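(* Let $D,M_p,M_i,k>0$ and $0<\alpha<1$. Let $\Omega\subset\mathbb{R}^n$, $n\geq2$, be a bounded Lipschitz domain of diameter at most $D$ whose complement is connected, and let $V=\chi_\Omega\varphi$ with $\varphi\in C^\alpha(\mathbb{R}^n)$ and $\|\varphi\|_{C^\alpha(\overline\Omega)}\leq M_p$. Let $u^i$ be an entire incident field with $\|u^i\|_{L^\infty(\mathbb{R}^n)}\leq1$ and $\|u^i\|_{C^{1,\alpha}(\mathbb{R}^n)}\leq M_i$. Assume that the medium scattering problem is uniformly well-posed. Then there exists a positive constant $\mathcal C$, depending only on $D,M_p,M_i,k,n,\alpha$, such that if \[ \sup_{\partial\Omega}|\varphi u^i|>\mathcal C\,\big(\operatorname{diam}(\Omega)\big)^\alpha, \] then $u^s_\infty\neq0$.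
   Context: Medium scattering: let $k>0$, let $V\in L^\infty(\mathbb{R}^n)$ be complex-valued with $\Im V\geq0$ and support in $\overline\Omega$. An incident field $u^i$ is an entire solution of $\Delta u^i+k^2u^i=0$ in $\mathbb{R}^n$. The total field $u=u^i+u^s\in H^2_{loc}(\mathbb{R}^n)$ solves $(\Delta+k^2(1+V))u=0$ in $\mathbb{R}^n$, and the scattered field $u^s$ satisfies the Sommerfeld radiation condition $\lim_{r\to\infty}r^{(n-1)/2}(\partial_r-ik)u^s=0$. The far-field pattern $u^s_\infty$ on $\mathbb{S}^{n-1}$ is defined by $u^s(x)=\frac{e^{ik|x|}}{|x|^{(n-1)/2}}u^s_\infty(x/|x|)+o(|x|^{-(n-1)/2})$ as $|x|\to\infty$ (equivalently $u^s_\infty(\hat x)=-k^2C_{n,k}\int e^{-ik\hat x\cdot y}(Vu)(y)\,dy$ for an explicit constant $C_{n,k}\neq0$). Uniform well-posedness: given $R_m,\mathcal M,k>0$, a ball $B_{R_m}$ of radius $R_m$, $V\in L^\infty(B_{R_m})$ extended by zero with $\|V\|_{L^\infty}\leq\mathcal M$, and an incident field with $|u^i|\leq1$ everywhere, the scattering is uniformly well-posed if there is a unique such $u^s\in H^2_{loc}(\mathbb{R}^n)$ and it satisfies $\|u^s\|_{H^2(B_{R_m})}\leq C$ for a constant $C=C(R_m,\mathcal M,k)$ depending only on $R_m,\mathcal M,k$. (Here this is assumed for balls containing $\Omega$ of radius comparable to $D$ and $\mathcal M=M_p$.) Standing assumption: bounded domains satisfy $H^2_0(\Omega)=\{u|_\Omega: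 u\in H^2(\mathbb{R}^n),\ u=0 \text{ in } \mathbb{R}^n\setminus\overline\Omega\}$. *)

theory Defs
  imports "HOL-Analysis.Analysis"
begin

definition pd :: "'a::euclidean_space \<Rightarrow> ('a \<Rightarrow> 'b::real_normed_vector) \<Rightarrow> 'a \<Rightarrow> 'b" where
  "pd b f x = frechet_derivative f (at x) b"

fun iter_pd :: "'a::euclidean_space list \<Rightarrow> ('a \<Rightarrow> 'b::real_normed_vector) \<Rightarrow> 'a \<Rightarrow> 'b" where
  "iter_pd [] f = f"
| "iter_pd (b # bs) f = pd b (iter_pd bs f)"

definition smooth :: "('a::euclidean_space \<Rightarrow> 'b::real_normed_vector) \<Rightarrow> bool" where
  "smooth f \<longleftrightarrow> (\<forall>bs. set bs \<subseteq> Basis \<longrightarrow> (\<forall>x. iter_pd bs f differentiable (at x)))"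

definition laplacian :: "('a::euclidean_space \<Rightarrow> 'b::real_normed_vector) \<Rightarrow> 'a \<Rightarrow> 'b" where
  "laplacian f x = (\<Sum>b\<in>Basis. pd b (pd b f) x)"

definition test_fn :: "('a::euclidean_space \<Rightarrow> real) \<Rightarrow> bool" where
  "test_fn \<phi> \<longleftrightarrow> smooth \<phi> \<and> (\<exists>K. compact K \<and> (\<forall>x. x \<notin> K \<longrightarrow> \<phi> x = 0))"

definition L2loc :: "('a::euclidean_space \<Rightarrow> complex) \<Rightarrow> bool" where
  "L2loc u \<longleftrightarrow> u \<in> borel_measurable lebesgue \<and>
     (\<forall>K. compact K \<longrightarrow> set_integrable lebesgue K (\<lambda>x. (norm (u x))\<^sup>2))"

definition weak_pd :: "'a::euclidean_space \<Rightarrow> ('a \<Rightarrow> complex) \<Rightarrow> ('a \<Rightarrow> complex) \<Rightarrow> bool" where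
  "weak_pd b u g \<longleftrightarrow> (\<forall>\<phi>. test_fn \<phi> \<longrightarrow>
     integral\<^sup>L lebesgue (\<lambda>x. u x * of_real (pd b \<phi> x)) = - integral\<^sup>L lebesgue (\<lambda>x. g x * of_real (\<phi> x)))"

definition H2_weak :: "('a::euclidean_space \<Rightarrow> complex) \<Rightarrow> ('a \<Rightarrow> 'a \<Rightarrow> complex) \<Rightarrow> ('a \<Rightarrow> 'a \<Rightarrow> 'a \<Rightarrow> complex) \<Rightarrow> bool" where
  "H2_weak u g1 g2 \<longleftrightarrow> L2loc u \<and>
     (\<forall>b\<in>Basis. L2loc (g1 b) \<and> weak_pd b u (g1 b) \<and>
        (\<forall>c\<in>Basis. L2loc (g2 b c) \<and> weak_pd c (g1 b) (g2 b c)))"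

definition H2loc :: "('a::euclidean_space \<Rightarrow> complex) \<Rightarrow> bool" where
  "H2loc u \<longleftrightarrow> (\<exists>g1 g2. H2_weak u g1 g2)"

definition H2_norm_le :: "'a::euclidean_space set \<Rightarrow> ('a \<Rightarrow> complex) \<Rightarrow> real \<Rightarrow> bool" where
  "H2_norm_le B u C \<longleftrightarrow> (\<exists>g1 g2. H2_weak u g1 g2 \<and>
     sqrt ((LINT x:B|lebesgue. (norm (u x))\<^sup>2)
         + (\<Sum>b\<in>Basis. LINT x:B|lebesgue. (norm (g1 b x))\<^sup>2)
         + (\<Sum>b\<in>Basis. \<Sum>c\<in>Basis. LINT x:B|lebesgue. (norm (g2 b c x))\<^sup>2)) \<le> C)"

definition incident_field :: "real \<Rightarrow> ('a::euclidean_space \<Rightarrow> complex) \<Rightarrow> bool" where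
  "incident_field k ui \<longleftrightarrow> smooth ui \<and> (\<forall>x. laplacian ui x + of_real (k\<^sup>2) * ui x = 0)"

definition radiating :: "real \<Rightarrow> ('a::euclidean_space \<Rightarrow> complex) \<Rightarrow> bool" where
  "radiating k us \<longleftrightarrow> (\<forall>\<^sub>F x in at_infinity. us differentiable (at x)) \<and>
     ((\<lambda>x. of_real (norm x powr ((real DIM('a) - 1) / 2)) *
        (frechet_derivative us (at x) (sgn x) - \<i> * of_real k * us x)) \<longlongrightarrow> 0) at_infinity"

definition scattered_field :: "real \<Rightarrow> ('a::euclidean_space \<Rightarrow> complex) \<Rightarrow> ('a \<Rightarrow> complex) \<Rightarrow> ('a \<Rightarrow> complex) \<Rightarrow> bool" where
  "scattered_field k V ui us \<longleftrightarrow> H2loc us \<and>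
     (\<forall>\<phi>. test_fn \<phi> \<longrightarrow>
        integral\<^sup>L lebesgue (\<lambda>x. (ui x + us x) *
          (of_real (laplacian \<phi> x) + of_real (k\<^sup>2) * (1 + V x) * of_real (\<phi> x))) = 0) \<and>
     radiating k us"

definition far_field :: "real \<Rightarrow> ('a::euclidean_space \<Rightarrow> complex) \<Rightarrow> ('a \<Rightarrow> complex) \<Rightarrow> bool" where
  "far_field k us F \<longleftrightarrow>
     ((\<lambda>x. of_real (norm x powr ((real DIM('a) - 1) / 2)) *
        (us x - exp (\<i> * of_real (k * norm x)) / of_real (norm x powr ((real DIM('a) - 1) / 2))
                 * F (sgn x))) \<longlongrightarrow> 0) at_infinity"

definition uniformly_well_posed :: "'a::euclidean_space itself \<Rightarrow> real \<Rightarrow> real \<Rightarrow> real \<Rightarrow> real \<Rightarrow> bool" where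
  "uniformly_well_posed TYPE('a) R M k C \<longleftrightarrow>
     (\<forall>(c::'a) (V::'a \<Rightarrow> complex) ui.
        V \<in> borel_measurable lebesgue \<and> (AE x in lebesgue. norm (V x) \<le> M) \<and>
        (AE x in lebesgue. Im (V x) \<ge> 0) \<and> (\<forall>x. x \<notin> ball c R \<longrightarrow> V x = 0) \<and>
        incident_field k ui \<and> (\<forall>x. norm (ui x) \<le> 1)
      \<longrightarrow> (\<exists>us. scattered_field k V ui us \<and>
             (\<forall>w. scattered_field k V ui w \<longrightarrow> (AE x in lebesgue. w x = us x)) \<and>
             H2_norm_le (ball c R) us C))"

definition lipschitz_domain :: "'a::euclidean_space set \<Rightarrow> bool" where
  "lipschitz_domain \<Omega> \<longleftrightarrow> open \<Omega> \<and> connected \<Omega> \<and> \<Omega> \<noteq> {} \<and>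
     (\<forall>p\<in>frontier \<Omega>. \<exists>(e::'a) r h L (g::'a \<Rightarrow> real).
        norm e = 1 \<and> r > 0 \<and> h > 0 \<and> L-lipschitz_on {y. y \<bullet> e = 0} g \<and>
        (let P = (\<lambda>x. x - (x \<bullet> e) *\<^sub>R e);
             Cyl = {x. norm (P x - P p) < r \<and> \<bar>x \<bullet> e - p \<bullet> e\<bar> < h}
         in \<Omega> \<inter> Cyl = {x \<in> Cyl. x \<bullet> e < g (P x)}))"

definition sup_bound :: "'a::metric_space set \<Rightarrow> ('a \<Rightarrow> 'b::real_normed_vector) \<Rightarrow> real \<Rightarrow> bool" where
  "sup_bound S f A \<longleftrightarrow> (\<forall>x\<in>S. norm (f x) \<le> A)"

definition holder_bound :: "'a::metric_space set \<Rightarrow> real \<Rightarrow> ('a \<Rightarrow> 'b::real_normed_vector) \<Rightarrow> real \<Rightarrow> bool" where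
  "holder_bound S \<alpha> f B \<longleftrightarrow> (\<forall>x\<in>S. \<forall>y\<in>S. norm (f x - f y) \<le> B * dist x y powr \<alpha>)"

definition C_alpha_norm_le :: "'a::metric_space set \<Rightarrow> real \<Rightarrow> ('a \<Rightarrow> 'b::real_normed_vector) \<Rightarrow> real \<Rightarrow> bool" where
  "C_alpha_norm_le S \<alpha> f M \<longleftrightarrow> (\<exists>A B. 0 \<le> A \<and> 0 \<le> B \<and> sup_bound S f A \<and> holder_bound S \<alpha> f B \<and> A + B \<le> M)"

definition C_alpha :: "'a::metric_space set \<Rightarrow> real \<Rightarrow> ('a \<Rightarrow> 'b::real_normed_vector) \<Rightarrow> bool" where
  "C_alpha S \<alpha> f \<longleftrightarrow> (\<exists>M. C_alpha_norm_le S \<alpha> f M)"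

definition C1_alpha_norm_le :: "'a::euclidean_space set \<Rightarrow> real \<Rightarrow> ('a \<Rightarrow> 'b::real_normed_vector) \<Rightarrow> real \<Rightarrow> bool" where
  "C1_alpha_norm_le S \<alpha> f M \<longleftrightarrow> (\<forall>x. f differentiable (at x)) \<and>
     (\<exists>A (A1::'a \<Rightarrow> real) (B1::'a \<Rightarrow> real). 0 \<le> A \<and> sup_bound S f A \<and>
        (\<forall>b\<in>Basis. 0 \<le> A1 b \<and> 0 \<le> B1 b \<and> sup_bound S (pd b f) (A1 b) \<and> holder_bound S \<alpha> (pd b f) (B1 b)) \<and>
        A + (\<Sum>b\<in>Basis. A1 b) + (\<Sum>b\<in>Basis. B1 b) \<le> M)"

end

theory Submission
  imports Defs "HOL-Computational_Algebra.Polynomial"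
begin

text \<open>Suppose the far field vanishes, so that \<open>v = u\<^sup>s\<close> is \<open>o(|x| ^ - (n - 1) / 2)\<close>, and put
  \<open>q = k\<^sup>2Vu\<close>. Every radial entire solution \<open>w\<close> of \<open>\<Delta>w + k\<^sup>2w = g\<close> with \<open>g\<close> a Gaussian (or \<open>0\<close>) is
  \<open>O(|x| ^ - (n - 1) / 2)\<close>, hence may be used as a test function: \<open>\<integral>vg + \<integral>qw = 0\<close>. With \<open>g = 0\<close> and
  \<open>w\<close> normalised at its centre \<open>z\<close> this says that \<open>Vu\<close> is orthogonal to a function close to \<open>1\<close> on a
  small \<open>\<Omega>\<close>. With \<open>g\<close> an approximate identity, \<open>w\<close> is a regularised fundamental solution bounded by
  \<open>|x| ^ - (n - 1)\<close>, and Schur's test gives \<open>\<parallel>v\<parallel> = O(diam \<Omega>) |\<Omega>|\<close> in \<open>L\<^sup>1(\<Omega>)\<close>. Together these force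
  \<open>\<phi>u\<^sup>i(z)\<close> to be \<open>O((diam \<Omega>) ^ \<alpha>)\<close>. For \<open>diam \<Omega>\<close> bounded below the bound
  \<open>|\<phi>u\<^sup>i| \<le> M\<^sub>p\<close> suffices.\<close>

section \<open>Smooth functions and a cutoff\<close>

text \<open>The field \<open>v\<close> is known only through integrals against compactly supported
  test functions and has no pointwise values, so estimates are made in L^1(\<Omega>), through
  Gaussian averages whose bounds do not depend on the width. Radial solutions are written as entire
  power series in |x - p|^2: no special functions, no singularity at the centre. Since
  \<open>v\<close> is o(|x|^(-(n-1)/2)), the test solutions may be standing waves; so a homogeneous
  solution can be subtracted from the regularised fundamental solution, and making it vanish at
  radius \<delta> gives a bound near the centre that is uniform in the width. The bound |x|^(-(n-1))
  is weaker than the true singularity (|x|^(2-n), or logarithmic in the plane), but it has the same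
  form in all dimensions and its integral over a ball of radius d is O(d). As |q| is at most k^2 Mp
  (1 + |v|), the L^1 estimate has \<open>v\<close> on both sides, and smallness of d absorbs it. The
  exponent \<alpha> comes from the oscillation of \<phi> over \<Omega>; the other errors are
  O(d).\<close>

lemma pd_eqI: "(f has_derivative D) (at x) \<Longrightarrow> pd b f x = D b"
  unfolding pd_def using frechet_derivative_at by metis

text \<open>\<open>iter_pd\<close> peels off the outermost derivative, while inductions on the order
  of smoothness need the innermost one removed, so that the statement for \<open>pd b f\<close> can
  be used.\<close>

lemma iter_pd_snoc: "iter_pd (bs @ [b]) f = iter_pd bs (pd b f)"
  by (induction bs) auto

text \<open>Smoothness graded by order. Closure under products and compositions is then an induction
  on \<open>n\<close>, since the derivative of a product or a composition has the same shape with
  one order less.\<close>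

definition times_diff :: "nat \<Rightarrow> ('a::euclidean_space \<Rightarrow> 'b::real_normed_vector) \<Rightarrow> bool" where
  "times_diff n f \<longleftrightarrow> (\<forall>bs. set bs \<subseteq> Basis \<and> length bs < n \<longrightarrow> (\<forall>x. iter_pd bs f differentiable (at x)))"

lemma smooth_iff_times_diff: "smooth f \<longleftrightarrow> (\<forall>n. times_diff n f)"
  unfolding smooth_def times_diff_def by (meson lessI)

lemma times_diff_0 [simp]: "times_diff 0 f"
  by (simp add: times_diff_def)

lemma times_diff_Suc:
  "times_diff (Suc n) f \<longleftrightarrow> (\<forall>x. f differentiable (at x)) \<and> (\<forall>b\<in>Basis. times_diff n (pd b f))"
proof
  assume L: "times_diff (Suc n) f"
  have "f differentiable (at x)" for x
    using L unfolding times_diff_def by (metis bot_least iter_pd.simps(1) list.set(1) list.size(3) zero_less_Suc)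
  moreover have "times_diff n (pd b f)" if "b \<in> Basis" for b
    unfolding times_diff_def
  proof (intro allI impI)
    fix bs :: "'a list" and x assume "set bs \<subseteq> Basis \<and> length bs < n"
    then have "set (bs @ [b]) \<subseteq> Basis \<and> length (bs @ [b]) < Suc n" using that by auto
    then show "iter_pd bs (pd b f) differentiable (at x)"
      using L unfolding times_diff_def iter_pd_snoc[symmetric] by blast
  qed
  ultimately show "(\<forall>x. f differentiable (at x)) \<and> (\<forall>b\<in>Basis. times_diff n (pd b f))" by blast
next
  assume R: "(\<forall>x. f differentiable (at x)) \<and> (\<forall>b\<in>Basis. times_diff n (pd b f))"
  show "times_diff (Suc n) f"
    unfolding times_diff_def
  proof (intro allI impI)
    fix bs :: "'a list" and x assume bs: "set bs \<subseteq> Basis \<and> length bs < Suc n"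
    show "iter_pd bs f differentiable (at x)"
    proof (cases bs rule: rev_cases)
      case Nil
      then show ?thesis using R by simp
    next
      case (snoc cs b)
      then have "b \<in> Basis" "set cs \<subseteq> Basis \<and> length cs < n" using bs by auto
      then have "iter_pd cs (pd b f) differentiable (at x)"
        using R unfolding times_diff_def by blast
      then show ?thesis unfolding snoc iter_pd_snoc .
    qed
  qed
qed

lemma times_diff_SucD: "times_diff (Suc n) f \<Longrightarrow> times_diff n f"
  unfolding times_diff_def by auto

lemma smooth_differentiable: "smooth f \<Longrightarrow> f differentiable (at x)"
  using times_diff_Suc[of 0] smooth_iff_times_diff by blast

lemma smooth_pd: "smooth f \<Longrightarrow> b \<in> Basis \<Longrightarrow> smooth (pd b f)"
  by (meson smooth_iff_times_diff times_diff_Suc)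

lemma smooth_continuous_on: "smooth f \<Longrightarrow> continuous_on S f"
  by (meson continuous_at_imp_continuous_on differentiable_imp_continuous_within smooth_differentiable)

lemma times_diff_const: "times_diff n (\<lambda>x::'a::euclidean_space. c)"
proof (induction n arbitrary: c)
  case (Suc n)
  have "pd b (\<lambda>x::'a. c) = (\<lambda>x. 0)" for b
    by (rule ext) (rule pd_eqI, auto intro!: derivative_eq_intros)
  then show ?case using Suc by (simp add: times_diff_Suc)
qed simp

lemma times_diff_add:
  assumes "times_diff n f" "times_diff n g"
  shows "times_diff n (\<lambda>x. f x + g x)"
  using assms
proof (induction n arbitrary: f g)
  case (Suc n)
  have d: "f differentiable (at x)" "g differentiable (at x)" for x
    using Suc.prems by (auto simp: times_diff_Suc)
  have "pd b (\<lambda>x. f x + g x) = (\<lambda>x. pd b f x + pd b g x)" for b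
  proof
    fix x
    show "pd b (\<lambda>x. f x + g x) x = pd b f x + pd b g x"
      unfolding pd_def[of b f] pd_def[of b g]
      by (rule pd_eqI) (auto intro!: derivative_eq_intros d[unfolded frechet_derivative_works])
  qed
  then show ?case using Suc d by (simp add: times_diff_Suc)
qed simp

lemma pd_mult:
  fixes f g :: "'a::euclidean_space \<Rightarrow> 'b::real_normed_algebra"
  assumes "f differentiable (at x)" "g differentiable (at x)"
  shows "pd b (\<lambda>x. f x * g x) x = f x * pd b g x + pd b f x * g x"
  unfolding pd_def[of b f] pd_def[of b g]
  by (rule pd_eqI) (auto intro!: derivative_eq_intros assms[unfolded frechet_derivative_works])

lemma times_diff_mult:
  fixes f g :: "'a::euclidean_space \<Rightarrow> 'b::real_normed_algebra"
  assumes "times_diff n f" "times_diff n g"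
  shows "times_diff n (\<lambda>x. f x * g x)"
  using assms
proof (induction n arbitrary: f g)
  case (Suc n)
  have d: "f differentiable (at x)" "g differentiable (at x)" for x
    using Suc.prems by (auto simp: times_diff_Suc)
  have "pd b (\<lambda>x. f x * g x) = (\<lambda>x. f x * pd b g x + pd b f x * g x)" for b
    using pd_mult d by blast
  moreover have "times_diff n (\<lambda>x. f x * pd b g x + pd b f x * g x)" if "b \<in> Basis" for b
    using that Suc.prems times_diff_SucD[OF Suc.prems(1)] times_diff_SucD[OF Suc.prems(2)]
    by (intro times_diff_add Suc.IH) (simp_all add: times_diff_Suc)
  ultimately show ?case using d by (auto simp: times_diff_Suc intro!: derivative_intros)
qed simp

text \<open>\<open>H m\<close> is the m-th derivative of \<open>H 0\<close>. Carrying the whole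
  sequence names all derivatives at once and makes chain-rule inductions uniform in
  \<open>m\<close>.\<close>

definition derivs :: "(nat \<Rightarrow> real \<Rightarrow> real) \<Rightarrow> bool" where
  "derivs H \<longleftrightarrow> (\<forall>m s. (H m has_real_derivative H (Suc m) s) (at s))"

lemma derivsD: "derivs H \<Longrightarrow> (H m has_real_derivative H (Suc m) s) (at s)"
  by (simp add: derivs_def)

lemma pd_compose:
  fixes f :: "'a::euclidean_space \<Rightarrow> real"
  assumes "(h has_real_derivative h') (at (f x))" "f differentiable (at x)"
  shows "pd b (\<lambda>x. h (f x)) x = h' * pd b f x"
    and "(\<lambda>x. h (f x)) differentiable (at x)"
proof -
  have *: "((\<lambda>x. h (f x)) has_derivative (\<lambda>y. h' * frechet_derivative f (at x) y)) (at x)"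
    using DERIV_compose_FDERIV[OF assms(1) assms(2)[unfolded frechet_derivative_works]]
    by (simp add: mult.commute)
  then show "pd b (\<lambda>x. h (f x)) x = h' * pd b f x"
    unfolding pd_def[of b f] by (rule pd_eqI)
  show "(\<lambda>x. h (f x)) differentiable (at x)"
    using * unfolding differentiable_def by blast
qed

text \<open>The derivative of \<open>H m (f x)\<close> contains \<open>H (Suc m) (f x)\<close>, so
  the induction on \<open>n\<close> has to treat all members of the sequence together.\<close>

lemma times_diff_compose:
  fixes f :: "'a::euclidean_space \<Rightarrow> real"
  assumes "derivs H" "times_diff n f"
  shows "times_diff n (\<lambda>x. H m (f x))"
  using assms(2)
proof (induction n arbitrary: m)
  case (Suc n)
  have d: "f differentiable (at x)" for x
    using Suc.prems by (auto simp: times_diff_Suc)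
  have "pd b (\<lambda>x. H m (f x)) = (\<lambda>x. H (Suc m) (f x) * pd b f x)" for b
    using pd_compose(1)[OF derivsD[OF assms(1)] d] by blast
  moreover have "times_diff n (\<lambda>x. H (Suc m) (f x) * pd b f x)" if "b \<in> Basis" for b
    using that Suc.prems times_diff_SucD[OF Suc.prems]
    by (intro times_diff_mult Suc.IH) (simp_all add: times_diff_Suc)
  ultimately show ?case
    using pd_compose(2)[OF derivsD[OF assms(1)] d] by (auto simp: times_diff_Suc)
qed simp

lemma smooth_compose:
  fixes f :: "'a::euclidean_space \<Rightarrow> real"
  shows "derivs H \<Longrightarrow> smooth f \<Longrightarrow> smooth (\<lambda>x. H m (f x))"
  by (simp add: smooth_iff_times_diff times_diff_compose)

lemma smooth_mult:
  fixes f g :: "'a::euclidean_space \<Rightarrow> 'b::real_normed_algebra"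
  shows "smooth f \<Longrightarrow> smooth g \<Longrightarrow> smooth (\<lambda>x. f x * g x)"
  by (simp add: smooth_iff_times_diff times_diff_mult)

lemma smooth_const: "smooth (\<lambda>x. c)"
  by (simp add: smooth_iff_times_diff times_diff_const)

lemma smooth_add: "smooth f \<Longrightarrow> smooth g \<Longrightarrow> smooth (\<lambda>x. f x + g x)"
  by (simp add: smooth_iff_times_diff times_diff_add)

lemma pd_linear_coord: "pd b (\<lambda>x::'a::euclidean_space. c * ((x - p) \<bullet> e)) x = c * (b \<bullet> e)"
  by (rule pd_eqI) (auto intro!: derivative_eq_intros)

lemma pd_norm_sq: "pd b (\<lambda>x::'a::euclidean_space. (norm (x - p))\<^sup>2) = (\<lambda>x. 2 * ((x - p) \<bullet> b))"
proof
  fix x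
  show "pd b (\<lambda>x. (norm (x - p))\<^sup>2) x = 2 * ((x - p) \<bullet> b)"
    unfolding power2_norm_eq_inner
    by (rule pd_eqI) (auto intro!: derivative_eq_intros simp: inner_commute)
qed

text \<open>First derivatives are affine and second derivatives constant, so every order from two on
  reduces to \<open>times_diff_const\<close>; the lower orders follow from
  \<open>times_diff_SucD\<close>.\<close>

lemma smooth_norm_sq: "smooth (\<lambda>x::'a::euclidean_space. (norm (x - p))\<^sup>2)"
proof -
  have d1: "(\<lambda>x::'a. 2 * ((x - p) \<bullet> b)) differentiable (at x)" for b x
    by (rule differentiableI) (auto intro!: derivative_eq_intros)
  have d0: "(\<lambda>x::'a. (norm (x - p))\<^sup>2) differentiable (at x)" for x
    unfolding power2_norm_eq_inner by (rule differentiableI) (auto intro!: derivative_eq_intros)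
  have "times_diff (Suc (Suc n)) (\<lambda>x::'a. (norm (x - p))\<^sup>2)" for n
  proof -
    have "pd b (\<lambda>x::'a. 2 * ((x - p) \<bullet> c)) = (\<lambda>x. 2 * (b \<bullet> c))" for b c
      using pd_linear_coord by blast
    then show ?thesis
      unfolding times_diff_Suc pd_norm_sq using d0 d1 by (simp add: times_diff_const)
  qed
  then show ?thesis
    unfolding smooth_iff_times_diff using times_diff_SucD by blast
qed

text \<open>With s = |x - p|^2 as radial variable no singularity arises at \<open>p\<close>. The
  factor 4s is |grad s|^2 and 2n is the Laplacian of s.\<close>

lemma laplacian_radial:
  fixes p :: "'a::euclidean_space"
  assumes f: "\<And>s. (f has_real_derivative f1 s) (at s)" "\<And>s. (f1 has_real_derivative f2 s) (at s)"
  shows "laplacian (\<lambda>x. f ((norm (x - p))\<^sup>2)) x =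
    4 * (norm (x - p))\<^sup>2 * f2 ((norm (x - p))\<^sup>2) + 2 * real DIM('a) * f1 ((norm (x - p))\<^sup>2)"
proof -
  let ?s = "\<lambda>x::'a. (norm (x - p))\<^sup>2"
  have ds: "?s differentiable (at x)" for x by (rule smooth_differentiable[OF smooth_norm_sq])
  have 1: "pd b (\<lambda>x. f (?s x)) = (\<lambda>x. f1 (?s x) * (2 * ((x - p) \<bullet> b)))" for b
    using pd_compose(1)[OF f(1) ds] by (auto simp: pd_norm_sq)
  have 2: "pd b (pd b (\<lambda>x. f (?s x))) x = f1 (?s x) * (2 * (b \<bullet> b)) + f2 (?s x) * (4 * ((x - p) \<bullet> b)\<^sup>2)" for b
  proof -
    have "(\<lambda>x::'a. 2 * ((x - p) \<bullet> b)) differentiable (at x)"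
      by (rule differentiableI) (auto intro!: derivative_eq_intros)
    then have "pd b (pd b (\<lambda>x. f (?s x))) x = f1 (?s x) * (2 * (b \<bullet> b))
        + f2 (?s x) * pd b ?s x * (2 * ((x - p) \<bullet> b))"
      unfolding 1
      by (subst pd_mult[OF pd_compose(2)[OF f(2) ds]])
         (simp_all only: pd_linear_coord pd_compose(1)[OF f(2) ds])
    then show ?thesis unfolding pd_norm_sq by (simp add: power2_eq_square[of "(x - p) \<bullet> b"])
  qed
  have 3: "(\<Sum>b\<in>Basis. ((x - p) \<bullet> b)\<^sup>2) = ?s x"
    by (metis (mono_tags, lifting) euclidean_inner power2_eq_square power2_norm_eq_inner sum.cong)
  show ?thesis
  proof -
    have "laplacian (\<lambda>x. f (?s x)) x =
        (\<Sum>b\<in>(Basis::'a set). 2 * f1 (?s x)) + (\<Sum>b\<in>Basis. 4 * f2 (?s x) * ((x - p) \<bullet> b)\<^sup>2)"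
      unfolding laplacian_def 2 sum.distrib by (intro arg_cong2[of _ _ _ _ "(+)"] sum.cong) auto
    also have "\<dots> = 2 * real DIM('a) * f1 (?s x) + 4 * f2 (?s x) * ?s x"
      unfolding sum_distrib_left[symmetric] 3 by simp
    finally show ?thesis by (simp add: mult_ac)
  qed
qed

section \<open>The function exp(-1/t) and a smooth cutoff\<close>

lemma poly_exp_tendsto_0: "((\<lambda>y::real. y ^ k * poly p y * exp (- y)) \<longlongrightarrow> 0) at_top"
proof (induction p arbitrary: k)
  case 0
  then show ?case by simp
next
  \<comment> \<open>Passing to the remaining coefficients multiplies by one more y, which the free
    exponent \<open>k\<close> takes up.\<close>
  case (pCons a p)
  have "((\<lambda>y::real. a * (y ^ k / exp y) + y ^ Suc k * poly p y * exp (- y)) \<longlongrightarrow> a * 0 + 0) at_top"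
    by (intro tendsto_intros tendsto_power_div_exp_0 pCons.IH)
  moreover have "a * (y ^ k / exp y) + y ^ Suc k * poly p y * exp (- y)
      = y ^ k * poly (pCons a p) y * exp (- y)" for y
    by (simp add: exp_minus divide_inverse) (simp add: algebra_simps)
  ultimately show ?case by (simp only: mult_zero_right add_0_left)
qed

text \<open>The derivative of P(1/t) exp(-1/t) is Q(1/t) exp(-1/t) with Q(y) = y^2 (P(y) - P'(y));
  \<open>[:0, 0, 1:]\<close> is y^2.\<close>

fun flat_poly :: "nat \<Rightarrow> real poly" where
  "flat_poly 0 = 1"
| "flat_poly (Suc m) = [:0, 0, 1:] * (flat_poly m - pderiv (flat_poly m))"

text \<open>\<open>flat 0\<close> is the classical function exp(-1/t), extended by zero to t \<le>
  0; \<open>flat m\<close> is its m-th derivative.\<close>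

definition flat :: "nat \<Rightarrow> real \<Rightarrow> real" where
  "flat m t = (if t > 0 then poly (flat_poly m) (1 / t) * exp (- (1 / t)) else 0)"

lemma poly_flat_poly_Suc:
  "poly (flat_poly (Suc m)) y = y\<^sup>2 * (poly (flat_poly m) y - poly (pderiv (flat_poly m)) y)"
  by (simp add: power2_eq_square)

declare flat_poly.simps(2) [simp del]

lemma derivs_flat: "derivs flat"
  unfolding derivs_def
proof (intro allI)
  fix m and t :: real
  consider "t > 0" | "t < 0" | "t = 0" by linarith
  then show "(flat m has_real_derivative flat (Suc m) t) (at t)"
  proof cases
    case 1
    have "((\<lambda>t. poly (flat_poly m) (1 / t) * exp (- (1 / t))) has_real_derivative flat (Suc m) t) (at t)"
    proof -
      let ?P = "flat_poly m"
      have i: "((\<lambda>t. 1 / t) has_real_derivative - (1 / t)\<^sup>2) (at t)"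
        using DERIV_inverse[of t UNIV] 1 by (simp add: divide_inverse power2_eq_square)
      have "((\<lambda>t. poly ?P (1 / t) * exp (- (1 / t))) has_real_derivative
          poly (pderiv ?P) (1 / t) * - (1 / t)\<^sup>2 * exp (- (1 / t)) +
          exp (- (1 / t)) * - (- (1 / t)\<^sup>2) * poly ?P (1 / t)) (at t)"
        by (intro DERIV_mult DERIV_chain2[OF poly_DERIV i] DERIV_chain2[OF DERIV_exp DERIV_minus[OF i]])
      moreover have "poly (pderiv ?P) (1 / t) * - (1 / t)\<^sup>2 * exp (- (1 / t)) +
          exp (- (1 / t)) * - (- (1 / t)\<^sup>2) * poly ?P (1 / t) = flat (Suc m) t"
        using 1 unfolding flat_def poly_flat_poly_Suc by (simp add: algebra_simps)
      ultimately show ?thesis by simp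
    qed
    moreover have "\<forall>\<^sub>F s in nhds t. s > 0"
      using 1 eventually_nhds_in_open[of "{0<..}" t] by simp
    then have ev: "\<forall>\<^sub>F s in nhds t. flat m s = poly (flat_poly m) (1 / s) * exp (- (1 / s))"
      by eventually_elim (simp add: flat_def)
    ultimately show ?thesis by (subst DERIV_cong_ev[OF refl ev refl])
  next
    case 2
    have "\<forall>\<^sub>F s in nhds t. s < 0"
      using 2 eventually_nhds_in_open[of "{..<0}" t] by simp
    then have ev: "\<forall>\<^sub>F s in nhds t. flat m s = 0"
      by eventually_elim (simp add: flat_def)
    moreover have "((\<lambda>_. 0) has_real_derivative flat (Suc m) t) (at t)"
      using 2 by (simp add: flat_def)
    ultimately show ?thesis by (subst DERIV_cong_ev[OF refl ev refl])
  next
    case 3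
    \<comment> \<open>With y = 1/h this is the difference quotient at 0 from the right: dividing by
      h contributes the extra factor y.\<close>
    have "((\<lambda>y. y ^ 1 * poly (flat_poly m) y * exp (- y)) \<longlongrightarrow> 0) at_top"
      by (rule poly_exp_tendsto_0)
    then have "((\<lambda>h. inverse h ^ 1 * poly (flat_poly m) (inverse h) * exp (- inverse h)) \<longlongrightarrow> 0) (at_right (0::real))"
      by (rule filterlim_compose) (rule filterlim_inverse_at_top_right)
    moreover have "\<forall>\<^sub>F h in at_right (0::real). inverse h ^ 1 * poly (flat_poly m) (inverse h) * exp (- inverse h)
        = (flat m (0 + h) - flat m 0) / h"
      by (simp add: eventually_at_filter flat_def divide_inverse)
    ultimately have r: "((\<lambda>h. (flat m (0 + h) - flat m 0) / h) \<longlongrightarrow> 0) (at_right 0)"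
      by (rule Lim_transform_eventually)
    have "\<forall>\<^sub>F h in at_left (0::real). 0 = (flat m (0 + h) - flat m 0) / h"
      by (simp add: eventually_at_filter flat_def)
    then have l: "((\<lambda>h. (flat m (0 + h) - flat m 0) / h) \<longlongrightarrow> 0) (at_left 0)"
      by (rule Lim_transform_eventually[rotated]) simp
    have "flat (Suc m) 0 = 0" by (simp add: flat_def)
    then show ?thesis
      unfolding DERIV_def 3 using filterlim_split_at[OF l r] by simp
  qed
qed

lemma flat_0_pos: "t > 0 \<Longrightarrow> flat 0 t > 0" by (simp add: flat_def)
lemma flat_nonpos: "t \<le> 0 \<Longrightarrow> flat m t = 0" by (simp add: flat_def)
lemma flat_0_mono: "s \<le> t \<Longrightarrow> flat 0 s \<le> flat 0 t"
  by (auto simp: flat_def frac_le)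

text \<open>Nesting \<open>flat 0\<close> in itself, with only constants in the denominators, keeps
  smoothness a matter of sums, products and compositions. The thresholds 1 and 4 are squares:
  applied to |x - p|^2 / R^2, the transition takes place between the radii R and 2R.\<close>

definition cutoff :: "real \<Rightarrow> real" where
  "cutoff t = flat 0 (1 - flat 0 (t - 1) / flat 0 3) / flat 0 1"

lemma cutoff_le_1: "t \<le> 1 \<Longrightarrow> cutoff t = 1"
  using flat_0_pos[of 1] by (simp add: cutoff_def flat_nonpos)

lemma cutoff_ge_4: "t \<ge> 4 \<Longrightarrow> cutoff t = 0"
  using flat_0_mono[of 3 "t - 1"] flat_0_pos[of 3] by (simp add: cutoff_def flat_nonpos)

lemma cutoff_bounds: "0 \<le> cutoff t" "cutoff t \<le> 1"
proof -
  have nn: "flat 0 s \<ge> 0" for s by (simp add: flat_def)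
  show "0 \<le> cutoff t" by (simp add: cutoff_def nn)
  have "flat 0 (1 - flat 0 (t - 1) / flat 0 3) \<le> flat 0 1"
    by (intro flat_0_mono) (simp add: nn)
  then show "cutoff t \<le> 1" using flat_0_pos[of 1] by (simp add: cutoff_def)
qed

lemma smooth_cutoff:
  fixes f :: "'a::euclidean_space \<Rightarrow> real"
  assumes "smooth f"
  shows "smooth (\<lambda>x. cutoff (f x))"
proof -
  have "smooth (\<lambda>x. flat 0 (f x + (- 1)))"
    by (intro smooth_compose[OF derivs_flat] smooth_add smooth_const assms)
  then have "smooth (\<lambda>x. 1 + (- 1 / flat 0 3) * flat 0 (f x + (- 1)))"
    by (intro smooth_add smooth_mult smooth_const)
  then have "smooth (\<lambda>x. (1 / flat 0 1) * flat 0 (1 + (- 1 / flat 0 3) * flat 0 (f x + (- 1))))"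
    by (intro smooth_mult smooth_const smooth_compose[OF derivs_flat])
  then show ?thesis by (simp add: cutoff_def)
qed

text \<open>What the commutator with the Laplacian requires: two derivatives that vanish off [1,4],
  with a common bound, which comes from continuity on this compact interval.\<close>

lemma cutoff_derivs:
  obtains c1 c2 K where
    "\<And>t. (cutoff has_real_derivative c1 t) (at t)" "\<And>t. (c1 has_real_derivative c2 t) (at t)"
    "\<And>t. t < 1 \<or> t > 4 \<Longrightarrow> c1 t = 0 \<and> c2 t = 0"
    "\<And>t. \<bar>c1 t\<bar> \<le> K \<and> \<bar>c2 t\<bar> \<le> K"
proof -
  let ?u = "\<lambda>t. 1 - flat 0 (t - 1) / flat 0 3"
  define c1 where "c1 = (\<lambda>t. - flat 1 (?u t) * flat 1 (t - 1) / (flat 0 3 * flat 0 1))"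
  define c2 where "c2 = (\<lambda>t. (flat 2 (?u t) * (flat 1 (t - 1))\<^sup>2 / flat 0 3 - flat 1 (?u t) * flat 2 (t - 1))
      / (flat 0 3 * flat 0 1))"
  have p: "flat 0 3 > 0" "flat 0 1 > 0" by (simp_all add: flat_0_pos)
  have D: "(flat 0 has_real_derivative flat 1 t) (at t)" "(flat 1 has_real_derivative flat 2 t) (at t)" for t
    using derivsD[OF derivs_flat, of 0 t] derivsD[OF derivs_flat, of 1 t] by (simp_all add: numeral_2_eq_2)
  have D': "((\<lambda>t. flat 0 (t - 1)) has_real_derivative flat 1 (t - 1)) (at t)"
    "((\<lambda>t. flat 1 (t - 1)) has_real_derivative flat 2 (t - 1)) (at t)" for t
    using DERIV_chain2[OF D(1), of "\<lambda>t. t - 1" 1 t UNIV] DERIV_chain2[OF D(2), of "\<lambda>t. t - 1" 1 t UNIV]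
    by (simp_all add: DERIV_diff[of "\<lambda>t. t" 1 _ _ "\<lambda>t. 1" 0, simplified])
  have u: "(?u has_real_derivative - (flat 1 (t - 1) / flat 0 3)) (at t)" for t
    using DERIV_diff[OF DERIV_const[of 1 "at t"] DERIV_cdivide[OF D'(1)[of t], of "flat 0 3"]] by simp
  have 1: "(cutoff has_real_derivative c1 t) (at t)" for t
    using DERIV_cdivide[OF DERIV_chain2[OF D(1) u[of t]], of "flat 0 1"]
    by (simp add: cutoff_def[abs_def] c1_def)
  have 2: "(c1 has_real_derivative c2 t) (at t)" for t
  proof -
    have "((\<lambda>t. - (flat 1 (?u t) * flat 1 (t - 1)) / (flat 0 3 * flat 0 1)) has_real_derivative
      - (flat 2 (?u t) * - (flat 1 (t - 1) / flat 0 3) * flat 1 (t - 1) + flat 2 (t - 1) * flat 1 (?u t))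
        / (flat 0 3 * flat 0 1)) (at t)"
      by (rule DERIV_cdivide[OF DERIV_minus[OF DERIV_mult[OF DERIV_chain2[OF D(2) u] D'(2)]]])
    moreover have "- (flat 2 (?u t) * - (flat 1 (t - 1) / flat 0 3) * flat 1 (t - 1) + flat 2 (t - 1) * flat 1 (?u t))
      = flat 2 (?u t) * (flat 1 (t - 1))\<^sup>2 / flat 0 3 - flat 1 (?u t) * flat 2 (t - 1)"
      by (simp add: power2_eq_square mult_ac)
    ultimately show ?thesis by (simp only: c1_def c2_def mult_minus_left)
  qed
  have 3: "c1 t = 0 \<and> c2 t = 0" if "t < 1 \<or> t > 4" for t
  proof (cases "t < 1")
    case True
    then show ?thesis by (simp add: c1_def c2_def flat_nonpos)
  next
    case False
    then have "?u t \<le> 0" using that flat_0_mono[of 3 "t - 1"] p by simp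
    then show ?thesis by (simp add: c1_def c2_def flat_nonpos)
  qed
  have cF: "isCont (flat m) t" for m t
    using derivsD[OF derivs_flat] DERIV_isCont by blast
  then have cF': "continuous_on UNIV (flat m)" for m
    by (simp add: continuous_at_imp_continuous_on)
  have "continuous_on {1..4} c1" "continuous_on {1..4} c2"
    unfolding c1_def c2_def using p
    by (auto intro!: continuous_intros continuous_on_compose2[OF cF'])
  then have "bounded (c1 ` {1..4})" "bounded (c2 ` {1..4})"
    by (auto intro!: compact_imp_bounded compact_continuous_image)
  then obtain K1 K2 where K: "\<forall>t\<in>{1..4}. \<bar>c1 t\<bar> \<le> K1" "\<forall>t\<in>{1..4}. \<bar>c2 t\<bar> \<le> K2"
    unfolding bounded_iff by (auto)
  have 4: "\<bar>c1 t\<bar> \<le> \<bar>K1\<bar> + \<bar>K2\<bar> \<and> \<bar>c2 t\<bar> \<le> \<bar>K1\<bar> + \<bar>K2\<bar>" for t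
  proof (cases "t \<in> {1..4}")
    case True
    then show ?thesis using K by fastforce
  next
    case False
    then show ?thesis using 3[of t] by auto
  qed
  show thesis using that[OF 1 2 3 4] by blast
qed

section \<open>Radial entire solutions of the Helmholtz equation\<close>

text \<open>The index \<open>m\<close> counts termwise derivatives, so for an everywhere convergent
  series \<open>power_series a\<close> is a sequence in the sense of \<open>derivs\<close>.\<close>

definition power_series :: "(nat \<Rightarrow> real) \<Rightarrow> nat \<Rightarrow> real \<Rightarrow> real" where
  "power_series a m s = (\<Sum>i. (diffs ^^ m) a i * s ^ i)"

lemma derivs_power_series:
  assumes "\<And>s. summable (\<lambda>i. a i * s ^ i)"
  shows "derivs (power_series a)"
proof -
  have "\<And>s. summable (\<lambda>i. (diffs ^^ m) a i * s ^ i)" for m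
    by (induction m) (simp_all add: assms termdiff_converges_all)
  then show ?thesis
    unfolding derivs_def power_series_def using termdiffs_strong_converges_everywhere by fastforce
qed

text \<open>The series of f', s f'' and f are all written in the powers s^i, ready for comparing
  coefficients in 4s f'' + 2n f' + k^2 f. For s f'' this is an index shift whose term at i = 0
  vanishes.\<close>

lemma power_series_sums:
  fixes a :: "nat \<Rightarrow> real"
  assumes "\<And>s. summable (\<lambda>i. a i * s ^ i)"
  shows "(\<lambda>i. diffs a i * s ^ i) sums power_series a 1 s"
    and "(\<lambda>i. real i * diffs a i * s ^ i) sums (s * power_series a 2 s)"
    and "(\<lambda>i. a i * s ^ i) sums power_series a 0 s"
proof -
  have s1: "\<And>s. summable (\<lambda>i. diffs a i * s ^ i)"
    by (simp add: assms termdiff_converges_all)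
  have s2: "\<And>s. summable (\<lambda>i. diffs (diffs a) i * s ^ i)"
    by (simp add: s1 termdiff_converges_all)
  show "(\<lambda>i. diffs a i * s ^ i) sums power_series a 1 s"
    using s1 by (simp add: power_series_def summable_sums)
  show "(\<lambda>i. a i * s ^ i) sums power_series a 0 s"
    using assms by (simp add: power_series_def summable_sums)
  have "(\<lambda>i. s * (diffs (diffs a) i * s ^ i)) sums (s * power_series a 2 s)"
    using s2 by (intro sums_mult) (simp add: power_series_def summable_sums numeral_2_eq_2)
  then have "(\<lambda>i. real (Suc i) * diffs a (Suc i) * s ^ Suc i) sums (s * power_series a 2 s)"
    by (simp add: diffs_def mult_ac)
  then show "(\<lambda>i. real i * diffs a i * s ^ i) sums (s * power_series a 2 s)"
    using sums_Suc_iff[of "\<lambda>i. real i * diffs a i * s ^ i"] by simp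
qed

definition radial_sol :: "nat \<Rightarrow> real \<Rightarrow> (real \<Rightarrow> real) \<Rightarrow> (nat \<Rightarrow> real \<Rightarrow> real) \<Rightarrow> bool" where
  "radial_sol n k g H \<longleftrightarrow> derivs H \<and> (\<forall>s. 4 * s * H 2 s + 2 * real n * H 1 s + k\<^sup>2 * H 0 s = g s)"

text \<open>Comparing coefficients in \<open>4sh'' + 2nh' + k\<^sup>2h = G exp(-bs)\<close>, which is \<open>\<Delta>w + k\<^sup>2w = G exp(-b|x|\<^sup>2)\<close>
  for \<open>w(x) = h(|x|\<^sup>2)\<close>; the value \<open>h0\<close> at the origin is free.\<close>
fun sol_coeff :: "nat \<Rightarrow> real \<Rightarrow> real \<Rightarrow> real \<Rightarrow> real \<Rightarrow> nat \<Rightarrow> real" where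
  "sol_coeff n k G b h0 0 = h0"
| "sol_coeff n k G b h0 (Suc m) =
     (G * (- b) ^ m / fact m - k\<^sup>2 * sol_coeff n k G b h0 m) / (real (Suc m) * (4 * real m + 2 * real n))"

text \<open>The factor m + 1 in the denominator of the recursion produces the factorial, which makes
  the series entire. The base Q = k^2 + b + 1 satisfies b \<le> Q and k^2 \<le> Q - 1; the spare 1
  pays for the Gaussian coefficient.\<close>

lemma sol_coeff_bound:
  assumes "n \<ge> 2" "b \<ge> 0"
  shows "\<bar>sol_coeff n k G b h0 m\<bar> \<le> (\<bar>h0\<bar> + \<bar>G\<bar>) * (k\<^sup>2 + b + 1) ^ m / fact m"
proof (induction m)
  case 0
  then show ?case by simp
next
  case (Suc m)
  define A Q where "A = \<bar>h0\<bar> + \<bar>G\<bar>" and "Q = k\<^sup>2 + b + 1"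
  have Q: "Q \<ge> 1" "b \<le> Q" "k\<^sup>2 \<le> Q - 1" "Q > 0" "A \<ge> 0" "\<bar>G\<bar> \<le> A"
    using assms zero_le_power2[of k] unfolding A_def Q_def by linarith+
  let ?c = "sol_coeff n k G b h0 m"
  have "\<bar>G * (- b) ^ m / fact m - k\<^sup>2 * ?c\<bar> \<le> \<bar>G\<bar> * b ^ m / fact m + k\<^sup>2 * \<bar>?c\<bar>"
    using assms by (simp add: abs_mult power_abs abs_triangle_ineq4[THEN order_trans])
  also have "\<dots> \<le> A * Q ^ m / fact m + (Q - 1) * (A * Q ^ m / fact m)"
    using Suc Q assms unfolding A_def[symmetric] Q_def[symmetric]
    by (intro add_mono divide_right_mono mult_mono power_mono) auto
  also have "\<dots> = A * Q ^ Suc m / fact m" by (simp add: field_simps)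
  finally have 1: "\<bar>G * (- b) ^ m / fact m - k\<^sup>2 * ?c\<bar> \<le> A * Q ^ Suc m / fact m" .
  have "\<bar>sol_coeff n k G b h0 (Suc m)\<bar> =
      \<bar>G * (- b) ^ m / fact m - k\<^sup>2 * ?c\<bar> / (real (Suc m) * (4 * real m + 2 * real n))"
    by (simp add: abs_mult)
  also have "\<dots> \<le> (A * Q ^ Suc m / fact m) / real (Suc m)"
  proof (rule frac_le)
    have "4 * real m + 2 * real n \<ge> 1" using assms by simp
    then show "real (Suc m) \<le> real (Suc m) * (4 * real m + 2 * real n)"
      by (metis mult.right_neutral mult_left_mono of_nat_0_le_iff)
  qed (use 1 Q in auto)
  also have "\<dots> = A * Q ^ Suc m / fact (Suc m)" by (simp add: field_simps)
  finally show ?case unfolding A_def Q_def .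
qed

text \<open>With G = 0 and h0 = 1 this is the spherical standing wave regular at the origin, a
  normalised Bessel function; with G = N^n and b = N^2 it is, up to a constant factor, a regularised
  fundamental solution.\<close>

lemma radial_sol_exists:
  assumes "n \<ge> 2" "b \<ge> 0"
  obtains H where "radial_sol n k (\<lambda>s. G * exp (- b * s)) H" "H 0 0 = h0"
proof -
  let ?a = "sol_coeff n k G b h0"
  have sm: "summable (\<lambda>i. ?a i * s ^ i)" for s
  proof (rule summable_comparison_test')
    show "summable (\<lambda>i. (\<bar>h0\<bar> + \<bar>G\<bar>) * (inverse (fact i) * ((k\<^sup>2 + b + 1) * \<bar>s\<bar>) ^ i))"
      by (intro summable_mult summable_exp)
    fix i :: nat
    have "norm (?a i * s ^ i) \<le> (\<bar>h0\<bar> + \<bar>G\<bar>) * (k\<^sup>2 + b + 1) ^ i / fact i * \<bar>s\<bar> ^ i"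
      unfolding real_norm_def abs_mult power_abs by (intro mult_right_mono sol_coeff_bound[OF assms]) simp
    then show "norm (?a i * s ^ i) \<le> (\<bar>h0\<bar> + \<bar>G\<bar>) * (inverse (fact i) * ((k\<^sup>2 + b + 1) * \<bar>s\<bar>) ^ i)"
      by (simp add: power_mult_distrib divide_inverse mult_ac)
  qed
  have "4 * s * power_series ?a 2 s + 2 * real n * power_series ?a 1 s + k\<^sup>2 * power_series ?a 0 s
      = G * exp (- b * s)" for s
  proof -
    have "(\<lambda>i. 4 * (real i * diffs ?a i * s ^ i) + 2 * real n * (diffs ?a i * s ^ i) + k\<^sup>2 * (?a i * s ^ i))
      sums (4 * (s * power_series ?a 2 s) + 2 * real n * power_series ?a 1 s + k\<^sup>2 * power_series ?a 0 s)"
      by (intro sums_add sums_mult power_series_sums sm)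
    \<comment> \<open>The recursion multiplied out: \<open>diffs ?a i\<close> is i + 1 times the
      next coefficient, and the other factor 4i + 2n of the denominator is positive.\<close>
    moreover have "4 * (real i * diffs ?a i * s ^ i) + 2 * real n * (diffs ?a i * s ^ i) + k\<^sup>2 * (?a i * s ^ i)
       = G * ((- b * s) ^ i /\<^sub>R fact i)" for i
    proof -
      have "4 * real i + 2 * real n > 0" using assms by simp
      then have "(4 * real i + 2 * real n) * diffs ?a i = G * (- b) ^ i / fact i - k\<^sup>2 * ?a i"
        by (simp add: diffs_def del: of_nat_Suc)
      then have "((4 * real i + 2 * real n) * diffs ?a i + k\<^sup>2 * ?a i) * s ^ i = G * (- b) ^ i / fact i * s ^ i"
        by simp
      then show ?thesis by (simp add: algebra_simps power_mult_distrib divide_inverse power_minus[of "b * s"] power_minus[of b])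
    qed
    moreover have "(\<lambda>i. G * ((- b * s) ^ i /\<^sub>R fact i)) sums (G * exp (- b * s))"
      by (intro sums_mult exp_converges)
    ultimately show ?thesis using sums_unique2 by (simp add: mult.assoc)
  qed
  moreover have "power_series ?a 0 0 = h0"
    by (simp add: power_series_def)
  ultimately show thesis
    using that derivs_power_series[OF sm] unfolding radial_sol_def by blast
qed

section \<open>Radial solutions at infinity and near the centre\<close>

lemma power_times_exp_le: "x ^ j * exp (- x) \<le> fact j" if "x \<ge> 0" for x :: real
proof -
  have "x ^ j /\<^sub>R fact j \<le> exp x"
    unfolding exp_def using that
    by (intro sum_le_suminf[of _ "{j}", simplified] summable_exp_generic) auto
  then show ?thesis by (simp add: exp_minus field_simps)
qed

text \<open>The correction term \<open>m / r * w * w1\<close> in the energy cancels the non-integrable friction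
  \<open>- m / r * w1\<^sup>2\<close>, so that \<open>E'\<close> is bounded by an integrable multiple of \<open>E + 1\<close>.\<close>
lemma energy_bounded:
  fixes w w1 g :: "real \<Rightarrow> real" and m :: nat
  assumes w: "\<And>r. r > 0 \<Longrightarrow> (w has_real_derivative w1 r) (at r)"
    and w1: "\<And>r. r > 0 \<Longrightarrow> (w1 has_real_derivative g r - m / r * w1 r - k\<^sup>2 * w r) (at r)"
    and k: "k > 0" and g: "\<And>r. r \<ge> 1 \<Longrightarrow> \<bar>g r\<bar> * r ^ m \<le> c / r\<^sup>2" and m: "m \<ge> 1"
  shows "\<exists>C r0. \<forall>r\<ge>r0. r ^ m * ((w r)\<^sup>2 + (w1 r)\<^sup>2) \<le> C"
proof -
  \<comment> \<open>Beyond m/k one has m/r \<le> k, so the correction term is at most half of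
    \<open>e\<close>, and \<open>E\<close> controls r^m e.\<close>
  define r0 where "r0 = max 1 (m / k)"
  define e where "e = (\<lambda>r. (w1 r)\<^sup>2 + k\<^sup>2 * (w r)\<^sup>2)"
  define E where "E = (\<lambda>r. r ^ m * ((w1 r)\<^sup>2 + k\<^sup>2 * (w r)\<^sup>2 + m / r * w r * w1 r))"
  \<comment> \<open>What is left after inserting the equation: the terms with (m/r) w1^2, (m/r) k^2
    w^2 and (m/r)^2 w w1 all cancel.\<close>
  define E' where "E' = (\<lambda>r. r ^ m * (2 * w1 r * g r + m / r * w r * g r - m / r\<^sup>2 * w r * w1 r))"
  \<comment> \<open>The part m/k comes from the term with w w1 / r^2, since k |w w1| \<le> e/2; the
    part 2c comes from the two forcing terms.\<close>
  define C where "C = m / k + 2 * c"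
  \<comment> \<open>Integrating factor for E' \<le> C/r^2 (E + 1): the derivative of C/r is -C/r^2,
    so \<Phi> is nonincreasing, and exp(C/r) \<ge> 1 turns its bound into one for E.\<close>
  define \<Phi> where "\<Phi> = (\<lambda>r. (E r + 1) * exp (C / r))"
  have E: "(E has_real_derivative E' r) (at r)" if "r > 0" for r
  proof -
    have "(E has_real_derivative real m * r ^ (m - 1) * (e r + m / r * w r * w1 r) +
        r ^ m * (2 * w1 r * (g r - m / r * w1 r - k\<^sup>2 * w r) + k\<^sup>2 * (2 * w r * w1 r) +
          (- (m / r\<^sup>2) * w r * w1 r + m / r * w1 r * w1 r + m / r * w r * (g r - m / r * w1 r - k\<^sup>2 * w r)))) (at r)"
      unfolding E_def e_def using that
      by (auto intro!: derivative_eq_intros w w1 simp: power2_eq_square divide_inverse algebra_simps)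
    moreover have "real m * r ^ (m - 1) = r ^ m * (m / r)"
      using that m by (cases m) auto
    ultimately have *: "(E has_real_derivative r ^ m * (m / r) * (e r + m / r * w r * w1 r) +
        r ^ m * (2 * w1 r * (g r - m / r * w1 r - k\<^sup>2 * w r) + k\<^sup>2 * (2 * w r * w1 r) +
          (- (m / r\<^sup>2) * w r * w1 r + m / r * w1 r * w1 r + m / r * w r * (g r - m / r * w1 r - k\<^sup>2 * w r)))) (at r)"
      by simp
    show ?thesis
      by (rule DERIV_cong[OF *]) (use that in \<open>simp add: E'_def e_def power2_eq_square divide_inverse algebra_simps\<close>)
  qed
  have r0: "r0 \<ge> 1" by (simp add: r0_def)
  have c: "c \<ge> 0"
    using order_trans[OF mult_nonneg_nonneg[OF abs_ge_zero zero_le_power] g[of 1]] by simp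
  have bounds: "r ^ m * e r \<le> 2 * E r" "E' r \<le> C / r\<^sup>2 * (E r + 1)" if r: "r \<ge> r0" for r
  proof -
    have r1: "r \<ge> 1" "m / r \<le> k" using r k by (auto simp: r0_def field_simps)
    have e: "k * \<bar>w r\<bar> * \<bar>w1 r\<bar> \<le> e r / 2" "2 * \<bar>w1 r\<bar> + k * \<bar>w r\<bar> \<le> 2 + e r"
    proof -
      have "0 \<le> (k * \<bar>w r\<bar> - \<bar>w1 r\<bar>)\<^sup>2" "0 \<le> (k * \<bar>w r\<bar> - 1)\<^sup>2 + (\<bar>w1 r\<bar> - 1)\<^sup>2 + (k * \<bar>w r\<bar>) * (k * \<bar>w r\<bar>)" by simp_all
      then show "k * \<bar>w r\<bar> * \<bar>w1 r\<bar> \<le> e r / 2"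
        by (simp add: e_def power2_eq_square algebra_simps)
      have "2 * \<bar>w1 r\<bar> \<le> 1 + (w1 r)\<^sup>2" "2 * (k * \<bar>w r\<bar>) \<le> 1 + (k * w r)\<^sup>2"
        using sum_squares_bound[of 1 "\<bar>w1 r\<bar>"] sum_squares_bound[of 1 "k * \<bar>w r\<bar>"]
        by (simp_all add: power_mult_distrib)
      moreover have "k * \<bar>w r\<bar> \<ge> 0" using k by simp
      ultimately show "2 * \<bar>w1 r\<bar> + k * \<bar>w r\<bar> \<le> 2 + e r"
        unfolding e_def by (simp add: power_mult_distrib)
    qed
    have e0: "e r \<ge> 0" by (simp add: e_def)
    have a: "\<bar>m / r * w r * w1 r\<bar> \<le> e r / 2"
    proof -
      have "\<bar>m / r * w r * w1 r\<bar> = (m / r) * (\<bar>w r\<bar> * \<bar>w1 r\<bar>)"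
        using r1 by (simp add: abs_mult)
      also have "\<dots> \<le> k * (\<bar>w r\<bar> * \<bar>w1 r\<bar>)" using r1 by (intro mult_right_mono) auto
      finally show ?thesis using e(1) by (simp only: mult.assoc)
    qed
    have "r ^ m * (e r / 2) \<le> r ^ m * (e r + m / r * w r * w1 r)"
      using abs_le_D2[OF a] r1 by (intro mult_left_mono) (linarith, simp)
    then show 1: "r ^ m * e r \<le> 2 * E r" by (simp add: E_def e_def mult_ac)
    have b: "r ^ m * (- (m / r\<^sup>2 * w r * w1 r)) \<le> m / k / r\<^sup>2 * E r"
    proof -
      have "- (m / r\<^sup>2 * w r * w1 r) \<le> \<bar>m / r\<^sup>2 * w r * w1 r\<bar>" by (rule abs_ge_minus_self)
      also have "\<dots> = (m / k / r\<^sup>2) * (k * \<bar>w r\<bar> * \<bar>w1 r\<bar>)" using k by (simp add: abs_mult)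
      also have "\<dots> \<le> (m / k / r\<^sup>2) * (e r / 2)" using e k by (intro mult_left_mono) auto
      finally have "r ^ m * (- (m / r\<^sup>2 * w r * w1 r)) \<le> r ^ m * ((m / k / r\<^sup>2) * (e r / 2))"
        using r1 by (intro mult_left_mono) auto
      also have "\<dots> = (m / k / r\<^sup>2) * (r ^ m * e r / 2)" by simp
      also have "\<dots> \<le> (m / k / r\<^sup>2) * E r" using 1 k by (intro mult_left_mono) auto
      finally show ?thesis .
    qed
    have d: "r ^ m * (2 * w1 r * g r + m / r * w r * g r) \<le> 2 * c / r\<^sup>2 * (E r + 1)"
    proof -
      have "2 * w1 r * g r + m / r * w r * g r \<le> \<bar>g r\<bar> * (2 * \<bar>w1 r\<bar> + m / r * \<bar>w r\<bar>)"
      proof -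
        have "2 * w1 r * g r + m / r * w r * g r \<le> \<bar>2 * w1 r * g r\<bar> + \<bar>m / r * w r * g r\<bar>"
          by (intro add_mono abs_ge_self)
        also have "\<dots> = \<bar>g r\<bar> * (2 * \<bar>w1 r\<bar> + m / r * \<bar>w r\<bar>)"
          using r1 by (simp add: abs_mult algebra_simps)
        finally show ?thesis .
      qed
      also have "\<dots> \<le> \<bar>g r\<bar> * (2 + e r)"
      proof (rule mult_left_mono)
        have "m / r * \<bar>w r\<bar> \<le> k * \<bar>w r\<bar>" using r1 by (intro mult_right_mono) auto
        then show "2 * \<bar>w1 r\<bar> + m / r * \<bar>w r\<bar> \<le> 2 + e r" using e by linarith
      qed simp
      finally have "r ^ m * (2 * w1 r * g r + m / r * w r * g r) \<le> r ^ m * (\<bar>g r\<bar> * (2 + e r))"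
        using r1 by (intro mult_left_mono) auto
      also have "\<dots> = (\<bar>g r\<bar> * r ^ m) * 2 + \<bar>g r\<bar> * (r ^ m * e r)" by (simp add: algebra_simps)
      also have "\<dots> \<le> c / r\<^sup>2 * 2 + c / r\<^sup>2 * (2 * E r)"
      proof (rule add_mono)
        show "\<bar>g r\<bar> * r ^ m * 2 \<le> c / r\<^sup>2 * 2" using g[OF r1(1)] by (rule mult_right_mono) simp
        have "\<bar>g r\<bar> * 1 \<le> \<bar>g r\<bar> * r ^ m" using r1 by (intro mult_left_mono) (auto simp: one_le_power)
        then have "\<bar>g r\<bar> \<le> c / r\<^sup>2" using g[OF r1(1)] by simp
        then show "\<bar>g r\<bar> * (r ^ m * e r) \<le> c / r\<^sup>2 * (2 * E r)"
          using c e0 r1 by (intro mult_mono[OF _ 1]) auto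
      qed
      also have "\<dots> = 2 * c / r\<^sup>2 * (E r + 1)" by (simp add: add_divide_distrib algebra_simps)
      finally show ?thesis .
    qed
    have "E' r = r ^ m * (2 * w1 r * g r + m / r * w r * g r) + r ^ m * (- (m / r\<^sup>2 * w r * w1 r))"
      by (simp add: E'_def algebra_simps)
    also have "\<dots> \<le> 2 * c / r\<^sup>2 * (E r + 1) + m / k / r\<^sup>2 * E r" using b d by simp
    also have "\<dots> \<le> 2 * c / r\<^sup>2 * (E r + 1) + m / k / r\<^sup>2 * (E r + 1)"
      using k by (intro add_left_mono mult_left_mono) auto
    also have "\<dots> = C / r\<^sup>2 * (E r + 1)" by (simp add: C_def add_divide_distrib algebra_simps)
    finally show "E' r \<le> C / r\<^sup>2 * (E r + 1)" .
  qed
  have \<Phi>: "\<Phi> r \<le> \<Phi> r0" if r: "r \<ge> r0" for r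
  proof (rule DERIV_nonpos_imp_nonincreasing[OF r])
    fix t assume t: "r0 \<le> t" "t \<le> r"
    then have "t > 0" using r0 by simp
    then have "(\<Phi> has_real_derivative (E' t - C / t\<^sup>2 * (E t + 1)) * exp (C / t)) (at t)"
      unfolding \<Phi>_def by (auto intro!: derivative_eq_intros E simp: power2_eq_square divide_inverse algebra_simps)
    moreover have "(E' t - C / t\<^sup>2 * (E t + 1)) * exp (C / t) \<le> 0"
      using bounds(2)[OF t(1)] by (simp add: mult_nonpos_nonneg)
    ultimately show "\<exists>y. (\<Phi> has_real_derivative y) (at t) \<and> y \<le> 0" by blast
  qed
  have "r ^ m * ((w r)\<^sup>2 + (w1 r)\<^sup>2) \<le> (1 + 1 / k\<^sup>2) * (2 * \<Phi> r0)" if r: "r \<ge> r0" for r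
  proof -
    have "C \<ge> 0" using c k by (simp add: C_def)
    have re: "0 \<le> r ^ m * e r" using r r0 by (simp add: e_def)
    have "E r + 1 \<le> \<Phi> r"
    proof -
      have "E r + 1 \<ge> 0" using bounds(1)[OF r] re by linarith
      then have "(E r + 1) * 1 \<le> (E r + 1) * exp (C / r)"
        using \<open>C \<ge> 0\<close> r r0 by (intro mult_left_mono) auto
      then show ?thesis by (simp add: \<Phi>_def)
    qed
    then have 2: "r ^ m * e r \<le> 2 * \<Phi> r0" using bounds(1)[OF r] \<Phi>[OF r] by linarith
    have "(w r)\<^sup>2 + (w1 r)\<^sup>2 \<le> (1 + 1 / k\<^sup>2) * e r"
      using k by (simp add: e_def field_simps)
    then have "r ^ m * ((w r)\<^sup>2 + (w1 r)\<^sup>2) \<le> r ^ m * ((1 + 1 / k\<^sup>2) * e r)"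
      using r r0 by (intro mult_left_mono) auto
    also have "\<dots> = (1 + 1 / k\<^sup>2) * (r ^ m * e r)" by simp
    also have "\<dots> \<le> (1 + 1 / k\<^sup>2) * (2 * \<Phi> r0)" using 2 by (intro mult_left_mono) auto
    finally show ?thesis .
  qed
  then show ?thesis by blast
qed

lemma derivs_sq:
  assumes "derivs H"
  shows "((\<lambda>r. H m (r\<^sup>2)) has_real_derivative 2 * r * H (Suc m) (r\<^sup>2)) (at r)"
proof -
  have "((\<lambda>r::real. r\<^sup>2) has_real_derivative 2 * r) (at r)"
    by (auto intro!: derivative_eq_intros)
  from DERIV_chain2[where g = "\<lambda>r::real. r\<^sup>2", OF derivsD[OF assms] this] show ?thesis
    by (simp add: mult.commute)
qed

text \<open>In the variable r, with s = r^2, the equation reads w'' + (n-1)/r w' + k^2 w = G exp(-b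
  r^2), which is the setting of \<open>energy_bounded\<close> with m = n - 1. The second summand is
  the square of w'(r).\<close>

lemma radial_sol_decay:
  assumes H: "radial_sol n k (\<lambda>s. G * exp (- b * s)) H" and n: "n \<ge> 2" and k: "k > 0" and b: "b > 0"
  shows "\<exists>C r0. \<forall>r\<ge>r0. r ^ (n - 1) * ((H 0 (r\<^sup>2))\<^sup>2 + (2 * r * H 1 (r\<^sup>2))\<^sup>2) \<le> C"
proof -
  have d: "derivs H" and ode: "4 * s * H 2 s + 2 * real n * H 1 s + k\<^sup>2 * H 0 s = G * exp (- b * s)" for s
    using H by (auto simp: radial_sol_def)
  have d1: "((\<lambda>r. H 0 (r\<^sup>2)) has_real_derivative 2 * r * H 1 (r\<^sup>2)) (at r)" for r
    using derivs_sq[OF d, of 0 r] by simp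
  have d2: "((\<lambda>r. 2 * r * H 1 (r\<^sup>2)) has_real_derivative
      G * exp (- b * r\<^sup>2) - real (n - 1) / r * (2 * r * H 1 (r\<^sup>2)) - k\<^sup>2 * H 0 (r\<^sup>2)) (at r)" if "r > 0" for r
  proof -
    have "((\<lambda>r. 2 * r * H 1 (r\<^sup>2)) has_real_derivative 2 * H 1 (r\<^sup>2) + 2 * r * H 2 (r\<^sup>2) * (2 * r)) (at r)"
      using DERIV_mult[OF DERIV_cmult[OF DERIV_ident, of 2 r UNIV] derivs_sq[OF d, of 1 r]]
      by (simp add: numeral_2_eq_2 algebra_simps)
    moreover have "2 * H 1 (r\<^sup>2) + 2 * r * H 2 (r\<^sup>2) * (2 * r) =
       G * exp (- b * r\<^sup>2) - real (n - 1) / r * (2 * r * H 1 (r\<^sup>2)) - k\<^sup>2 * H 0 (r\<^sup>2)"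
    proof -
      have "real (n - 1) / r * (2 * r * H 1 (r\<^sup>2)) = (real n - 1) * (2 * H 1 (r\<^sup>2))"
        using that n by (simp add: of_nat_diff)
      then show ?thesis
        unfolding ode[symmetric] by (simp add: power2_eq_square algebra_simps)
    qed
    ultimately show ?thesis by metis
  qed
  \<comment> \<open>The constant comes from r^(n+1) \<le> (r^2)^(n+1) for r \<ge> 1 and from x^j
    exp(-x) \<le> j! with x = b r^2 and j = n + 1.\<close>
  have g: "\<bar>G * exp (- b * r\<^sup>2)\<bar> * r ^ (n - 1) \<le> (\<bar>G\<bar> * fact (n + 1) / b ^ (n + 1)) / r\<^sup>2" if "r \<ge> 1" for r
  proof -
    have "r ^ (n - 1) * r\<^sup>2 = r ^ (n + 1)" using n by (simp add: power_add[symmetric])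
    also have "\<dots> \<le> (r\<^sup>2) ^ (n + 1)"
      using that by (intro power_mono) (auto simp: self_le_power)
    finally have 1: "r ^ (n - 1) * r\<^sup>2 \<le> (r\<^sup>2) ^ (n + 1)" .
    have "(b * r\<^sup>2) ^ (n + 1) * exp (- (b * r\<^sup>2)) \<le> fact (n + 1)"
      using b by (intro power_times_exp_le) auto
    then have 2: "(r\<^sup>2) ^ (n + 1) * exp (- (b * r\<^sup>2)) \<le> fact (n + 1) / b ^ (n + 1)"
      using b by (simp add: field_simps power_mult_distrib del: fact_Suc power_Suc)
    have "r ^ (n - 1) * r\<^sup>2 * exp (- (b * r\<^sup>2)) \<le> (r\<^sup>2) ^ (n + 1) * exp (- (b * r\<^sup>2))"
      using 1 by (rule mult_right_mono) simp
    then have "r ^ (n - 1) * r\<^sup>2 * exp (- (b * r\<^sup>2)) \<le> fact (n + 1) / b ^ (n + 1)"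
      using 2 by linarith
    then have "\<bar>G\<bar> * (r ^ (n - 1) * r\<^sup>2 * exp (- (b * r\<^sup>2))) \<le> \<bar>G\<bar> * (fact (n + 1) / b ^ (n + 1))"
      by (rule mult_left_mono) simp
    moreover have "\<bar>G\<bar> * (r ^ (n - 1) * r\<^sup>2 * exp (- (b * r\<^sup>2))) = \<bar>G * exp (- b * r\<^sup>2)\<bar> * r ^ (n - 1) * r\<^sup>2"
      by (simp add: abs_mult)
    moreover have "r\<^sup>2 > 0" using that by simp
    ultimately show ?thesis
      by (simp only: pos_le_divide_eq times_divide_eq_right)
  qed
  show ?thesis
    using energy_bounded[of "\<lambda>r. H 0 (r\<^sup>2)" "\<lambda>r. 2 * r * H 1 (r\<^sup>2)" "\<lambda>r. G * exp (- b * r\<^sup>2)" "n - 1", OF d1 d2 k g] n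
    by simp
qed

text \<open>The majorant is a multiple of the derivative of arctan. After scaling by N it has an
  explicit bounded primitive, which bounds the mass of the Gaussian uniformly in N.\<close>

lemma gaussian_le_inverse_sq:
  fixes x :: real
  assumes "x \<ge> 0"
  shows "x ^ m * exp (- x\<^sup>2) \<le> (2 + 2 * fact (m + 1)) / (1 + x\<^sup>2)"
proof -
  have "x ^ m * (1 + x\<^sup>2) \<le> 2 + 2 * (x\<^sup>2) ^ (m + 1)"
  proof (cases "x \<le> 1")
    case True
    then have "x ^ m * (1 + x\<^sup>2) \<le> 1 * (1 + 1)"
      using assms by (intro mult_mono add_mono power_le_one) auto
    moreover have "(x\<^sup>2) ^ (m + 1) \<ge> 0" by (intro zero_le_power zero_le_power2)
    ultimately show ?thesis by (smt (verit))
  next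
    case False
    then have x: "x \<ge> 1" by simp
    have "x ^ m \<le> (x\<^sup>2) ^ m" using x by (intro power_mono) (auto simp: self_le_power)
    moreover have "1 + x\<^sup>2 \<le> 2 * x\<^sup>2" using x by simp
    ultimately have "x ^ m * (1 + x\<^sup>2) \<le> (x\<^sup>2) ^ m * (2 * x\<^sup>2)"
      using x by (intro mult_mono) auto
    moreover have "(x\<^sup>2) ^ m * (2 * x\<^sup>2) = 2 * (x\<^sup>2) ^ (m + 1)" by simp
    ultimately show ?thesis by linarith
  qed
  then have "x ^ m * (1 + x\<^sup>2) * exp (- x\<^sup>2) \<le> (2 + 2 * (x\<^sup>2) ^ (m + 1)) * exp (- x\<^sup>2)"
    by (rule mult_right_mono) simp
  also have "\<dots> = 2 * exp (- x\<^sup>2) + 2 * ((x\<^sup>2) ^ (m + 1) * exp (- x\<^sup>2))" by (simp add: algebra_simps)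
  also have "\<dots> \<le> 2 * 1 + 2 * fact (m + 1)"
    using power_times_exp_le[of "x\<^sup>2" "m + 1"] by (intro add_mono mult_left_mono) auto
  finally show ?thesis by (simp add: pos_le_divide_eq add_pos_nonneg mult_ac del: fact_Suc power_Suc)
qed

text \<open>The flux \<open>r ^ (n - 1) * w'\<close> is at most the mass of the Gaussian plus \<open>k\<^sup>2 B r\<close>, where \<open>B\<close> is the maximum of
  \<open>r ^ (n - 1) * |w|\<close>; integrating back from the zero at \<open>\<delta>\<close> absorbs \<open>B\<close>, uniformly in \<open>N\<close>.\<close>
lemma radial_sol_near_origin:
  assumes H: "radial_sol n k (\<lambda>s. N ^ n * exp (- N\<^sup>2 * s)) H" and n: "n \<ge> 2" and N: "N > 0"
    and \<delta>: "\<delta> > 0" "k\<^sup>2 * \<delta>\<^sup>2 \<le> 1 / 2" and zero: "H 0 (\<delta>\<^sup>2) = 0" and r: "0 \<le> r" "r \<le> \<delta>"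
  shows "r ^ (n - 1) * \<bar>H 0 (r\<^sup>2)\<bar> \<le> 8 * (1 + fact n) * \<delta>"
proof -
  define m where "m = n - 1"
  have m: "m \<ge> 1" "n = Suc m" using n by (auto simp: m_def)
  define c where "c = (2 + 2 * fact n :: real)"
  have d: "derivs H" and ode: "4 * s * H 2 s + 2 * real n * H 1 s + k\<^sup>2 * H 0 s = N ^ n * exp (- N\<^sup>2 * s)" for s
    using H by (auto simp: radial_sol_def)
  have d1: "((\<lambda>r. H 0 (r\<^sup>2)) has_real_derivative 2 * r * H 1 (r\<^sup>2)) (at r)" for r
    using derivs_sq[OF d, of 0 r] by simp
  \<comment> \<open>The flux r^(n-1) w'(r); its derivative no longer contains the friction
    term.\<close>
  define P where "P = (\<lambda>r. 2 * r ^ n * H 1 (r\<^sup>2))"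
  have P: "(P has_real_derivative r ^ m * (N ^ n * exp (- N\<^sup>2 * r\<^sup>2) - k\<^sup>2 * H 0 (r\<^sup>2))) (at r)" for r
  proof -
    have "(P has_real_derivative (2 * (real n * r ^ m)) * H 1 (r\<^sup>2) + 2 * r * H 2 (r\<^sup>2) * (2 * r ^ n)) (at r)"
      unfolding P_def
      using DERIV_mult[OF DERIV_cmult[OF DERIV_pow[of n r UNIV], of 2] derivs_sq[OF d, of 1 r]]
      by (simp add: numeral_2_eq_2 m)
    moreover have "(2 * (real n * r ^ m)) * H 1 (r\<^sup>2) + 2 * r * H 2 (r\<^sup>2) * (2 * r ^ n)
      = r ^ m * (N ^ n * exp (- N\<^sup>2 * r\<^sup>2) - k\<^sup>2 * H 0 (r\<^sup>2))"
      unfolding ode[symmetric] by (simp add: m power2_eq_square algebra_simps)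
    ultimately show ?thesis by metis
  qed
  have cont: "continuous_on {0..\<delta>} (\<lambda>r. r ^ m * \<bar>H 0 (r\<^sup>2)\<bar>)"
    by (intro continuous_intros DERIV_continuous_on[of _ "\<lambda>r. H 0 (r\<^sup>2)" "\<lambda>r. 2 * r * H 1 (r\<^sup>2)"]
          has_field_derivative_at_within[OF d1])
  obtain t where t: "t \<in> {0..\<delta>}" "\<forall>r\<in>{0..\<delta>}. r ^ m * \<bar>H 0 (r\<^sup>2)\<bar> \<le> t ^ m * \<bar>H 0 (t\<^sup>2)\<bar>"
    using continuous_attains_sup[OF _ _ cont] \<delta> by auto
  define B where "B = t ^ m * \<bar>H 0 (t\<^sup>2)\<bar>"
  have B: "r ^ m * \<bar>H 0 (r\<^sup>2)\<bar> \<le> B" if "0 \<le> r" "r \<le> \<delta>" for r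
    using t(2) that by (auto simp: B_def)
  have B0: "B \<ge> 0" using t by (simp add: B_def)
  \<comment> \<open>A primitive of the bound on |P'|; comparing it with P and with -P bounds
    |P|.\<close>
  let ?Q = "\<lambda>r. c * arctan (N * r) + k\<^sup>2 * B * r"
  have Q: "(?Q has_real_derivative c * N / (1 + (N * r)\<^sup>2) + k\<^sup>2 * B) (at r)" for r
    by (auto intro!: derivative_eq_intros simp: divide_inverse)
  have P': "\<bar>r ^ m * (N ^ n * exp (- N\<^sup>2 * r\<^sup>2) - k\<^sup>2 * H 0 (r\<^sup>2))\<bar> \<le> c * N / (1 + (N * r)\<^sup>2) + k\<^sup>2 * B"
    if r: "0 \<le> r" "r \<le> \<delta>" for r
  proof -
    have "r ^ m * (N ^ n * exp (- N\<^sup>2 * r\<^sup>2)) = N * ((N * r) ^ m * exp (- (N * r)\<^sup>2))"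
      by (simp add: m power_mult_distrib)
    also have "\<dots> \<le> N * (c / (1 + (N * r)\<^sup>2))"
      using gaussian_le_inverse_sq[of "N * r" m] r N unfolding c_def m(2) by (intro mult_left_mono) auto
    finally have 1: "\<bar>r ^ m * (N ^ n * exp (- N\<^sup>2 * r\<^sup>2))\<bar> \<le> c * N / (1 + (N * r)\<^sup>2)"
      using r N by (simp add: mult_ac)
    have "\<bar>r ^ m * (k\<^sup>2 * H 0 (r\<^sup>2))\<bar> = k\<^sup>2 * (r ^ m * \<bar>H 0 (r\<^sup>2)\<bar>)"
      using r by (simp add: abs_mult)
    also have "\<dots> \<le> k\<^sup>2 * B" using B[OF r] by (intro mult_left_mono) auto
    finally show ?thesis using 1 unfolding right_diff_distrib by linarith
  qed
  have P1: "\<bar>P r\<bar> \<le> 2 * c + k\<^sup>2 * B * \<delta>" if r: "0 \<le> r" "r \<le> \<delta>" for r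
  proof -
    have 0: "P 0 = 0" using m by (simp add: P_def)
    have "?Q 0 - P 0 \<le> ?Q r - P r"
    proof (rule DERIV_nonneg_imp_nondecreasing[OF r(1)])
      fix x assume "0 \<le> x" "x \<le> r"
      then show "\<exists>y. ((\<lambda>r. ?Q r - P r) has_real_derivative y) (at x) \<and> 0 \<le> y"
        using P'[of x] r DERIV_diff[OF Q P, of x] by (intro exI conjI) (assumption, linarith)
    qed
    moreover have "?Q 0 + P 0 \<le> ?Q r + P r"
    proof (rule DERIV_nonneg_imp_nondecreasing[OF r(1)])
      fix x assume "0 \<le> x" "x \<le> r"
      then show "\<exists>y. ((\<lambda>r. ?Q r + P r) has_real_derivative y) (at x) \<and> 0 \<le> y"
        using P'[of x] r DERIV_add[OF Q P, of x] by (intro exI conjI) (assumption, linarith)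
    qed
    ultimately have "\<bar>P r\<bar> \<le> c * arctan (N * r) + k\<^sup>2 * B * r" using 0 by simp
    also have "\<dots> \<le> c * 2 + k\<^sup>2 * B * \<delta>"
    proof (intro add_mono mult_left_mono)
      have "arctan (N * r) < pi / 2" by (rule arctan_ubound)
      then show "arctan (N * r) \<le> 2" using pi_half_less_two by linarith
    qed (use r B0 in \<open>auto simp: c_def\<close>)
    finally show ?thesis by simp
  qed
  have le: "r ^ m * \<bar>H 0 (r\<^sup>2)\<bar> \<le> \<delta> * (2 * c) + B / 2" if r: "0 \<le> r" "r \<le> \<delta>" for r
  proof (cases "r = 0 \<or> r = \<delta>")
    case True
    then have "r ^ m * \<bar>H 0 (r\<^sup>2)\<bar> = 0" using zero m by auto
    moreover have "\<delta> * (2 * c) \<ge> 0" using \<delta> by (simp add: c_def)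
    ultimately show ?thesis using B0 by linarith
  next
    case False
    then have r: "0 < r" "r < \<delta>" using r by auto
    \<comment> \<open>As the solution vanishes at \<delta>, its value at r is controlled by w' at
      some larger \<xi>. Since r < \<xi>, the weight r^m can be replaced by \<xi>^m, which produces
      the flux at \<xi>.\<close>
    obtain \<xi> where \<xi>: "\<xi> > r" "\<xi> < \<delta>" "H 0 (\<delta>\<^sup>2) - H 0 (r\<^sup>2) = (\<delta> - r) * (2 * \<xi> * H 1 (\<xi>\<^sup>2))"
      using MVT2[OF r(2), of "\<lambda>r. H 0 (r\<^sup>2)" "\<lambda>r. 2 * r * H 1 (r\<^sup>2)"] d1 by blast
    have "r ^ m * \<bar>H 0 (r\<^sup>2)\<bar> = (\<delta> - r) * (r ^ m * \<bar>2 * \<xi> * H 1 (\<xi>\<^sup>2)\<bar>)"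
    proof -
      have "\<bar>H 0 (r\<^sup>2)\<bar> = \<bar>(\<delta> - r) * (2 * \<xi> * H 1 (\<xi>\<^sup>2))\<bar>" using \<xi>(3) zero by simp
      then show ?thesis using r by (simp add: abs_mult)
    qed
    also have "\<dots> \<le> \<delta> * \<bar>P \<xi>\<bar>"
    proof (rule mult_mono)
      have "r ^ m * \<bar>2 * \<xi> * H 1 (\<xi>\<^sup>2)\<bar> \<le> \<xi> ^ m * \<bar>2 * \<xi> * H 1 (\<xi>\<^sup>2)\<bar>"
        using \<xi> r by (intro mult_right_mono power_mono) auto
      also have "\<dots> = \<bar>P \<xi>\<bar>" using \<xi> r by (simp add: P_def m abs_mult)
      finally show "r ^ m * \<bar>2 * \<xi> * H 1 (\<xi>\<^sup>2)\<bar> \<le> \<bar>P \<xi>\<bar>" .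
    qed (use r in auto)
    also have "\<dots> \<le> \<delta> * (2 * c + k\<^sup>2 * B * \<delta>)"
      using P1[of \<xi>] \<xi> r \<delta> by (intro mult_left_mono) auto
    also have "\<dots> = \<delta> * (2 * c) + (k\<^sup>2 * \<delta>\<^sup>2) * B" by (simp add: power2_eq_square algebra_simps)
    also have "\<dots> \<le> \<delta> * (2 * c) + (1 / 2) * B"
      using \<delta> B0 by (intro add_left_mono mult_right_mono) auto
    finally show ?thesis by simp
  qed
  \<comment> \<open>The estimate at the maximum point \<open>t\<close> bounds B in terms of itself;
    absorbing half of it leaves 4 c \<delta> with c = 2 + 2 n!.\<close>
  have "B \<le> \<delta> * (2 * c) + B / 2" using le[of t] t unfolding B_def by auto
  then have "B \<le> 8 * (1 + fact n) * \<delta>" by (simp add: c_def algebra_simps)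
  then show ?thesis using B[OF r] unfolding m_def by linarith
qed

text \<open>Subtracting a homogeneous solution leaves the right-hand side unchanged; this freedom
  serves to place a zero at a chosen radius.\<close>

lemma radial_sol_diff:
  assumes P: "radial_sol n k g P" and J: "radial_sol n k (\<lambda>s. 0) J"
  shows "radial_sol n k g (\<lambda>m s. P m s - c * J m s)"
proof -
  have "derivs (\<lambda>m s. P m s - c * J m s)"
    using assms unfolding derivs_def radial_sol_def by (auto intro!: derivative_eq_intros)
  moreover have "4 * s * (P 2 s - c * J 2 s) + 2 * real n * (P 1 s - c * J 1 s) + k\<^sup>2 * (P 0 s - c * J 0 s)
     = (4 * s * P 2 s + 2 * real n * P 1 s + k\<^sup>2 * P 0 s) - c * (4 * s * J 2 s + 2 * real n * J 1 s + k\<^sup>2 * J 0 s)" for s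
    by (simp add: algebra_simps)
  ultimately show ?thesis using assms unfolding radial_sol_def by simp
qed

section \<open>Integration by parts\<close>

lemma integrable_compact_support:
  fixes f :: "'a::euclidean_space \<Rightarrow> 'b::{banach, second_countable_topology}"
  assumes "continuous_on UNIV f" "compact K" "\<And>x. x \<notin> K \<Longrightarrow> f x = 0"
  shows "integrable lborel f"
proof -
  have "(\<lambda>x. indicator K x *\<^sub>R f x) = f"
    using assms(3) by (auto simp: indicator_def fun_eq_iff)
  then show ?thesis
    using borel_integrable_compact[OF assms(2) continuous_on_subset[OF assms(1)]] by auto
qed

lemma pd_eq_0_outside:
  assumes "compact K" "\<And>x. x \<notin> K \<Longrightarrow> f x = 0" "x \<notin> K"
  shows "pd b f x = 0"
proof -
  have "((\<lambda>_. 0) has_derivative (\<lambda>_. 0)) (at x)" by simp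
  then have "(f has_derivative (\<lambda>_. 0)) (at x)"
    by (rule has_derivative_transform_within_open[of _ _ _ _ "- K"])
       (use assms compact_imp_closed in \<open>auto simp: open_Compl\<close>)
  then show ?thesis by (simp add: pd_eqI)
qed

lemma lborel_integral_translate:
  fixes f :: "'a::euclidean_space \<Rightarrow> 'b::{banach, second_countable_topology}"
  assumes "f \<in> borel_measurable borel"
  shows "(LBINT x. f (c + x)) = integral\<^sup>L lborel f"
    and "integrable lborel (\<lambda>x. f (c + x)) \<longleftrightarrow> integrable lborel f"
proof -
  have m: "(+) c \<in> lborel \<rightarrow>\<^sub>M borel" by simp
  show "(LBINT x. f (c + x)) = integral\<^sup>L lborel f"
    using integral_distr[OF m assms] by (simp add: lborel_distr_plus)
  show "integrable lborel (\<lambda>x. f (c + x)) \<longleftrightarrow> integrable lborel f"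
    using integrable_distr_eq[OF m assms] by (simp add: lborel_distr_plus)
qed

text \<open>The difference quotients have integral zero by translation invariance.\<close>
lemma integral_pd_eq_0:
  fixes F :: "'a::euclidean_space \<Rightarrow> 'b::euclidean_space"
  assumes d: "\<And>x. F differentiable (at x)" and c: "continuous_on UNIV (pd b F)"
    and K: "compact K" "\<And>x. x \<notin> K \<Longrightarrow> F x = 0"
  shows "integral\<^sup>L lborel (pd b F) = 0"
proof -
  have pd0: "pd b F x = 0" if "x \<notin> K" for x
    using pd_eq_0_outside[OF K that] by simp
  have "bounded (pd b F ` K)"
    by (intro compact_imp_bounded compact_continuous_image continuous_on_subset[OF c] K) auto
  then obtain M0 where M0: "\<And>x. x \<in> K \<Longrightarrow> norm (pd b F x) \<le> M0"
    unfolding bounded_iff by auto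
  define M where "M = \<bar>M0\<bar>"
  have M: "norm (pd b F x) \<le> M" for x
    using M0[of x] pd0[of x] unfolding M_def by (cases "x \<in> K") auto
  define t where "t = (\<lambda>j. 1 / real (Suc j))"
  define q where "q = (\<lambda>j x. (1 / t j) *\<^sub>R (F (x + t j *\<^sub>R b) - F x))"
  have t: "t j > 0" "t j \<le> 1" for j by (auto simp: t_def)
  have Fd: "(F has_derivative frechet_derivative F (at x)) (at x)" for x
    using d frechet_derivative_works by blast
  have line: "((\<lambda>s. F (x + s *\<^sub>R b)) has_derivative (\<lambda>h. h *\<^sub>R pd b F (x + s *\<^sub>R b))) (at s within S)" for x s S
  proof -
    have "((\<lambda>s. x + s *\<^sub>R b) has_derivative (\<lambda>h. h *\<^sub>R b)) (at s within S)"
      by (auto intro!: derivative_eq_intros)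
    from has_derivative_compose[OF this Fd]
    have "((\<lambda>s. F (x + s *\<^sub>R b)) has_derivative (\<lambda>h. frechet_derivative F (at (x + s *\<^sub>R b)) (h *\<^sub>R b))) (at s within S)" .
    then show ?thesis
      using linear_frechet_derivative[OF d] by (simp add: pd_def linear_scale)
  qed
  have contF: "continuous_on UNIV F"
    using d by (simp add: continuous_at_imp_continuous_on differentiable_imp_continuous_within)
  have intF: "integrable lborel F"
    by (rule integrable_compact_support[OF contF K])
  have bF: "F \<in> borel_measurable borel"
    by (rule borel_measurable_continuous_onI[OF contF])
  have qb: "norm (q j x) \<le> M" for j x
  proof -
    have "norm (F (x + t j *\<^sub>R b) - F (x + 0 *\<^sub>R b)) \<le> M * norm (t j - 0)"
    proof (rule differentiable_bound[OF convex_UNIV line])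
      fix s :: real
      show "onorm (\<lambda>h. h *\<^sub>R pd b F (x + s *\<^sub>R b)) \<le> M"
      proof (rule onorm_le)
        show "norm (h *\<^sub>R pd b F (x + s *\<^sub>R b)) \<le> M * norm h" for h
          using mult_left_mono[OF M, of "\<bar>h\<bar>"] by (simp add: mult.commute[of M])
      qed
    qed auto
    then have "norm (F (x + t j *\<^sub>R b) - F x) \<le> M * t j" using t(1)[of j] by simp
    then have "norm (F (x + t j *\<^sub>R b) - F x) / t j \<le> M" using t(1)[of j] by (simp add: pos_divide_le_eq)
    then show ?thesis using t(1)[of j] unfolding q_def by (simp only: norm_scaleR) simp
  qed
  obtain r where r: "K \<subseteq> cball 0 r"
    using compact_imp_bounded[OF K(1)] unfolding bounded_iff by (metis mem_cball_0 subsetI)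
  \<comment> \<open>The steps \<open>t j\<close> are at most 1, so all difference quotients vanish
    outside the support enlarged by |b|, which gives one dominating function.\<close>
  define S where "S = cball (0::'a) (r + norm b)"
  have q0: "q j x = 0" if "x \<notin> S" for j x
  proof -
    have n: "norm x > r + norm b" using that by (simp add: S_def)
    have "norm (t j *\<^sub>R b) \<le> norm b" using t[of j] by (simp add: mult_left_le_one_le)
    then have "norm (x + t j *\<^sub>R b) > r" using n norm_triangle_ineq2[of x "- (t j *\<^sub>R b)"] by simp
    moreover have "norm x > r" using n norm_ge_zero[of b] by linarith
    ultimately have "x + t j *\<^sub>R b \<notin> K" "x \<notin> K" using r by (auto simp: subset_iff)
    then show ?thesis using K(2) by (simp add: q_def)
  qed
  have t0: "t \<longlonglongrightarrow> 0"
    using LIMSEQ_inverse_real_of_nat by (simp add: t_def inverse_eq_divide del: of_nat_Suc)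
  have lim: "(\<lambda>j. q j x) \<longlonglongrightarrow> pd b F x" for x
  proof -
    have "((\<lambda>h. norm (F (x + h *\<^sub>R b) - F x - h *\<^sub>R pd b F x) / norm h) \<longlongrightarrow> 0) (at 0)"
      using line[of x 0 UNIV] by (simp add: has_derivative_at)
    moreover have "\<forall>\<^sub>F h in at 0. norm (F (x + h *\<^sub>R b) - F x - h *\<^sub>R pd b F x) / norm h
        = norm ((F (x + h *\<^sub>R b) - F x) /\<^sub>R h - pd b F x)"
    proof (rule eventually_at_filter[THEN iffD2], rule always_eventually, intro allI impI)
      fix h :: real assume "h \<noteq> 0"
      then have "(F (x + h *\<^sub>R b) - F x) /\<^sub>R h - pd b F x = (1 / h) *\<^sub>R (F (x + h *\<^sub>R b) - F x - h *\<^sub>R pd b F x)"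
        by (simp add: scaleR_diff_right divide_inverse)
      then show "norm (F (x + h *\<^sub>R b) - F x - h *\<^sub>R pd b F x) / norm h
          = norm ((F (x + h *\<^sub>R b) - F x) /\<^sub>R h - pd b F x)" by simp
    qed
    ultimately have "((\<lambda>h. norm ((F (x + h *\<^sub>R b) - F x) /\<^sub>R h - pd b F x)) \<longlongrightarrow> 0) (at 0)"
      by (rule Lim_transform_eventually)
    then have "((\<lambda>h. (F (x + h *\<^sub>R b) - F x) /\<^sub>R h) \<longlongrightarrow> pd b F x) (at 0)"
      by (simp add: tendsto_norm_zero_iff Lim_null[symmetric])
    moreover have "filterlim t (at 0) sequentially"
    proof -
      have "t j \<noteq> 0" for j using t(1)[of j] by simp
      then show ?thesis using t0 by (simp add: filterlim_at)
    qed
    ultimately have "(\<lambda>j. (F (x + t j *\<^sub>R b) - F x) /\<^sub>R t j) \<longlonglongrightarrow> pd b F x"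
      by (rule filterlim_compose)
    then show ?thesis by (simp add: q_def divide_inverse)
  qed
  have intq: "integral\<^sup>L lborel (q j) = 0" for j
  proof -
    have "(LBINT x. F (t j *\<^sub>R b + x)) = integral\<^sup>L lborel F"
      "integrable lborel (\<lambda>x. F (t j *\<^sub>R b + x))"
      using lborel_integral_translate[OF bF] intF by auto
    then show ?thesis using intF by (simp add: q_def add.commute)
  qed
  have "(\<lambda>j. integral\<^sup>L lborel (q j)) \<longlonglongrightarrow> integral\<^sup>L lborel (pd b F)"
  proof (rule integral_dominated_convergence[where w = "\<lambda>x. M * indicator S x"])
    show "integrable lborel (\<lambda>x. M * indicator S x)"
      unfolding S_def using emeasure_lborel_cball_finite by (intro integrable_mult_right integrable_real_indicator) auto
    show "pd b F \<in> borel_measurable lborel"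
      using borel_measurable_continuous_onI[OF c] by simp
    show "q j \<in> borel_measurable lborel" for j
    proof -
      have "continuous_on UNIV (q j)"
        unfolding q_def by (intro continuous_intros continuous_on_compose2[OF contF]) auto
      then show ?thesis using borel_measurable_continuous_onI by simp
    qed
    show "AE x in lborel. norm (q j x) \<le> M * indicator S x" for j
      using qb q0 by (auto simp: indicator_def intro!: AE_I2)
  qed (use lim in auto)
  then have "(\<lambda>j::nat. 0) \<longlonglongrightarrow> integral\<^sup>L lborel (pd b F)" unfolding intq .
  then show ?thesis by (rule LIMSEQ_unique) (rule tendsto_const)
qed

lemma test_fn_props:
  assumes "test_fn \<phi>"
  obtains K where "smooth \<phi>" "compact K" "\<And>x. x \<notin> K \<Longrightarrow> \<phi> x = 0"
    "\<And>x. x \<notin> K \<Longrightarrow> laplacian \<phi> x = 0"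
proof -
  obtain K where K: "smooth \<phi>" "compact K" "\<And>x. x \<notin> K \<Longrightarrow> \<phi> x = 0"
    using assms by (auto simp: test_fn_def)
  have 1: "pd b \<phi> x = 0" if "x \<notin> K" for b x by (rule pd_eq_0_outside[OF K(2,3) that])
  have 2: "pd b (pd b \<phi>) x = 0" if "x \<notin> K" for b x by (rule pd_eq_0_outside[OF K(2) 1 that])
  show thesis using that[OF K] 2 by (simp add: laplacian_def)
qed

lemma continuous_on_laplacian:
  fixes f :: "'a::euclidean_space \<Rightarrow> 'b::real_normed_vector"
  shows "smooth f \<Longrightarrow> continuous_on S (laplacian f)"
  unfolding laplacian_def[abs_def] by (intro continuous_on_sum smooth_continuous_on smooth_pd)

lemma pd_of_real:
  fixes f :: "'a::euclidean_space \<Rightarrow> real"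
  assumes "f differentiable (at x)"
  shows "pd b (\<lambda>x. complex_of_real (f x)) x = of_real (pd b f x)"
    and "(\<lambda>x. complex_of_real (f x)) differentiable (at x)"
proof -
  have *: "((\<lambda>x. complex_of_real (f x)) has_derivative (\<lambda>y. of_real (frechet_derivative f (at x) y))) (at x)"
    by (intro bounded_linear.has_derivative[OF bounded_linear_of_real]) (use assms frechet_derivative_works in blast)
  show "pd b (\<lambda>x. complex_of_real (f x)) x = of_real (pd b f x)"
    unfolding pd_def[of b f] by (rule pd_eqI[OF *])
  show "(\<lambda>x. complex_of_real (f x)) differentiable (at x)"
    using * differentiable_def by blast
qed

lemma pd_diff:
  assumes "f differentiable (at x)" "g differentiable (at x)"
  shows "pd b (\<lambda>x. f x - g x) x = pd b f x - pd b g x"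
  unfolding pd_def[of b f] pd_def[of b g]
  by (rule pd_eqI) (auto intro!: derivative_eq_intros assms[unfolded frechet_derivative_works])

text \<open>Green's second identity. The products \<open>F b\<close> = ui d_b \<phi> - \<phi> d_b ui
  have compact support, and the sum of their derivatives d_b is ui Lap \<phi> - \<phi> Lap ui; each
  derivative integrates to zero.\<close>

lemma incident_field_weak:
  fixes ui :: "'a::euclidean_space \<Rightarrow> complex"
  assumes ui: "incident_field k ui" and \<phi>: "test_fn \<phi>"
  shows "(LBINT x. ui x * of_real (laplacian \<phi> x + k\<^sup>2 * \<phi> x)) = 0"
    and "integrable lborel (\<lambda>x. ui x * of_real (laplacian \<phi> x + k\<^sup>2 * \<phi> x))"
proof -
  obtain K where K: "smooth \<phi>" "compact K" "\<And>x. x \<notin> K \<Longrightarrow> \<phi> x = 0"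
    "\<And>x. x \<notin> K \<Longrightarrow> laplacian \<phi> x = 0"
    using test_fn_props[OF \<phi>] by blast
  have K1: "pd b \<phi> x = 0" if "x \<notin> K" for b x
    by (rule pd_eq_0_outside[OF K(2,3) that])
  have sui: "smooth ui" and lap: "laplacian ui x = - of_real (k\<^sup>2) * ui x" for x
    using ui by (auto simp: incident_field_def add_eq_0_iff2)
  define F where "F = (\<lambda>b x. ui x * of_real (pd b \<phi> x) - of_real (\<phi> x) * pd b ui x)"
  have dui: "ui differentiable (at x)" "b \<in> Basis \<Longrightarrow> pd b ui differentiable (at x)" for b x
    using sui by (auto intro: smooth_differentiable smooth_pd)
  have d\<phi>: "\<phi> differentiable (at x)" "b \<in> Basis \<Longrightarrow> pd b \<phi> differentiable (at x)" for b x
    using K(1) by (auto intro: smooth_differentiable smooth_pd)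
  have pF: "pd b (F b) x = ui x * of_real (pd b (pd b \<phi>) x) - of_real (\<phi> x) * pd b (pd b ui) x" if b: "b \<in> Basis" for b x
    unfolding F_def using b
    by (subst pd_diff) (auto intro!: derivative_intros dui d\<phi> pd_of_real(2) simp: pd_mult dui d\<phi> pd_of_real)
  have dF: "F b differentiable (at x)" if b: "b \<in> Basis" for b x
    unfolding F_def using b by (auto intro!: derivative_intros dui d\<phi> pd_of_real(2))
  have cF: "continuous_on UNIV (pd b (F b))" if b: "b \<in> Basis" for b
  proof -
    have "pd b (F b) = (\<lambda>x. ui x * of_real (pd b (pd b \<phi>) x) - of_real (\<phi> x) * pd b (pd b ui) x)"
      by (rule ext) (rule pF[OF b])
    moreover have "smooth (pd b (pd b \<phi>))" "smooth (pd b (pd b ui))"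
      using b by (simp_all add: smooth_pd sui K(1))
    ultimately show ?thesis
      by (simp only:) (intro continuous_on_diff continuous_on_mult continuous_on_of_real smooth_continuous_on sui K(1))
  qed
  have F0: "F b x = 0" if "x \<notin> K" for b x
    using K(3) K1 that by (simp add: F_def)
  have i0: "integral\<^sup>L lborel (pd b (F b)) = 0" and ii: "integrable lborel (pd b (F b))" if b: "b \<in> Basis" for b
  proof -
    show "integral\<^sup>L lborel (pd b (F b)) = 0"
      by (rule integral_pd_eq_0[OF dF[OF b] cF[OF b] K(2) F0])
    show "integrable lborel (pd b (F b))"
      by (rule integrable_compact_support[OF cF[OF b] K(2) pd_eq_0_outside[OF K(2) F0]])
  qed
  have eq: "ui x * of_real (laplacian \<phi> x + k\<^sup>2 * \<phi> x) = (\<Sum>b\<in>Basis. pd b (F b) x)" for x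
  proof -
    have "(\<Sum>b\<in>Basis. pd b (F b) x) = ui x * of_real (laplacian \<phi> x) - of_real (\<phi> x) * laplacian ui x"
      by (simp add: pF sum_subtractf laplacian_def sum_distrib_left)
    then show ?thesis by (simp add: lap algebra_simps)
  qed
  show "(LBINT x. ui x * of_real (laplacian \<phi> x + k\<^sup>2 * \<phi> x)) = 0"
    unfolding eq using i0 ii by (subst Bochner_Integration.integral_sum) auto
  show "integrable lborel (\<lambda>x. ui x * of_real (laplacian \<phi> x + k\<^sup>2 * \<phi> x))"
    unfolding eq using ii by (intro Bochner_Integration.integrable_sum) auto
qed

section \<open>Integrals of kernels\<close>

lemma ennreal_le_suminf: "f j \<le> (\<Sum>j. f j)" for f :: "nat \<Rightarrow> ennreal"
  using sum_le_suminf[of f "{j}"] by simp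

lemma emeasure_lborel_cball:
  "r \<ge> 0 \<Longrightarrow> emeasure lborel (cball (c::'a::euclidean_space) r) =
    ennreal (r ^ DIM('a) * measure lborel (ball (0::'a) 1))"
proof -
  assume r: "r \<ge> 0"
  have "emeasure lborel (cball c r) = ennreal (measure lborel (cball c r))"
    using emeasure_lborel_cball_finite[of c r] by (intro emeasure_eq_ennreal_measure) auto
  then show ?thesis
    by (simp only: content_cball_conv_ball content_ball_conv_unit_ball[OF r])
qed

text \<open>Dyadic shells replace polar coordinates. For d/2^(j+1) < |x| \<le> d/2^j the kernel is
  at most \<open>a j\<close>, and \<open>a j\<close> times the volume of the outer ball is a
  constant times d/2^j, a geometric series.\<close>

lemma nn_integral_inverse_power_cball:
  fixes d :: real
  assumes "d > 0"
  shows "(\<integral>\<^sup>+ x. ennreal (1 / norm (x::'a::euclidean_space) ^ (DIM('a) - 1)) * indicator (cball 0 d) x \<partial>lborel)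
     \<le> ennreal (2 ^ DIM('a) * measure lborel (ball (0::'a) 1) * d)"
proof -
  define m where "m = DIM('a) - 1"
  have n: "DIM('a) = Suc m" using DIM_positive[where 'a='a] by (simp add: m_def)
  define c where "c = measure lborel (ball (0::'a) 1)"
  define a where "a = (\<lambda>j::nat. (2 ^ Suc j / d) ^ m)"
  have a: "a j \<ge> 0" for j using assms by (simp add: a_def)
  let ?S = "\<lambda>x::'a. \<Sum>j. ennreal (a j) * indicator (cball 0 (d / 2 ^ j)) x"
  have le: "ennreal (1 / norm x ^ m) * indicator (cball 0 d) x \<le> ?S x" if x0: "x \<noteq> 0" for x :: 'a
  proof (cases "x \<in> cball 0 d")
    case True
    obtain N0 where "(1 / 2) ^ N0 < norm x / d"
      using real_arch_pow_inv[of "norm x / d" "1 / 2"] x0 assms by auto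
    then have N0: "d / 2 ^ N0 < norm x" using assms by (simp add: field_simps)
    \<comment> \<open>The first dyadic radius below |x|; minimality puts x into the ball one step
      larger.\<close>
    define N where "N = (LEAST N. d / 2 ^ N < norm x)"
    have N: "d / 2 ^ N < norm x" unfolding N_def using N0 by (rule LeastI)
    have "N \<noteq> 0"
    proof
      assume "N = 0"
      then show False using N True by simp
    qed
    then obtain j where j: "N = Suc j" using not0_implies_Suc by blast
    have "\<not> d / 2 ^ j < norm x" using not_less_Least[of j "\<lambda>N. d / 2 ^ N < norm x"] j unfolding N_def by simp
    then have xj: "x \<in> cball 0 (d / 2 ^ j)" by simp
    have "1 / norm x \<le> 2 ^ Suc j / d"
      using N x0 assms unfolding j by (simp add: field_simps)
    then have "(1 / norm x) ^ m \<le> a j" unfolding a_def by (rule power_mono) simp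
    then have "ennreal (1 / norm x ^ m) * indicator (cball 0 d) x \<le> ennreal (a j) * indicator (cball 0 (d / 2 ^ j)) x"
      using True xj a by (simp add: power_one_over ennreal_leI)
    also have "\<dots> \<le> ?S x"
      by (rule ennreal_le_suminf)
    finally show ?thesis .
  qed simp
  have "(\<integral>\<^sup>+ x. ennreal (1 / norm (x::'a) ^ m) * indicator (cball 0 d) x \<partial>lborel) \<le> (\<integral>\<^sup>+ x. ?S x \<partial>lborel)"
    by (rule nn_integral_mono_AE) (use AE_lborel_singleton[of 0] le in auto)
  also have "\<dots> = (\<Sum>j. \<integral>\<^sup>+ x. ennreal (a j) * indicator (cball (0::'a) (d / 2 ^ j)) x \<partial>lborel)"
    by (intro nn_integral_suminf borel_measurable_times_ennreal borel_measurable_const borel_measurable_indicator) simp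
  also have "\<dots> = (\<Sum>j. ennreal (2 ^ Suc m * c * d * (1 / 2) ^ Suc j))"
  proof (rule suminf_cong)
    fix j :: nat
    have "(\<integral>\<^sup>+ x. ennreal (a j) * indicator (cball (0::'a) (d / 2 ^ j)) x \<partial>lborel)
        = ennreal (a j) * ennreal ((d / 2 ^ j) ^ Suc m * c)"
      using assms by (simp add: nn_integral_cmult_indicator emeasure_lborel_cball n c_def)
    also have "\<dots> = ennreal (a j * ((d / 2 ^ j) ^ Suc m * c))"
      by (rule ennreal_mult'[symmetric]) (rule a)
    finally have *: "(\<integral>\<^sup>+ x. ennreal (a j) * indicator (cball (0::'a) (d / 2 ^ j)) x \<partial>lborel)
       = ennreal (a j * ((d / 2 ^ j) ^ Suc m * c))" .
    have **: "a j * ((d / 2 ^ j) ^ Suc m * c) = 2 ^ Suc m * c * d * (1 / 2) ^ Suc j"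
    proof -
      have "a j * (d / 2 ^ j) ^ m = 2 ^ m"
        using assms unfolding a_def power_mult_distrib[symmetric] by simp
      then have "a j * ((d / 2 ^ j) ^ Suc m * c) = 2 ^ m * ((d / 2 ^ j) * c)"
        by (simp add: mult_ac)
      then show ?thesis by (simp add: power_one_over)
    qed
    show "(\<integral>\<^sup>+ x. ennreal (a j) * indicator (cball (0::'a) (d / 2 ^ j)) x \<partial>lborel)
       = ennreal (2 ^ Suc m * c * d * (1 / 2) ^ Suc j)" unfolding * ** ..
  qed
  also have "\<dots> = ennreal (2 ^ Suc m * c * d * 1)"
    using assms by (intro suminf_ennreal_eq sums_mult power_half_series) (simp add: c_def)
  finally show ?thesis by (simp add: m_def[symmetric] n c_def)
qed

text \<open>Unit shells: for j \<le> |x| \<le> j + 1 the Gaussian is at most K/(j+1)^(n+2), the ball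
  of radius j + 1 has volume proportional to (j+1)^n, and the sum of 1/(j+1)^2 converges.\<close>

lemma integrable_gaussian:
  assumes b: "b > 0"
  shows "integrable lborel (\<lambda>x::'a::euclidean_space. exp (- b * (norm x)\<^sup>2))"
proof (rule integrableI_bounded)
  define n where "n = DIM('a)"
  define c where "c = measure lborel (ball (0::'a) 1)"
  \<comment> \<open>Writing exp(-b j^2) = exp(b) exp(-b(1 + j^2)) avoids a zero denominator at j =
    0. The factorial and b^(n+1) stem from \<open>power_times_exp_le\<close>, and 2^(n+1) from
    (j+1)^2 \<le> 2(1 + j^2).\<close>
  define K where "K = exp b * fact (n + 1) * 2 ^ (n + 1) / b ^ (n + 1)"
  have K: "K \<ge> 0" using b by (simp add: K_def)
  let ?a = "\<lambda>j::nat. K / real (Suc j) ^ (n + 2)"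
  let ?S = "\<lambda>x::'a. \<Sum>j. ennreal (?a j) * indicator (cball 0 (real (Suc j))) x"
  have le: "ennreal (norm (exp (- b * (norm x)\<^sup>2))) \<le> ?S x" for x :: 'a
  proof -
    define j where "j = nat \<lfloor>norm x\<rfloor>"
    have j: "real j \<le> norm x" "norm x \<le> real (Suc j)" by (auto simp: j_def) linarith
    have "(b * (1 + (real j)\<^sup>2)) ^ (n + 1) * exp (- (b * (1 + (real j)\<^sup>2))) \<le> fact (n + 1)"
      using b by (intro power_times_exp_le) auto
    then have 1: "exp (- (b * (1 + (real j)\<^sup>2))) \<le> fact (n + 1) / (b * (1 + (real j)\<^sup>2)) ^ (n + 1)"
      using b by (simp add: pos_le_divide_eq add_pos_nonneg mult.commute del: fact_Suc power_Suc)
    have 2: "real (Suc j) ^ (n + 2) / 2 ^ (n + 1) \<le> (1 + (real j)\<^sup>2) ^ (n + 1)"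
    proof -
      have "0 \<le> (real j - 1)\<^sup>2" by simp
      then have "(real (Suc j))\<^sup>2 / 2 \<le> 1 + (real j)\<^sup>2" by (simp add: power2_eq_square algebra_simps)
      then have "((real (Suc j))\<^sup>2 / 2) ^ (n + 1) \<le> (1 + (real j)\<^sup>2) ^ (n + 1)" by (rule power_mono) simp
      then have "((real (Suc j))\<^sup>2) ^ (n + 1) / 2 ^ (n + 1) \<le> (1 + (real j)\<^sup>2) ^ (n + 1)"
        by (simp only: power_divide)
      moreover have "real (Suc j) ^ (n + 2) \<le> ((real (Suc j))\<^sup>2) ^ (n + 1)"
        unfolding power_mult[symmetric] by (rule power_increasing) auto
      then have "real (Suc j) ^ (n + 2) / 2 ^ (n + 1) \<le> ((real (Suc j))\<^sup>2) ^ (n + 1) / 2 ^ (n + 1)"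
        by (rule divide_right_mono) simp
      ultimately show ?thesis by (rule order_trans[rotated])
    qed
    have "exp (- b * (norm x)\<^sup>2) \<le> exp (- b * (real j)\<^sup>2)"
      using j(1) b by (simp add: power_mono)
    also have "\<dots> = exp b * exp (- (b * (1 + (real j)\<^sup>2)))"
    proof -
      have e: "- b * (real j)\<^sup>2 = b + - (b * (1 + (real j)\<^sup>2))" by (simp add: distrib_left)
      show ?thesis by (subst e) (rule exp_add)
    qed
    also have "\<dots> \<le> exp b * (fact (n + 1) / (b * (1 + (real j)\<^sup>2)) ^ (n + 1))"
      using 1 by (intro mult_left_mono) auto
    also have "\<dots> = exp b * fact (n + 1) / b ^ (n + 1) / (1 + (real j)\<^sup>2) ^ (n + 1)"
      by (simp only: power_mult_distrib times_divide_eq_right divide_divide_eq_left)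
    also have "\<dots> \<le> exp b * fact (n + 1) / b ^ (n + 1) / (real (Suc j) ^ (n + 2) / 2 ^ (n + 1))"

    proof (rule divide_left_mono[OF 2])
      show "0 < (1 + (real j)\<^sup>2) ^ (n + 1) * (real (Suc j) ^ (n + 2) / 2 ^ (n + 1))"
        by (intro mult_pos_pos zero_less_power divide_pos_pos add_pos_nonneg) simp_all
    qed (use b in simp)
    also have "\<dots> = ?a j" by (simp add: K_def)
    finally have "ennreal (norm (exp (- b * (norm x)\<^sup>2))) \<le> ennreal (?a j) * indicator (cball 0 (real (Suc j))) x"
      using j by (simp add: ennreal_leI)
    also have "\<dots> \<le> ?S x"
      by (rule ennreal_le_suminf)
    finally show ?thesis .
  qed
  have "(\<integral>\<^sup>+ x. ennreal (norm (exp (- b * (norm (x::'a))\<^sup>2))) \<partial>lborel) \<le> (\<integral>\<^sup>+ x. ?S x \<partial>lborel)"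
    by (rule nn_integral_mono) (rule le)
  also have "\<dots> = (\<Sum>j. \<integral>\<^sup>+ x. ennreal (?a j) * indicator (cball (0::'a) (real (Suc j))) x \<partial>lborel)"
    by (intro nn_integral_suminf borel_measurable_times_ennreal borel_measurable_const borel_measurable_indicator) simp
  also have "\<dots> = (\<Sum>j. ennreal (K * c * inverse (real (Suc j) ^ 2)))"
  proof (rule suminf_cong)
    fix j :: nat
    have "(\<integral>\<^sup>+ x. ennreal (?a j) * indicator (cball (0::'a) (real (Suc j))) x \<partial>lborel)
        = ennreal (?a j) * ennreal (real (Suc j) ^ n * c)"
      by (simp add: nn_integral_cmult_indicator emeasure_lborel_cball n_def c_def)
    also have "\<dots> = ennreal (?a j * (real (Suc j) ^ n * c))"
      by (rule ennreal_mult'[symmetric]) (use K in simp)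
    finally have *: "(\<integral>\<^sup>+ x. ennreal (?a j) * indicator (cball (0::'a) (real (Suc j))) x \<partial>lborel)
       = ennreal (?a j * (real (Suc j) ^ n * c))" .
    have **: "?a j * (real (Suc j) ^ n * c) = K * c * inverse (real (Suc j) ^ 2)"
      by (simp add: power_add divide_inverse power2_eq_square del: of_nat_Suc)
    show "(\<integral>\<^sup>+ x. ennreal (?a j) * indicator (cball (0::'a) (real (Suc j))) x \<partial>lborel)
       = ennreal (K * c * inverse (real (Suc j) ^ 2))" unfolding * ** ..
  qed
  also have "\<dots> < \<infinity>"
  proof -
    have "summable (\<lambda>j. inverse (real (Suc j) ^ 2))"
      using inverse_power_summable[of 2] summable_Suc_iff[of "\<lambda>j. inverse (real j ^ 2)"] by simp
    then have "summable (\<lambda>j. K * c * inverse (real (Suc j) ^ 2))" by (rule summable_mult)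
    then have "(\<Sum>j. ennreal (K * c * inverse (real (Suc j) ^ 2))) = ennreal (\<Sum>j. K * c * inverse (real (Suc j) ^ 2))"
      using K by (intro suminf_ennreal2) (auto simp: c_def)
    then show ?thesis by simp
  qed
  finally show "(\<integral>\<^sup>+ x. ennreal (norm (exp (- b * (norm (x::'a))\<^sup>2))) \<partial>lborel) < \<infinity>" .
qed simp

lemma integrable_gaussian_shift:
  assumes "b > 0"
  shows "integrable lborel (\<lambda>x::'a::euclidean_space. exp (- b * (norm (x - p))\<^sup>2))"
proof -
  have "integrable lborel (\<lambda>x::'a. exp (- b * (norm (- p + x))\<^sup>2))"
    using lborel_integral_translate(2)[of "\<lambda>x::'a. exp (- b * (norm x)\<^sup>2)" "- p"] integrable_gaussian[OF assms, where 'a='a]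
    by simp
  then show ?thesis by simp
qed

section \<open>Testing with radial solutions\<close>

definition locally_integrable :: "('a::euclidean_space \<Rightarrow> complex) \<Rightarrow> bool" where
  "locally_integrable v \<longleftrightarrow> v \<in> borel_measurable borel \<and>
     (\<forall>R. integrable lborel (\<lambda>x. indicator (cball 0 R) x *\<^sub>R v x))"

text \<open>v = o(|x|^(-(n-1)/2)), squared so as to have an integer power, and almost everywhere
  because \<open>v\<close> will be a representative of the scattered field up to a null set.\<close>

definition vanishes_at_infinity :: "('a::euclidean_space \<Rightarrow> complex) \<Rightarrow> bool" where
  "vanishes_at_infinity v \<longleftrightarrow>
     (\<forall>e>0. \<exists>R. AE x in lborel. norm x \<ge> R \<longrightarrow> norm x ^ (DIM('a) - 1) * (norm (v x))\<^sup>2 \<le> e)"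

lemma locally_integrable_mult:
  assumes v: "locally_integrable v" and f: "continuous_on UNIV f" "compact K" "\<And>x. x \<notin> K \<Longrightarrow> f x = 0"
  shows "integrable lborel (\<lambda>x. v x * of_real (f x))"
proof -
  obtain r where r: "K \<subseteq> cball 0 r"
    using compact_imp_bounded[OF f(2)] unfolding bounded_iff by (metis mem_cball_0 subsetI)
  have "bounded (f ` K)"
    by (intro compact_imp_bounded compact_continuous_image continuous_on_subset[OF f(1)] f(2)) auto
  then obtain M where M: "\<And>x. x \<in> K \<Longrightarrow> norm (f x) \<le> M"
    unfolding bounded_iff by auto
  have vb: "v \<in> borel_measurable lborel" "f \<in> borel_measurable lborel"
    using v borel_measurable_continuous_onI[OF f(1)] by (auto simp: locally_integrable_def)
  show ?thesis
  proof (rule Bochner_Integration.integrable_bound)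
    show "integrable lborel (\<lambda>x. \<bar>M\<bar> *\<^sub>R (indicator (cball 0 r) x *\<^sub>R v x))"
      by (rule integrable_scaleR_right) (use v in \<open>auto simp: locally_integrable_def\<close>)
    show "(\<lambda>x. v x * of_real (f x)) \<in> borel_measurable lborel"
      using vb by measurable
    have "norm (v x * of_real (f x)) \<le> norm (\<bar>M\<bar> *\<^sub>R (indicator (cball 0 r) x *\<^sub>R v x))" for x
    proof (cases "x \<in> K")
      case True
      then have "norm (v x) * \<bar>f x\<bar> \<le> norm (v x) * \<bar>M\<bar>" using M[OF True] by (intro mult_left_mono) auto
      then show ?thesis using True r by (auto simp: norm_mult mult.commute subset_iff)
    qed (simp add: f(3))
    then show "AE x in lborel. norm (v x * of_real (f x)) \<le> norm (\<bar>M\<bar> *\<^sub>R (indicator (cball 0 r) x *\<^sub>R v x))"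
      by simp
  qed
qed

lemma vanishes_at_infinity_bounded:
  fixes v :: "'a::euclidean_space \<Rightarrow> complex"
  assumes "vanishes_at_infinity v"
  obtains R where "AE x in lborel. norm x \<ge> R \<longrightarrow> norm (v x) \<le> 1"
proof -
  obtain R where R: "AE x in lborel. norm x \<ge> R \<longrightarrow> norm x ^ (DIM('a) - 1) * (norm (v x))\<^sup>2 \<le> 1"
    using assms unfolding vanishes_at_infinity_def by (metis zero_less_one)
  have "AE x in lborel. norm x \<ge> max R 1 \<longrightarrow> norm (v x) \<le> 1"
    using R
  proof (rule eventually_mono, intro impI)
    fix x assume *: "norm x \<ge> R \<longrightarrow> norm x ^ (DIM('a) - 1) * (norm (v x))\<^sup>2 \<le> 1" "norm x \<ge> max R 1"
    then have "1 * (norm (v x))\<^sup>2 \<le> norm x ^ (DIM('a) - 1) * (norm (v x))\<^sup>2"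
      by (intro mult_right_mono one_le_power) auto
    also have "\<dots> \<le> 1" using * by simp
    finally show "norm (v x) \<le> 1" by (simp add: power_le_one_iff)
  qed
  then show thesis by (rule that)
qed

text \<open>On a ball the product is dominated by |G| |v|; outside it, where |v| \<le> 1 almost
  everywhere, by |G| times the Gaussian.\<close>

lemma integrable_mult_gaussian:
  fixes v :: "'a::euclidean_space \<Rightarrow> complex"
  assumes v: "locally_integrable v" "vanishes_at_infinity v" and b: "b > 0"
  shows "integrable lborel (\<lambda>x. v x * of_real (G * exp (- b * (norm (x - p))\<^sup>2)))"
proof -
  obtain R where R: "AE x in lborel. norm x \<ge> R \<longrightarrow> norm (v x) \<le> 1"
    using vanishes_at_infinity_bounded[OF v(2)] by blast
  let ?g = "\<lambda>x. exp (- b * (norm (x - p))\<^sup>2)"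
  have vb: "v \<in> borel_measurable lborel" using v(1) by (auto simp: locally_integrable_def)
  have gm: "?g \<in> borel_measurable lborel" by simp
  show ?thesis
  proof (rule Bochner_Integration.integrable_bound)
    show "integrable lborel (\<lambda>x. \<bar>G\<bar> * norm (indicator (cball 0 R) x *\<^sub>R v x) + \<bar>G\<bar> * ?g x)"
      using v(1) integrable_gaussian_shift[OF b]
      by (intro Bochner_Integration.integrable_add integrable_mult_right integrable_norm) (auto simp: locally_integrable_def)
    show "(\<lambda>x. v x * of_real (G * ?g x)) \<in> borel_measurable lborel"
      using vb gm by measurable
    show "AE x in lborel. norm (v x * of_real (G * ?g x)) \<le>
        norm (\<bar>G\<bar> * norm (indicator (cball 0 R) x *\<^sub>R v x) + \<bar>G\<bar> * ?g x)"
      using R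
    proof (rule eventually_mono)
      fix x assume x: "norm x \<ge> R \<longrightarrow> norm (v x) \<le> 1"
      have g: "0 \<le> ?g x" "?g x \<le> 1" using b by auto
      have eq: "norm (v x * of_real (G * ?g x)) = \<bar>G\<bar> * (norm (v x) * ?g x)"
        by (simp add: norm_mult)
      have "norm (v x) * ?g x \<le> norm (indicator (cball 0 R) x *\<^sub>R v x) + ?g x"
      proof (cases "norm x \<le> R")
        case True
        then have "norm (v x) * ?g x \<le> norm (v x) * 1" using g by (intro mult_left_mono) auto
        moreover have "norm (indicator (cball 0 R) x *\<^sub>R v x) = norm (v x)" using True by simp
        ultimately show ?thesis using g(1) by linarith
      next
        case False
        then have "norm (v x) * ?g x \<le> 1 * ?g x" using x g by (intro mult_right_mono) auto
        then show ?thesis using False by simp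
      qed
      then have "\<bar>G\<bar> * (norm (v x) * ?g x) \<le> \<bar>G\<bar> * (norm (indicator (cball 0 R) x *\<^sub>R v x) + ?g x)"
        by (rule mult_left_mono) simp
      also have "\<dots> \<le> norm (\<bar>G\<bar> * norm (indicator (cball 0 R) x *\<^sub>R v x) + \<bar>G\<bar> * ?g x)"
        by (simp add: distrib_left)
      finally show "norm (v x * of_real (G * ?g x)) \<le>
          norm (\<bar>G\<bar> * norm (indicator (cball 0 R) x *\<^sub>R v x) + \<bar>G\<bar> * ?g x)"
        unfolding eq .
    qed
  qed
qed

text \<open>Testing with the radial function cut off at radius \<open>R\<close>, the commutator terms live on the
  annulus between \<open>R\<close> and \<open>2R\<close>, where they are \<open>o(R ^ - n)\<close> because both \<open>v\<close> and the radial
  function decay like \<open>|x| ^ - (n - 1) / 2\<close>.\<close>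
lemma radial_identity:
  fixes v q :: "'a::euclidean_space \<Rightarrow> complex"
  assumes n: "DIM('a) \<ge> 2" and k: "k > 0" and b: "b > 0"
    and v: "locally_integrable v" "vanishes_at_infinity v"
    and q: "integrable lborel q" "\<And>x. x \<notin> cball 0 \<rho> \<Longrightarrow> q x = 0"
    and weak: "\<And>\<phi>. test_fn \<phi> \<Longrightarrow> (LBINT x. v x * of_real (laplacian \<phi> x + k\<^sup>2 * \<phi> x))
        + (LBINT x. q x * of_real (\<phi> x)) = 0"
    and H: "radial_sol DIM('a) k (\<lambda>s. G * exp (- b * s)) H"
  shows "(LBINT x. v x * of_real (G * exp (- b * (norm (x - p))\<^sup>2)))
        + (LBINT x. q x * of_real (H 0 ((norm (x - p))\<^sup>2))) = 0"
proof -
  let ?n = "DIM('a)"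
  define m where "m = ?n - 1"
  have nm: "?n = Suc m" using n by (simp add: m_def)
  have dH: "derivs H" and ode: "4 * s * H 2 s + 2 * real ?n * H 1 s + k\<^sup>2 * H 0 s = G * exp (- b * s)" for s
    using H by (auto simp: radial_sol_def)
  define s where "s = (\<lambda>x::'a. (norm (x - p))\<^sup>2)"
  have smooth_s: "smooth s" unfolding s_def by (rule smooth_norm_sq)
  have s0: "s x \<ge> 0" for x by (simp add: s_def)
  obtain c1 c2 K where c: "\<And>t. (cutoff has_real_derivative c1 t) (at t)" "\<And>t. (c1 has_real_derivative c2 t) (at t)"
    "\<And>t. t < 1 \<or> t > 4 \<Longrightarrow> c1 t = 0 \<and> c2 t = 0"
    "\<And>t. \<bar>c1 t\<bar> \<le> K \<and> \<bar>c2 t\<bar> \<le> K"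
    using cutoff_derivs by metis
  have K0: "K \<ge> 0" using c(4)[of 0] by linarith
  obtain C r0 where decay: "\<And>r. r \<ge> r0 \<Longrightarrow> r ^ m * ((H 0 (r\<^sup>2))\<^sup>2 + (2 * r * H 1 (r\<^sup>2))\<^sup>2) \<le> C"
    using radial_sol_decay[OF H n k b] unfolding m_def by blast
  have C0: "C \<ge> 0" using decay[of "max r0 0"] by (rule order_trans[rotated]) auto
  define R where "R = (\<lambda>j. real (Suc j))"
  have R1: "R j \<ge> 1" for j by (simp add: R_def)
  have Rpos: "R j > 0" for j using R1[of j] by linarith
  define ct where "ct = (\<lambda>j x. cutoff (s x / (R j)\<^sup>2))"
  define \<phi> where "\<phi> = (\<lambda>j x. H 0 (s x) * ct j x)"
  \<comment> \<open>The commutator of the Laplacian with the cutoff: the first summand is twice the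
    inner product of the gradients of solution and cutoff, the bracket is the Laplacian of the
    cutoff, all expressed in s.\<close>
  define E where "E = (\<lambda>j x. 8 * s x * H 1 (s x) * c1 (s x / (R j)\<^sup>2) / (R j)\<^sup>2
      + H 0 (s x) * (4 * s x * c2 (s x / (R j)\<^sup>2) / (R j) ^ 4 + 2 * real ?n * c1 (s x / (R j)\<^sup>2) / (R j)\<^sup>2))"
  have smooth_ct: "smooth (ct j)" for j
  proof -
    have "smooth (\<lambda>x. (1 / (R j)\<^sup>2) * s x)"
      by (intro smooth_mult smooth_const smooth_s)
    then show ?thesis unfolding ct_def by (intro smooth_cutoff) simp
  qed
  have smooth_\<phi>: "smooth (\<phi> j)" for j
    unfolding \<phi>_def by (intro smooth_mult smooth_compose[OF dH] smooth_s smooth_ct)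
  have ct0: "ct j x = 0" if "x \<notin> cball p (2 * R j)" for j x
  proof -
    have "norm (x - p) \<ge> 2 * R j" using that by (simp add: dist_norm norm_minus_commute)
    then have "s x \<ge> (2 * R j)\<^sup>2" unfolding s_def using Rpos[of j] by (intro power_mono) auto
    then have "s x / (R j)\<^sup>2 \<ge> 4" using Rpos[of j] by (simp add: pos_le_divide_eq power_mult_distrib)
    then show ?thesis unfolding ct_def by (rule cutoff_ge_4)
  qed
  have test: "test_fn (\<phi> j)" for j
    unfolding test_fn_def
  proof (intro conjI exI allI impI)
    show "\<phi> j x = 0" if "x \<notin> cball p (2 * R j)" for x
      using ct0[OF that] by (simp add: \<phi>_def)
  qed (rule smooth_\<phi> compact_cball)+
  have lap: "laplacian (\<phi> j) x + k\<^sup>2 * \<phi> j x = ct j x * (G * exp (- b * s x)) + E j x" for j x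
  proof -
    let ?t = "\<lambda>u. u / (R j)\<^sup>2"
    define f1 where "f1 = (\<lambda>u. H 1 u * cutoff (?t u) + H 0 u * (c1 (?t u) / (R j)\<^sup>2))"
    define f2 where "f2 = (\<lambda>u. H 2 u * cutoff (?t u) + 2 * (H 1 u * (c1 (?t u) / (R j)\<^sup>2)) + H 0 u * (c2 (?t u) / (R j) ^ 4))"
    have t: "(?t has_real_derivative 1 / (R j)\<^sup>2) (at u)" for u
      by (rule DERIV_cdivide[OF DERIV_ident])
    have k0: "((\<lambda>u. cutoff (?t u)) has_real_derivative c1 (?t u) / (R j)\<^sup>2) (at u)" for u
      using DERIV_chain2[where g = ?t, OF c(1) t] by simp
    have k1: "((\<lambda>u. c1 (?t u) / (R j)\<^sup>2) has_real_derivative c2 (?t u) / (R j) ^ 4) (at u)" for u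
      using DERIV_cdivide[where c = "(R j)\<^sup>2", OF DERIV_chain2[where g = ?t, OF c(2) t[of u]]]
      by (simp add: power2_eq_square power4_eq_xxxx mult.assoc)
    have H01: "(H 0 has_real_derivative H 1 u) (at u)" "(H 1 has_real_derivative H 2 u) (at u)" for u
      using derivsD[OF dH, of 0 u] derivsD[OF dH, of 1 u] by (simp_all add: numeral_2_eq_2)
    have f: "((\<lambda>u. H 0 u * cutoff (?t u)) has_real_derivative f1 u) (at u)" for u
      using DERIV_mult[OF H01(1) k0, of u] by (simp add: f1_def mult.commute)
    have f': "(f1 has_real_derivative f2 u) (at u)" for u
      using DERIV_add[OF DERIV_mult[OF H01(2) k0, of u] DERIV_mult[OF H01(1) k1, of u]]
      unfolding f1_def f2_def by (rule DERIV_cong) (simp add: algebra_simps)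
    have "laplacian (\<phi> j) x = 4 * s x * f2 (s x) + 2 * real ?n * f1 (s x)"
      using laplacian_radial[OF f f', of p x] by (simp add: \<phi>_def ct_def s_def)
    then have "laplacian (\<phi> j) x + k\<^sup>2 * \<phi> j x
       = ct j x * (4 * s x * H 2 (s x) + 2 * real ?n * H 1 (s x) + k\<^sup>2 * H 0 (s x)) + E j x"
      unfolding f1_def f2_def \<phi>_def ct_def E_def
      by (simp only: distrib_left distrib_right times_divide_eq_right times_divide_eq_left) (simp add: mult_ac)
    then show ?thesis unfolding ode .
  qed
  have vb: "v \<in> borel_measurable lborel" using v(1) by (auto simp: locally_integrable_def)
  have qb: "q \<in> borel_measurable lborel" using q(1) by auto
  have ctb: "ct j \<in> borel_measurable lborel" for j
    using borel_measurable_continuous_onI[OF smooth_continuous_on[OF smooth_ct[of j], of UNIV]] by simp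
  have cH: "continuous_on UNIV (\<lambda>x. H 0 (s x))"
    by (rule smooth_continuous_on[OF smooth_compose[OF dH smooth_s]])
  have Hb: "(\<lambda>x. H 0 (s x)) \<in> borel_measurable lborel"
    using borel_measurable_continuous_onI[OF cH] by simp
  define vg where "vg = (\<lambda>x. v x * of_real (G * exp (- b * s x)))"
  have vg: "integrable lborel vg"
    unfolding vg_def s_def by (rule integrable_mult_gaussian[OF v b])
  have ct01: "\<bar>ct j x\<bar> \<le> 1" for j x
    using cutoff_bounds by (simp add: ct_def abs_le_iff order_trans[of _ 0])
  have ctlim: "(\<lambda>j. ct j x) \<longlonglongrightarrow> 1" for x
  proof (rule tendsto_eventually)
    obtain J :: nat where J: "s x \<le> real J" using real_arch_simple by blast
    show "\<forall>\<^sub>F j in sequentially. ct j x = 1"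
    proof (rule eventually_sequentiallyI[of J])
      fix j assume "j \<ge> J"
      then have "s x \<le> R j" using J by (simp add: R_def)
      also have "R j \<le> (R j)\<^sup>2" using R1[of j] by (simp add: self_le_power)
      finally have "s x / (R j)\<^sup>2 \<le> 1" using Rpos[of j] by (simp add: pos_divide_le_eq)
      then show "ct j x = 1" unfolding ct_def by (rule cutoff_le_1)
    qed
  qed
  have int_ct: "integrable lborel (\<lambda>x. vg x * of_real (ct j x))" for j
  proof (rule Bochner_Integration.integrable_bound[OF vg])
    show "(\<lambda>x. vg x * of_real (ct j x)) \<in> borel_measurable lborel"
      using vg ctb[of j] by measurable
    have "norm (vg x * of_real (ct j x)) \<le> norm (vg x)" for x
      using mult_left_mono[OF ct01[of j x], of "norm (vg x)"] by (simp add: norm_mult)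
    then show "AE x in lborel. norm (vg x * of_real (ct j x)) \<le> norm (vg x)" by simp
  qed
  have limA: "(\<lambda>j. (LBINT x. vg x * of_real (ct j x))) \<longlonglongrightarrow> integral\<^sup>L lborel vg"
  proof (rule integral_dominated_convergence[where w = "\<lambda>x. norm (vg x)"])
    show "(\<lambda>x. vg x * of_real (ct j x)) \<in> borel_measurable lborel" for j
      using int_ct[of j] by (rule borel_measurable_integrable)
    have "norm (vg x * of_real (ct j x)) \<le> norm (vg x)" for x j
      using mult_left_mono[OF ct01[of j x], of "norm (vg x)"] by (simp add: norm_mult)
    then show "AE x in lborel. norm (vg x * of_real (ct j x)) \<le> norm (vg x)" for j by simp
    have "(\<lambda>j. vg x * of_real (ct j x)) \<longlonglongrightarrow> vg x" for x
      using tendsto_mult[OF tendsto_const tendsto_of_real[OF ctlim[of x]], of "vg x"] by simp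
    then show "AE x in lborel. (\<lambda>j. vg x * of_real (ct j x)) \<longlonglongrightarrow> vg x" by simp
  qed (use vg in auto)
  have "bounded ((\<lambda>x. H 0 (s x)) ` cball 0 \<rho>)"
    by (intro compact_imp_bounded compact_continuous_image continuous_on_subset[OF cH]) auto
  then obtain Mq where "\<forall>y\<in>(\<lambda>x. H 0 (s x)) ` cball 0 \<rho>. norm y \<le> Mq"
    unfolding bounded_iff by blast
  then have Mq: "\<bar>H 0 (s x)\<bar> \<le> Mq" if "x \<in> cball 0 \<rho>" for x
    using that by (metis image_eqI real_norm_def)
  have qbound: "norm (q x * of_real (\<phi> j x)) \<le> \<bar>Mq\<bar> * norm (q x)" for x j
  proof (cases "x \<in> cball 0 \<rho>")
    case True
    have "\<bar>\<phi> j x\<bar> \<le> \<bar>Mq\<bar> * 1"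
      unfolding \<phi>_def abs_mult using Mq[OF True] ct01 by (intro mult_mono) auto
    then show ?thesis
      using mult_left_mono[of "\<bar>\<phi> j x\<bar>" "\<bar>Mq\<bar>" "norm (q x)"] by (simp add: norm_mult mult.commute)
  next
    case False
    then show ?thesis by (simp add: q(2))
  qed
  have limB: "(\<lambda>j. (LBINT x. q x * of_real (\<phi> j x))) \<longlonglongrightarrow> (LBINT x. q x * of_real (H 0 (s x)))"
  proof (rule integral_dominated_convergence[where w = "\<lambda>x. \<bar>Mq\<bar> * norm (q x)"])
    show "(\<lambda>x. q x * of_real (H 0 (s x))) \<in> borel_measurable lborel"
      using qb Hb by measurable
    show "(\<lambda>x. q x * of_real (\<phi> j x)) \<in> borel_measurable lborel" for j
      unfolding \<phi>_def using qb Hb ctb[of j] by measurable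
    show "AE x in lborel. norm (q x * of_real (\<phi> j x)) \<le> \<bar>Mq\<bar> * norm (q x)" for j using qbound by simp
    have "(\<lambda>j. q x * of_real (H 0 (s x) * ct j x)) \<longlonglongrightarrow> q x * of_real (H 0 (s x) * 1)" for x
      by (intro tendsto_mult tendsto_const tendsto_of_real ctlim)
    then show "AE x in lborel. (\<lambda>j. q x * of_real (\<phi> j x)) \<longlonglongrightarrow> q x * of_real (H 0 (s x))"
      by (simp add: \<phi>_def)
  qed (use q(1) in auto)
  have intL: "integrable lborel (\<lambda>x. v x * of_real (laplacian (\<phi> j) x + k\<^sup>2 * \<phi> j x))" for j
  proof (rule test_fn_props[OF test[of j]])
    fix S
    assume S: "compact S" "\<And>x. x \<notin> S \<Longrightarrow> \<phi> j x = 0" "\<And>x. x \<notin> S \<Longrightarrow> laplacian (\<phi> j) x = 0"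
    show ?thesis
    proof (rule locally_integrable_mult[OF v(1) _ S(1)])
      show "laplacian (\<phi> j) x + k\<^sup>2 * \<phi> j x = 0" if "x \<notin> S" for x
        using S(2,3)[OF that] by simp
      show "continuous_on UNIV (\<lambda>x. laplacian (\<phi> j) x + k\<^sup>2 * \<phi> j x)"
        by (intro continuous_on_add continuous_on_mult continuous_on_const continuous_on_laplacian
            smooth_continuous_on smooth_\<phi>)
    qed
  qed
  have vE: "v x * of_real (E j x) = v x * of_real (laplacian (\<phi> j) x + k\<^sup>2 * \<phi> j x) - vg x * of_real (ct j x)" for j x
    unfolding lap vg_def by (simp add: algebra_simps)
  have intE: "integrable lborel (\<lambda>x. v x * of_real (E j x))" for j
    unfolding vE by (intro Bochner_Integration.integrable_diff intL int_ct)
  \<comment> \<open>On the annulus s/R^2 is at most 4; the gradient term contributes 16 K and the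
    Laplacian of the cutoff (16 + 2n) K, each with a factor 1/R.\<close>
  define A where "A = K * (32 + 2 * real ?n)"
  have A0: "A \<ge> 0" using K0 by (simp add: A_def)
  have Ebound: "\<bar>E j x\<bar> \<le> A / R j * (\<bar>H 0 (s x)\<bar> + \<bar>2 * norm (x - p) * H 1 (s x)\<bar>)"
    if x: "(R j)\<^sup>2 \<le> s x" "s x \<le> 4 * (R j)\<^sup>2" for j x
  proof -
    let ?t = "s x / (R j)\<^sup>2"
    let ?w = "\<bar>H 0 (s x)\<bar>" and ?w1 = "\<bar>2 * norm (x - p) * H 1 (s x)\<bar>"
    have Rs: "R j \<le> norm (x - p)" using x(1) Rpos[of j] by (simp add: s_def)
    have R2: "(R j)\<^sup>2 > 0" using Rpos[of j] by simp
    have t4: "?t \<le> 4" "?t \<ge> 0" using x R2 s0[of x] by (simp_all add: pos_divide_le_eq)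
    have H1: "\<bar>H 1 (s x)\<bar> \<le> ?w1 / (2 * R j)"
    proof -
      have "2 * R j * \<bar>H 1 (s x)\<bar> \<le> 2 * norm (x - p) * \<bar>H 1 (s x)\<bar>" using Rs by (intro mult_right_mono) auto
      then show ?thesis using Rpos[of j] by (simp add: pos_le_divide_eq abs_mult mult.commute)
    qed
    have e1: "\<bar>8 * s x * H 1 (s x) * c1 ?t / (R j)\<^sup>2\<bar> \<le> K * 16 / R j * ?w1"
    proof -
      have "\<bar>8 * s x * H 1 (s x) * c1 ?t / (R j)\<^sup>2\<bar> = 8 * (?t * (\<bar>H 1 (s x)\<bar> * \<bar>c1 ?t\<bar>))"
        using s0[of x] by (simp add: abs_mult)
      also have "\<dots> \<le> 8 * (4 * (?w1 / (2 * R j) * K))"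
        using t4 H1 c(4)[of ?t] K0 Rpos[of j] by (intro mult_left_mono mult_mono) auto
      also have "\<dots> = K * 16 / R j * ?w1" by simp
      finally show ?thesis .
    qed
    have e2: "\<bar>4 * s x * c2 ?t / (R j) ^ 4 + 2 * real ?n * c1 ?t / (R j)\<^sup>2\<bar> \<le> K * (16 + 2 * real ?n) / R j"
    proof -
      have "4 * s x * c2 ?t / (R j) ^ 4 = 4 * (?t * c2 ?t) / (R j)\<^sup>2"
        by (simp add: power2_eq_square power4_eq_xxxx)
      then have "\<bar>4 * s x * c2 ?t / (R j) ^ 4 + 2 * real ?n * c1 ?t / (R j)\<^sup>2\<bar>
         = \<bar>4 * (?t * c2 ?t) + 2 * real ?n * c1 ?t\<bar> / (R j)\<^sup>2"
        using R2 by (simp only: add_divide_distrib[symmetric] abs_divide)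
      also have "\<dots> \<le> (4 * (4 * K) + 2 * real ?n * K) / (R j)\<^sup>2"
      proof (rule divide_right_mono)
        have "\<bar>?t * c2 ?t\<bar> \<le> 4 * K"
          unfolding abs_mult using t4 c(4)[of ?t] by (intro mult_mono) auto
        moreover have "\<bar>2 * real ?n * c1 ?t\<bar> \<le> 2 * real ?n * K"
          unfolding abs_mult using c(4)[of ?t] by (intro mult_mono) auto
        ultimately show "\<bar>4 * (?t * c2 ?t) + 2 * real ?n * c1 ?t\<bar> \<le> 4 * (4 * K) + 2 * real ?n * K"
          by linarith
      qed simp
      also have "\<dots> = K * (16 + 2 * real ?n) / (R j)\<^sup>2" by (simp add: algebra_simps)
      also have "\<dots> \<le> K * (16 + 2 * real ?n) / R j"
      proof (rule divide_left_mono)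
        show "R j \<le> (R j)\<^sup>2" using R1[of j] by (simp add: self_le_power)
        show "0 < (R j)\<^sup>2 * R j" using Rpos[of j] by simp
      qed (use K0 in simp)
      finally show ?thesis .
    qed
    have "\<bar>E j x\<bar> \<le> K * 16 / R j * ?w1 + ?w * (K * (16 + 2 * real ?n) / R j)"
    proof -
      have "\<bar>E j x\<bar> \<le> \<bar>8 * s x * H 1 (s x) * c1 ?t / (R j)\<^sup>2\<bar>
          + \<bar>H 0 (s x) * (4 * s x * c2 ?t / (R j) ^ 4 + 2 * real ?n * c1 ?t / (R j)\<^sup>2)\<bar>"
        unfolding E_def by (rule abs_triangle_ineq)
      moreover have "\<bar>H 0 (s x) * (4 * s x * c2 ?t / (R j) ^ 4 + 2 * real ?n * c1 ?t / (R j)\<^sup>2)\<bar>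
          \<le> ?w * (K * (16 + 2 * real ?n) / R j)"
        unfolding abs_mult[of "H 0 (s x)"] using e2 by (rule mult_left_mono) simp
      ultimately show ?thesis using e1 by linarith
    qed
    also have "\<dots> \<le> A / R j * ?w1 + ?w * (A / R j)"
      unfolding A_def using K0 Rpos[of j]
      by (intro add_mono mult_right_mono mult_left_mono divide_right_mono) auto
    finally show ?thesis by (simp add: distrib_left mult.commute)
  qed
  have sq: "(\<bar>a\<bar> + \<bar>b\<bar>)\<^sup>2 \<le> 2 * (a\<^sup>2 + b\<^sup>2)" for a b :: real
  proof -
    have "(x + y)\<^sup>2 \<le> 2 * (x\<^sup>2 + y\<^sup>2)" for x y :: real
      using zero_le_power2[of "x - y"] by (simp add: power2_eq_square algebra_simps)
    from this[of "\<bar>a\<bar>" "\<bar>b\<bar>"] show ?thesis by (simp only: power2_abs)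
  qed
  \<comment> \<open>The pointwise bound \<open>D\<close>, of size e/R^n, times the volume of the
    ball of radius 2R: the powers of R cancel.\<close>
  define B where "B = A * sqrt (2 ^ Suc m * C) * 2 ^ ?n * measure lborel (cball (0::'a) 1)"
  have B0: "B \<ge> 0" using A0 C0 by (simp add: B_def)
  have small: "\<forall>\<^sub>F j in sequentially. norm ((LBINT x. v x * of_real (E j x))) \<le> e * B" if e: "e > 0" for e
  proof -
    obtain R0 where R0: "AE x in lborel. norm x \<ge> R0 \<longrightarrow> norm x ^ m * (norm (v x))\<^sup>2 \<le> e\<^sup>2"
      using v(2) e unfolding vanishes_at_infinity_def m_def by (meson zero_less_power)
    \<comment> \<open>R \<ge> 2|p| gives r = |x - p| \<le> 2|x| on the annulus, and then R \<ge> 2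
      R0 gives |x| \<ge> R0, so that the decay of \<open>v\<close> can be used there.\<close>
    obtain J :: nat where J: "max (max r0 (2 * norm p)) (2 * R0) \<le> real J" using real_arch_simple by blast
    show ?thesis
    proof (rule eventually_sequentiallyI[of J])
      fix j assume j: "j \<ge> J"
      have Rj: "r0 \<le> R j" "2 * norm p \<le> R j" "2 * R0 \<le> R j" using J j by (auto simp: R_def)
      define D where "D = e * (A * sqrt (2 ^ Suc m * C)) / (R j) ^ ?n"
      have D0: "D \<ge> 0" using e A0 C0 Rpos[of j] by (simp add: D_def)
      have pt: "norm (v x * of_real (E j x)) \<le> D * indicator (cball p (2 * R j)) x"
        if vx: "norm x \<ge> R0 \<longrightarrow> norm x ^ m * (norm (v x))\<^sup>2 \<le> e\<^sup>2" for x
      proof (cases "(R j)\<^sup>2 \<le> s x \<and> s x \<le> 4 * (R j)\<^sup>2")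
        case False
        then have "s x / (R j)\<^sup>2 < 1 \<or> s x / (R j)\<^sup>2 > 4"
          using Rpos[of j] by (auto simp: pos_divide_less_eq pos_less_divide_eq)
        then have "E j x = 0" using c(3) unfolding E_def by auto
        then show ?thesis using D0 by simp
      next
        case True
        define r where "r = norm (x - p)"
        have sr: "s x = r\<^sup>2" by (simp add: s_def r_def)
        have r: "R j \<le> r" "r \<le> 2 * R j"
        proof -
          show "R j \<le> r" using True Rpos[of j] by (simp add: s_def r_def)
          have "r\<^sup>2 \<le> (2 * R j)\<^sup>2" using True by (simp add: s_def r_def power_mult_distrib)
          then show "r \<le> 2 * R j" by (rule power2_le_imp_le) (use Rpos[of j] in simp)
        qed
        have r0: "r > 0" using r Rpos[of j] by linarith
        have xr: "r \<le> 2 * norm x"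
        proof -
          have "r \<le> norm x + norm p" unfolding r_def by (rule norm_triangle_ineq4)
          then show ?thesis using r Rj by linarith
        qed
        let ?h = "\<bar>H 0 (s x)\<bar> + \<bar>2 * r * H 1 (s x)\<bar>"
        have a: "r ^ m * (norm (v x))\<^sup>2 \<le> 2 ^ m * e\<^sup>2"
        proof -
          have "r ^ m * (norm (v x))\<^sup>2 \<le> (2 * norm x) ^ m * (norm (v x))\<^sup>2"
            using xr r0 by (intro mult_right_mono power_mono) auto
          also have "\<dots> = 2 ^ m * (norm x ^ m * (norm (v x))\<^sup>2)" by (simp add: power_mult_distrib)
          also have "\<dots> \<le> 2 ^ m * e\<^sup>2" using vx xr r Rj by (intro mult_left_mono) auto
          finally show ?thesis .
        qed
        have h: "r ^ m * ?h\<^sup>2 \<le> 2 * C"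
        proof -
          have "?h\<^sup>2 \<le> 2 * ((H 0 (s x))\<^sup>2 + (2 * r * H 1 (s x))\<^sup>2)"
            by (rule sq)
          then have "r ^ m * ?h\<^sup>2 \<le> r ^ m * (2 * ((H 0 (s x))\<^sup>2 + (2 * r * H 1 (s x))\<^sup>2))"
            using r0 by (intro mult_left_mono) auto
          also have "\<dots> = 2 * (r ^ m * ((H 0 (s x))\<^sup>2 + (2 * r * H 1 (s x))\<^sup>2))"
            by (rule mult.left_commute)
          also have "\<dots> \<le> 2 * C"
            unfolding sr by (intro mult_left_mono decay) (use r Rj in auto)
          finally show ?thesis .
        qed
        \<comment> \<open>Each factor supplies half of the decay r^(-m): \<open>a\<close> with a
          small constant, \<open>h\<close> with a fixed one.\<close>
        have "(r ^ m * (norm (v x) * ?h))\<^sup>2 = (r ^ m * (norm (v x))\<^sup>2) * (r ^ m * ?h\<^sup>2)"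
          by (simp only: power_mult_distrib power2_eq_square) (simp only: mult_ac)
        also have "\<dots> \<le> (2 ^ m * e\<^sup>2) * (2 * C)"
          by (rule mult_mono[OF a h]) (use r0 in auto)
        also have "\<dots> = (e * sqrt (2 ^ Suc m * C))\<^sup>2"
          using C0 by (simp add: power_mult_distrib)
        finally have "r ^ m * (norm (v x) * ?h) \<le> e * sqrt (2 ^ Suc m * C)"
          by (rule power2_le_imp_le) (use e C0 in simp)
        moreover have "(R j) ^ m * (norm (v x) * ?h) \<le> r ^ m * (norm (v x) * ?h)"
          using r Rpos[of j] by (intro mult_right_mono power_mono) auto
        ultimately have vh: "norm (v x) * ?h \<le> e * sqrt (2 ^ Suc m * C) / (R j) ^ m"
          using Rpos[of j] by (simp add: pos_le_divide_eq mult.commute)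
        have "norm (v x * of_real (E j x)) = norm (v x) * \<bar>E j x\<bar>" by (simp add: norm_mult)
        also have "\<dots> \<le> norm (v x) * (A / R j * ?h)"
          using Ebound[of j x] True unfolding r_def by (intro mult_left_mono) auto
        also have "\<dots> = A / R j * (norm (v x) * ?h)" by simp
        also have "\<dots> \<le> A / R j * (e * sqrt (2 ^ Suc m * C) / (R j) ^ m)"
          using vh A0 Rpos[of j] by (intro mult_left_mono) auto
        also have "\<dots> = D" by (simp add: D_def nm)
        finally show ?thesis using r by (simp add: r_def dist_norm norm_minus_commute)
      qed
      have "norm ((LBINT x. v x * of_real (E j x))) \<le> (LBINT x. norm (v x * of_real (E j x)))"
        by (rule integral_norm_bound)
      also have "\<dots> \<le> (LBINT x. D * indicator (cball p (2 * R j)) x)"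
      proof (rule integral_mono_AE)
        show "integrable lborel (\<lambda>x. norm (v x * of_real (E j x)))" by (rule integrable_norm[OF intE])
        show "integrable lborel (\<lambda>x. D * indicator (cball p (2 * R j)) x)"
          using emeasure_lborel_cball_finite by (intro integrable_mult_right integrable_real_indicator) auto
        show "AE x in lborel. norm (v x * of_real (E j x)) \<le> D * indicator (cball p (2 * R j)) x"
          using R0 by (rule eventually_mono) (rule pt)
      qed
      also have "\<dots> = D * measure lborel (cball p (2 * R j))"
        by simp
      also have "measure lborel (cball p (2 * R j)) = (2 * R j) ^ ?n * measure lborel (cball (0::'a) 1)"
        using content_ball_conv_unit_ball[of "2 * R j" p] Rpos[of j] by (simp add: content_cball_conv_ball)
      also have "D * ((2 * R j) ^ ?n * measure lborel (cball (0::'a) 1)) = e * B"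
        using Rpos[of j] unfolding D_def B_def by (simp add: power_mult_distrib)
      finally show "norm ((LBINT x. v x * of_real (E j x))) \<le> e * B" .
    qed
  qed
  have limE: "(\<lambda>j. (LBINT x. v x * of_real (E j x))) \<longlonglongrightarrow> 0"
  proof (rule tendstoI)
    fix e :: real assume e: "e > 0"
    have "e / (B + 1) > 0" using e B0 by simp
    from small[OF this] show "\<forall>\<^sub>F j in sequentially. dist ((LBINT x. v x * of_real (E j x))) 0 < e"
    proof (rule eventually_mono)
      fix j assume "norm ((LBINT x. v x * of_real (E j x))) \<le> e / (B + 1) * B"
      also have "\<dots> < e" using e B0 by (simp add: pos_divide_less_eq distrib_left)
      finally show "dist ((LBINT x. v x * of_real (E j x))) 0 < e" by simp
    qed
  qed
  have zero: "(LBINT x. v x * of_real (E j x)) + (LBINT x. vg x * of_real (ct j x))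
      + (LBINT x. q x * of_real (\<phi> j x)) = 0" for j
  proof -
    have "(LBINT x. v x * of_real (E j x)) =
      (LBINT x. v x * of_real (laplacian (\<phi> j) x + k\<^sup>2 * \<phi> j x)) - (LBINT x. vg x * of_real (ct j x))"
      unfolding vE by (rule Bochner_Integration.integral_diff[OF intL int_ct])
    then show ?thesis using weak[OF test[of j]] by simp
  qed
  have "(\<lambda>j. 0) \<longlonglongrightarrow> 0 + integral\<^sup>L lborel vg + (LBINT x. q x * of_real (H 0 (s x)))"
    using tendsto_add[OF tendsto_add[OF limE limA] limB] unfolding zero .
  then have "0 = 0 + integral\<^sup>L lborel vg + (LBINT x. q x * of_real (H 0 (s x)))"
    by (rule LIMSEQ_unique[OF tendsto_const])
  then show ?thesis by (simp add: vg_def s_def)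
qed

section \<open>Mollification\<close>

lemma lborel_integral_affine:
  fixes f :: "'a::euclidean_space \<Rightarrow> 'b::{banach, second_countable_topology}"
  assumes "c \<noteq> 0" "f \<in> borel_measurable borel"
  shows "integral\<^sup>L lborel f = (LBINT x. \<bar>c\<bar> ^ DIM('a) *\<^sub>R f (t + c *\<^sub>R x))"
proof -
  have T: "(\<lambda>x. t + c *\<^sub>R x) \<in> lborel \<rightarrow>\<^sub>M borel" by simp
  have "integral\<^sup>L lborel f = integral\<^sup>L (density (distr lborel borel (\<lambda>x. t + c *\<^sub>R x)) (\<lambda>_. ennreal (\<bar>c\<bar> ^ DIM('a)))) f"
    using lborel_affine[OF assms(1), of t] by simp
  also have "\<dots> = integral\<^sup>L (distr lborel borel (\<lambda>x. t + c *\<^sub>R x)) (\<lambda>x. \<bar>c\<bar> ^ DIM('a) *\<^sub>R f x)"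
    by (rule integral_density) (use assms in auto)
  also have "\<dots> = (LBINT x. \<bar>c\<bar> ^ DIM('a) *\<^sub>R f (t + c *\<^sub>R x))"
    by (rule integral_distr[OF T]) (use assms in auto)
  finally show ?thesis .
qed

text \<open>Density of continuous functions in L^1, in a form that keeps the good part bounded:
  \<open>v\<close> is truncated on the ball, and the truncation is approximated by bounded
  continuous functions. Outside the ball \<open>v\<close> is already bounded almost everywhere and
  is kept.\<close>

lemma L1_approximation:
  fixes v :: "'a::euclidean_space \<Rightarrow> complex"
  assumes v: "locally_integrable v" and b: "AE x in lborel. norm x \<ge> R \<longrightarrow> norm (v x) \<le> 1" and e: "e > 0"
  obtains h q M where "h \<in> borel_measurable borel" "integrable lborel q"
    "(LBINT x. norm (q x)) \<le> e" "\<And>x. v x = h x + q x"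
    "\<And>x. norm (h x) \<le> M" "\<And>x. norm x < R \<Longrightarrow> isCont h x"
proof -
  define I where "I = (\<lambda>x. indicat_real (cball (0::'a) R) x)"
  have I[measurable]: "I \<in> borel_measurable borel"
    unfolding I_def by (intro borel_measurable_indicator) simp
  have I01: "I x = 0 \<or> I x = 1" for x by (simp add: I_def indicator_def)
  have vb[measurable]: "v \<in> borel_measurable borel" using v by (simp add: locally_integrable_def)
  have iv: "integrable lborel (\<lambda>x. I x *\<^sub>R v x)" using v by (simp add: locally_integrable_def I_def)
  have iI: "integrable lborel I"
    unfolding I_def using emeasure_lborel_cball_finite by (intro integrable_real_indicator) auto
  define tr where "tr = (\<lambda>j x. if norm (v x) \<le> real j then v x else 0)"
  have tr[measurable]: "tr j \<in> borel_measurable borel" for j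
    unfolding tr_def by measurable
  have "(\<lambda>j. (LBINT x. I x * norm (v x - tr j x))) \<longlonglongrightarrow> integral\<^sup>L lborel (\<lambda>x::'a. 0::real)"
  proof (rule integral_dominated_convergence[where w = "\<lambda>x. norm (I x *\<^sub>R v x)"])
    show "AE x in lborel. norm (I x * norm (v x - tr j x)) \<le> norm (I x *\<^sub>R v x)" for j
      by (intro AE_I2) (auto simp: tr_def abs_mult)
    have "(\<lambda>j. I x * norm (v x - tr j x)) \<longlonglongrightarrow> 0" for x
    proof (rule tendsto_eventually)
      obtain J :: nat where "norm (v x) \<le> real J" using real_arch_simple by blast
      then have "I x * norm (v x - tr j x) = 0" if "j \<ge> J" for j
        using that by (simp add: tr_def)
      then show "\<forall>\<^sub>F j in sequentially. I x * norm (v x - tr j x) = 0"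
        by (rule eventually_sequentiallyI)
    qed
    then show "AE x in lborel. (\<lambda>j. I x * norm (v x - tr j x)) \<longlonglongrightarrow> 0" by simp
    show "integrable lborel (\<lambda>x. norm (I x *\<^sub>R v x))" by (rule integrable_norm[OF iv])
  qed simp_all
  then have "(\<lambda>j. (LBINT x. I x * norm (v x - tr j x))) \<longlonglongrightarrow> 0" by simp
  then have "\<forall>\<^sub>F j in sequentially. (LBINT x. I x * norm (v x - tr j x)) < e / 2"
    using e by (intro order_tendstoD(2)) auto
  from eventually_happens'[OF sequentially_bot this]
  obtain j where j: "(LBINT x. I x * norm (v x - tr j x)) < e / 2"
    by blast
  let ?C = "cball (0::complex) (real j)"
  have "tr j \<in> borel_measurable lebesgue"
    using tr[of j] by (simp add: measurable_completion)
  then have "tr j measurable_on UNIV"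
    by (rule lebesgue_measurable_imp_measurable_on) simp
  then obtain Z g where Z: "negligible Z" and g: "\<And>i. continuous_on UNIV (g i)"
    "\<And>x. x \<notin> Z \<Longrightarrow> (\<lambda>i. g i x) \<longlonglongrightarrow> tr j x"
    unfolding measurable_on_def by auto
  \<comment> \<open>Projection onto the disc of radius j makes the approximants uniformly bounded,
    as dominated convergence needs, and leaves the limit unchanged.\<close>
  define f where "f = (\<lambda>i x. closest_point ?C (g i x))"
  have cc: "continuous_on UNIV (closest_point ?C)"
    by (rule continuous_on_closest_point) auto
  have cf: "continuous_on UNIV (f i)" for i
    unfolding f_def by (rule continuous_on_compose2[OF cc g(1)]) auto
  have f[measurable]: "f i \<in> borel_measurable borel" for i
    by (rule borel_measurable_continuous_onI[OF cf])
  have fb: "norm (f i x) \<le> real j" for i x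
    using closest_point_in_set[of ?C "g i x"] by (simp add: f_def)
  have trb: "norm (tr j x) \<le> real j" for x by (simp add: tr_def)
  have flim: "(\<lambda>i. f i x) \<longlonglongrightarrow> tr j x" if "x \<notin> Z" for x
  proof -
    have "(\<lambda>i. closest_point ?C (g i x)) \<longlonglongrightarrow> closest_point ?C (tr j x)"
      using continuous_on_tendsto_compose[OF cc g(2)[OF that]] by simp
    moreover have "closest_point ?C (tr j x) = tr j x"
      using trb by (intro closest_point_self) simp
    ultimately show ?thesis by (simp add: f_def)
  qed
  have AEZ: "AE x in lborel. x \<notin> Z"
  proof -
    have "Z \<in> null_sets lebesgue" using Z by (simp add: negligible_iff_null_sets)
    then have "AE x in lebesgue. x \<notin> Z" by (rule AE_not_in)
    then show ?thesis by (simp only: AE_completion_iff)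
  qed
  have "(\<lambda>i. (LBINT x. I x * norm (tr j x - f i x))) \<longlonglongrightarrow> integral\<^sup>L lborel (\<lambda>x::'a. 0::real)"
  proof (rule integral_dominated_convergence[where w = "\<lambda>x. 2 * real j * I x"])
    show "AE x in lborel. norm (I x * norm (tr j x - f i x)) \<le> 2 * real j * I x" for i
    proof (intro AE_I2)
      fix x :: 'a
      have "norm (tr j x - f i x) \<le> 2 * real j"
        using norm_triangle_ineq4[of "tr j x" "f i x"] trb[of x] fb[of i x] by linarith
      then show "norm (I x * norm (tr j x - f i x)) \<le> 2 * real j * I x"
        using I01[of x] by auto
    qed
    have "(\<lambda>i. I x * norm (tr j x - f i x)) \<longlonglongrightarrow> 0" if "x \<notin> Z" for x
      using tendsto_mult[OF tendsto_const tendsto_norm[OF tendsto_diff[OF tendsto_const flim[OF that]]], of "I x" "tr j x"]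
      by simp
    then show "AE x in lborel. (\<lambda>i. I x * norm (tr j x - f i x)) \<longlonglongrightarrow> 0"
      using AEZ by (auto elim: eventually_mono)
    show "integrable lborel (\<lambda>x. 2 * real j * I x)" by (rule integrable_mult_right[OF iI])
  qed simp_all
  then have "(\<lambda>i. (LBINT x. I x * norm (tr j x - f i x))) \<longlonglongrightarrow> 0" by simp
  then have "\<forall>\<^sub>F i in sequentially. (LBINT x. I x * norm (tr j x - f i x)) < e / 2"
    using e by (intro order_tendstoD(2)) auto
  from eventually_happens'[OF sequentially_bot this]
  obtain i where i: "(LBINT x. I x * norm (tr j x - f i x)) < e / 2"
    by blast
  \<comment> \<open>Outside the ball the value 0 on the null set where |v| > 1 makes the bound hold
    at every point.\<close>
  define h where "h = (\<lambda>x. if x \<in> cball 0 R then f i x else if norm (v x) \<le> 1 then v x else 0)"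
  define q where "q = (\<lambda>x. v x - h x)"
  have "(\<lambda>x. if norm (v x) \<le> 1 then v x else 0) \<in> borel_measurable borel" by measurable
  then have h: "h \<in> borel_measurable borel" unfolding h_def by (intro measurable_If_set f) auto
  have qb: "q \<in> borel_measurable borel" unfolding q_def using h by measurable
  have i1: "integrable lborel (\<lambda>x. I x * norm (v x - tr j x))"
  proof (rule Bochner_Integration.integrable_bound[OF iv])
    show "AE x in lborel. norm (I x * norm (v x - tr j x)) \<le> norm (I x *\<^sub>R v x)"
      by (intro AE_I2) (auto simp: tr_def abs_mult)
  qed simp
  have i2: "integrable lborel (\<lambda>x. I x * norm (tr j x - f i x))"
  proof (rule Bochner_Integration.integrable_bound[OF integrable_mult_right[OF iI, of "2 * real j"]])
    show "AE x in lborel. norm (I x * norm (tr j x - f i x)) \<le> norm (2 * real j * I x)"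
    proof (intro AE_I2)
      fix x :: 'a
      have "norm (tr j x - f i x) \<le> 2 * real j"
        using norm_triangle_ineq4[of "tr j x" "f i x"] trb[of x] fb[of i x] by linarith
      then show "norm (I x * norm (tr j x - f i x)) \<le> norm (2 * real j * I x)"
        using I01[of x] by auto
    qed
  qed simp
  have qle: "AE x in lborel. norm (q x) \<le> I x * norm (v x - tr j x) + I x * norm (tr j x - f i x)"
    using b
  proof (rule eventually_mono)
    fix x assume x: "norm x \<ge> R \<longrightarrow> norm (v x) \<le> 1"
    show "norm (q x) \<le> I x * norm (v x - tr j x) + I x * norm (tr j x - f i x)"
    proof (cases "x \<in> cball 0 R")
      case True
      then show ?thesis
        using norm_triangle_ineq[of "v x - tr j x" "tr j x - f i x"] by (simp add: q_def h_def I_def)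
    next
      case False
      then show ?thesis using x by (simp add: q_def h_def I_def)
    qed
  qed
  have q: "integrable lborel q"
    by (rule Bochner_Integration.integrable_bound[OF Bochner_Integration.integrable_add[OF i1 i2]])
       (use qb qle in \<open>auto elim: eventually_mono\<close>)
  have "(LBINT x. norm (q x)) \<le>
      (LBINT x. I x * norm (v x - tr j x) + I x * norm (tr j x - f i x))"
    by (rule integral_mono_AE[OF integrable_norm[OF q] Bochner_Integration.integrable_add[OF i1 i2] qle])
  also have "\<dots> = (LBINT x. I x * norm (v x - tr j x)) + (LBINT x. I x * norm (tr j x - f i x))"
    by (rule Bochner_Integration.integral_add[OF i1 i2])
  also have "\<dots> \<le> e" using i j by linarith
  finally have qe: "(LBINT x. norm (q x)) \<le> e" .
  have hb: "norm (h x) \<le> max (real j) 1" for x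
    using fb[of i x] by (auto simp: h_def)
  have hc: "isCont h x" if "norm x < R" for x
  proof -
    have "isCont (f i) x" using cf[of i] by (simp add: continuous_on_eq_continuous_at)
    moreover have "\<forall>\<^sub>F y in nhds x. h y = f i y"
    proof (rule eventually_nhds_in_open[of "ball 0 R" x, THEN eventually_mono])
      show "h y = f i y" if "y \<in> ball 0 R" for y using that by (simp add: h_def)
    qed (use that in auto)
    ultimately show ?thesis using isCont_cong by blast
  qed
  show thesis by (rule that[OF h q qe _ hb hc]) (simp add: q_def)
qed

abbreviation gauss_kernel :: "real \<Rightarrow> 'a::euclidean_space \<Rightarrow> 'a \<Rightarrow> real" where
  "gauss_kernel N p x \<equiv> N ^ DIM('a) * exp (- N\<^sup>2 * (norm (x - p))\<^sup>2)"

text \<open>The number pi^(n/2), carried as a symbol because the kernels stay unnormalised;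
  positivity allows dividing by it.\<close>

definition gauss_mass :: "'a::euclidean_space itself \<Rightarrow> real" where
  "gauss_mass _ = integral\<^sup>L lborel (\<lambda>x::'a. exp (- (norm x)\<^sup>2))"

lemma gauss_mass_pos: "gauss_mass TYPE('a::euclidean_space) > 0"
proof -
  have i: "integrable lborel (\<lambda>x::'a. exp (- (norm x)\<^sup>2))"
    using integrable_gaussian[of 1, where 'a='a] by simp
  have J: "integrable lborel (\<lambda>x. exp (- 1) * indicat_real (cball (0::'a) 1) x)"
    using emeasure_lborel_cball_finite by (intro integrable_mult_right integrable_real_indicator) auto
  have "0 < exp (- 1) * measure lborel (cball (0::'a) 1)"
    by (simp add: content_cball_conv_ball content_ball_pos)
  also have "\<dots> = (LBINT x. exp (- 1) * indicat_real (cball (0::'a) 1) x)"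
    by simp
  also have "\<dots> \<le> gauss_mass TYPE('a)"
    unfolding gauss_mass_def
    by (rule integral_mono[OF J i]) (auto simp: indicator_def power_le_one_iff)
  finally show ?thesis .
qed

text \<open>The substitution x = p + z/N moves N from the kernel into the argument of
  \<open>f\<close>, so that for bounded \<open>f\<close> a fixed Gaussian serves as dominating
  function for all N.\<close>

lemma gauss_kernel_rescale:
  fixes f :: "'a::euclidean_space \<Rightarrow> 'b::{banach, second_countable_topology}"
  assumes "N > 0" "f \<in> borel_measurable borel"
  shows "(LBINT x. gauss_kernel N p x *\<^sub>R f x)
    = (LBINT z. exp (- (norm z)\<^sup>2) *\<^sub>R f (p + (1 / N) *\<^sub>R z))"
proof -
  have m: "(\<lambda>x. gauss_kernel N p x *\<^sub>R f x) \<in> borel_measurable borel" using assms(2) by measurable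
  have "(LBINT x. gauss_kernel N p x *\<^sub>R f x) = (LBINT z. \<bar>1 / N\<bar> ^ DIM('a) *\<^sub>R
      (gauss_kernel N p (p + (1 / N) *\<^sub>R z) *\<^sub>R f (p + (1 / N) *\<^sub>R z)))"
    by (rule lborel_integral_affine[OF _ m]) (use assms in simp)
  moreover have *: "\<bar>1 / N\<bar> ^ DIM('a) *\<^sub>R (gauss_kernel N p (p + (1 / N) *\<^sub>R z) *\<^sub>R f (p + (1 / N) *\<^sub>R z))
      = exp (- (norm z)\<^sup>2) *\<^sub>R f (p + (1 / N) *\<^sub>R z)" for z
  proof -
    have "\<bar>1 / N\<bar> ^ DIM('a) * gauss_kernel N p (p + (1 / N) *\<^sub>R z) = exp (- (norm z)\<^sup>2)"
      using assms(1) by (simp add: power_divide power_mult_distrib)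
    then show ?thesis by (simp only: scaleR_scaleR)
  qed
  ultimately show ?thesis unfolding * by simp
qed

lemma gauss_kernel_integral:
  assumes "N > 0"
  shows "integral\<^sup>L lborel (gauss_kernel N (p::'a::euclidean_space)) = gauss_mass TYPE('a)"
    and "integrable lborel (gauss_kernel N p)"
  using gauss_kernel_rescale[OF assms, of "\<lambda>_. 1::real" p] integrable_gaussian_shift[of "N\<^sup>2" p] assms
  by (simp_all add: gauss_mass_def)

definition mollify :: "real \<Rightarrow> ('a::euclidean_space \<Rightarrow> complex) \<Rightarrow> 'a \<Rightarrow> complex" where
  "mollify N f p = (LBINT x. f x * of_real (gauss_kernel N p x))"

lemma borel_measurable_mollify:
  fixes f :: "'a::euclidean_space \<Rightarrow> complex"
  assumes f[measurable]: "f \<in> borel_measurable borel"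
  shows "mollify N f \<in> borel_measurable borel"
proof -
  have "(\<lambda>(p, x). f x * of_real (gauss_kernel N p x)) \<in> borel_measurable (borel \<Otimes>\<^sub>M lborel)"
    by measurable
  then have "(\<lambda>p. (LBINT x. f x * of_real (gauss_kernel N p x))) \<in> borel_measurable borel"
    by (rule lborel.borel_measurable_lebesgue_integral)
  then show ?thesis unfolding mollify_def[abs_def] .
qed

lemma norm_mult_gauss_kernel:
  fixes z :: complex
  assumes "N > 0"
  shows "norm (z * of_real (gauss_kernel N p x)) = norm z * gauss_kernel N p x"
  unfolding norm_mult norm_of_real using assms by (simp add: abs_mult)

lemma nn_integral_gauss_kernel:
  assumes "N > 0"
  shows "(\<integral>\<^sup>+ p. ennreal (gauss_kernel N p (x::'a::euclidean_space)) \<partial>lborel) = ennreal (gauss_mass TYPE('a))"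
proof -
  have "(\<integral>\<^sup>+ p. ennreal (gauss_kernel N p x) \<partial>lborel) = (\<integral>\<^sup>+ p. ennreal (gauss_kernel N x p) \<partial>lborel)"
    by (simp only: norm_minus_commute)
  also have "\<dots> = ennreal (integral\<^sup>L lborel (gauss_kernel N x))"
    using gauss_kernel_integral(2)[OF assms, of x] assms by (intro nn_integral_eq_integral) auto
  finally show ?thesis unfolding gauss_kernel_integral(1)[OF assms] .
qed

text \<open>Young's inequality for convolutions: after Tonelli, the symmetric kernel integrates over
  \<open>p\<close> to the same mass as over \<open>x\<close>.\<close>

lemma mollify_L1_le:
  fixes q :: "'a::euclidean_space \<Rightarrow> complex"
  assumes N: "N > 0" and q: "integrable lborel q"
  shows "(\<integral>\<^sup>+ p. ennreal (norm (mollify N q p)) \<partial>lborel)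
     \<le> ennreal (gauss_mass TYPE('a) * (LBINT x. norm (q x)))"
proof -
  have [measurable]: "q \<in> borel_measurable borel" using borel_measurable_integrable[OF q] by simp
  have pt: "ennreal (norm (mollify N q p)) \<le> (\<integral>\<^sup>+ x. ennreal (norm (q x)) * ennreal (gauss_kernel N p x) \<partial>lborel)" for p
  proof -
    have eq: "norm (q x * of_real (gauss_kernel N p x)) = norm (q x) * gauss_kernel N p x" for x
      by (rule norm_mult_gauss_kernel[OF N])
    have i: "integrable lborel (\<lambda>x. q x * of_real (gauss_kernel N p x))"
    proof (rule Bochner_Integration.integrable_bound[OF integrable_scaleR_right[OF q, of "N ^ DIM('a)"]])
      have "exp (- N\<^sup>2 * (norm (x - p))\<^sup>2) \<le> 1" for x by simp
      then have "norm (q x) * gauss_kernel N p x \<le> norm (q x) * (N ^ DIM('a) * 1)" for x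
        using N by (intro mult_left_mono) auto
      then show "AE x in lborel. norm (q x * of_real (gauss_kernel N p x)) \<le> norm (N ^ DIM('a) *\<^sub>R q x)"
        unfolding eq using N by (simp add: mult.commute)
      show "(\<lambda>x. q x * of_real (gauss_kernel N p x)) \<in> borel_measurable lborel" by measurable
    qed
    have "ennreal (norm (mollify N q p)) \<le> (\<integral>\<^sup>+ x. ennreal (norm (q x * of_real (gauss_kernel N p x))) \<partial>lborel)"
      unfolding mollify_def by (rule integral_norm_bound_ennreal[OF i])
    then show ?thesis unfolding eq using N by (simp add: ennreal_mult')
  qed
  have "(\<integral>\<^sup>+ p. ennreal (norm (mollify N q p)) \<partial>lborel)
      \<le> (\<integral>\<^sup>+ p. (\<integral>\<^sup>+ x. ennreal (norm (q x)) * ennreal (gauss_kernel N p x) \<partial>lborel) \<partial>lborel)"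
    by (rule nn_integral_mono) (rule pt)
  also have "\<dots> = (\<integral>\<^sup>+ x. (\<integral>\<^sup>+ p. ennreal (norm (q x)) * ennreal (gauss_kernel N p x) \<partial>lborel) \<partial>lborel)"
    by (rule lborel_pair.Fubini'[symmetric]) measurable
  also have "\<dots> = (\<integral>\<^sup>+ x. ennreal (norm (q x)) * ennreal (gauss_mass TYPE('a)) \<partial>lborel)"
  proof (rule nn_integral_cong)
    fix x :: 'a
    have "(\<lambda>p. ennreal (gauss_kernel N p x)) \<in> borel_measurable lborel" by measurable
    from nn_integral_cmult[OF this]
    show "(\<integral>\<^sup>+ p. ennreal (norm (q x)) * ennreal (gauss_kernel N p x) \<partial>lborel) = ennreal (norm (q x)) * ennreal (gauss_mass TYPE('a))"
      unfolding nn_integral_gauss_kernel[OF N] .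
  qed
  also have "\<dots> = (\<integral>\<^sup>+ x. ennreal (norm (q x)) \<partial>lborel) * ennreal (gauss_mass TYPE('a))"
    by (rule nn_integral_multc) measurable
  also have "(\<integral>\<^sup>+ x. ennreal (norm (q x)) \<partial>lborel) = ennreal ((LBINT x. norm (q x)))"
    by (rule nn_integral_eq_integral[OF integrable_norm[OF q]]) simp
  also have "ennreal ((LBINT x. norm (q x))) * ennreal (gauss_mass TYPE('a))
      = ennreal (gauss_mass TYPE('a) * (LBINT x. norm (q x)))"
    using gauss_mass_pos[where 'a='a] by (simp add: ennreal_mult' mult.commute)
  finally show ?thesis .
qed

text \<open>In rescaled form the integrand converges pointwise by continuity at \<open>p\<close>,
  dominated by M times a fixed Gaussian.\<close>

lemma mollify_tendsto:
  fixes h :: "'a::euclidean_space \<Rightarrow> complex"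
  assumes h[measurable]: "h \<in> borel_measurable borel" and b: "\<And>x. norm (h x) \<le> M" and c: "isCont h p"
  shows "(\<lambda>j. mollify (real (Suc j)) h p) \<longlonglongrightarrow> gauss_mass TYPE('a) *\<^sub>R h p"
    and "N > 0 \<Longrightarrow> norm (mollify N h p) \<le> gauss_mass TYPE('a) * M"
proof -
  have ig: "integrable lborel (\<lambda>x::'a. exp (- (norm x)\<^sup>2))"
    using integrable_gaussian[of 1, where 'a='a] by simp
  have eq: "mollify N h p = (LBINT z. exp (- (norm z)\<^sup>2) *\<^sub>R h (p + (1 / N) *\<^sub>R z))" if "N > 0" for N
    using gauss_kernel_rescale[OF that h, of p] by (simp add: mollify_def scaleR_conv_of_real mult.commute)
  have le: "norm (exp (- (norm z)\<^sup>2) *\<^sub>R h (p + (1 / N) *\<^sub>R z)) \<le> M * exp (- (norm z)\<^sup>2)" for N and z :: 'a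
    using mult_left_mono[OF b[of "p + (1 / N) *\<^sub>R z"], of "exp (- (norm z)\<^sup>2)"] by (simp add: mult.commute)
  have iM: "integrable lborel (\<lambda>z::'a. M * exp (- (norm z)\<^sup>2))" by (rule integrable_mult_right[OF ig])
  have "(\<lambda>j. (LBINT z. exp (- (norm z)\<^sup>2) *\<^sub>R h (p + (1 / real (Suc j)) *\<^sub>R z)))
      \<longlonglongrightarrow> integral\<^sup>L lborel (\<lambda>z::'a. exp (- (norm z)\<^sup>2) *\<^sub>R h p)"
  proof (rule integral_dominated_convergence[OF _ _ iM])
    have "(\<lambda>j. exp (- (norm z)\<^sup>2) *\<^sub>R h (p + (1 / real (Suc j)) *\<^sub>R z)) \<longlonglongrightarrow> exp (- (norm z)\<^sup>2) *\<^sub>R h p" for z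
    proof -
      have "(\<lambda>j. 1 / real (Suc j)) \<longlonglongrightarrow> 0"
        using LIMSEQ_inverse_real_of_nat by (simp add: inverse_eq_divide del: of_nat_Suc)
      then have "(\<lambda>j. p + (1 / real (Suc j)) *\<^sub>R z) \<longlonglongrightarrow> p + 0 *\<^sub>R z"
        by (intro tendsto_add tendsto_const tendsto_scaleR)
      then have "(\<lambda>j. p + (1 / real (Suc j)) *\<^sub>R z) \<longlonglongrightarrow> p" by simp
      from isCont_tendsto_compose[OF c this] show ?thesis
        by (rule tendsto_scaleR[OF tendsto_const])
    qed
    then show "AE z in lborel. (\<lambda>j. exp (- (norm z)\<^sup>2) *\<^sub>R h (p + (1 / real (Suc j)) *\<^sub>R z)) \<longlonglongrightarrow> exp (- (norm z)\<^sup>2) *\<^sub>R h p"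
      by simp
    show "AE z in lborel. norm (exp (- (norm z)\<^sup>2) *\<^sub>R h (p + (1 / real (Suc j)) *\<^sub>R z)) \<le> M * exp (- (norm z)\<^sup>2)" for j
      by (rule AE_I2) (rule le)
    show "(\<lambda>z. exp (- (norm z)\<^sup>2) *\<^sub>R h (p + (1 / real (Suc j)) *\<^sub>R z)) \<in> borel_measurable lborel" for j
      by measurable
    show "(\<lambda>z::'a. exp (- (norm z)\<^sup>2) *\<^sub>R h p) \<in> borel_measurable lborel" by measurable
  qed
  then show "(\<lambda>j. mollify (real (Suc j)) h p) \<longlonglongrightarrow> gauss_mass TYPE('a) *\<^sub>R h p"
    using ig by (simp add: eq gauss_mass_def del: of_nat_Suc)
  assume N: "N > 0"
  have "norm (mollify N h p) \<le> integral\<^sup>L lborel (\<lambda>z::'a. M * exp (- (norm z)\<^sup>2))"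
    unfolding eq[OF N]
  proof (rule Bochner_Integration.integral_norm_bound_integral)
    show "integrable lborel (\<lambda>z. exp (- (norm z)\<^sup>2) *\<^sub>R h (p + (1 / N) *\<^sub>R z))"
    proof (rule Bochner_Integration.integrable_bound[OF iM])
      show "AE z in lborel. norm (exp (- (norm z)\<^sup>2) *\<^sub>R h (p + (1 / N) *\<^sub>R z)) \<le> norm (M * exp (- (norm z)\<^sup>2))"
        by (rule AE_I2) (rule order_trans[OF le], simp)
      show "(\<lambda>z. exp (- (norm z)\<^sup>2) *\<^sub>R h (p + (1 / N) *\<^sub>R z)) \<in> borel_measurable lborel"
        by measurable
    qed
  qed (use iM le in auto)
  then show "norm (mollify N h p) \<le> gauss_mass TYPE('a) * M"
    by (simp add: gauss_mass_def mult.commute)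
qed

text \<open>Since \<open>v\<close> need not be continuous, it is compared with its mollifications
  through a splitting v = h + q: for the bounded part \<open>h\<close> they converge at every point
  of \<Omega>, for \<open>q\<close> they are small in L^1 uniformly in N.\<close>

lemma L1_bound_from_mollify:
  fixes v :: "'a::euclidean_space \<Rightarrow> complex"
  assumes v: "locally_integrable v" "vanishes_at_infinity v"
    and \<Omega>: "\<Omega> \<in> sets borel" "bounded \<Omega>" and L: "L \<ge> 0"
    and bound: "\<And>N. N \<ge> 1 \<Longrightarrow> (\<integral>\<^sup>+ p. ennreal (norm (mollify N v p)) * indicator \<Omega> p \<partial>lborel) \<le> ennreal L"
  shows "ennreal (gauss_mass TYPE('a)) * (\<integral>\<^sup>+ p. ennreal (norm (v p)) * indicator \<Omega> p \<partial>lborel) \<le> ennreal L"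
proof (rule ennreal_le_epsilon)
  fix e :: real assume "e > 0"
  let ?\<gamma> = "gauss_mass TYPE('a)"
  have \<gamma>: "?\<gamma> > 0" by (rule gauss_mass_pos)
  \<comment> \<open>The mollification of \<open>q\<close> and the multiple \<gamma> q contribute
    \<gamma> e' each, together \<open>e\<close>.\<close>
  define e' where "e' = e / (2 * ?\<gamma>)"
  have e': "e' > 0" using \<open>e > 0\<close> \<gamma> by (simp add: e'_def)
  obtain R1 where R1: "AE x in lborel. norm x \<ge> R1 \<longrightarrow> norm (v x) \<le> 1"
    using vanishes_at_infinity_bounded[OF v(2)] by blast
  obtain R2 where R2: "\<And>x. x \<in> \<Omega> \<Longrightarrow> norm x \<le> R2" using \<Omega>(2) unfolding bounded_iff by auto
  \<comment> \<open>The extra 1 puts \<Omega> strictly inside the ball, where \<open>h\<close> is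
    continuous.\<close>
  define R where "R = max R1 (R2 + 1)"
  have AR: "AE x in lborel. norm x \<ge> R \<longrightarrow> norm (v x) \<le> 1"
    using R1 by (rule eventually_mono) (simp add: R_def)
  have \<Omega>R: "norm x < R" if "x \<in> \<Omega>" for x using R2[OF that] by (simp add: R_def)
  obtain h q M where h: "h \<in> borel_measurable borel" and q: "integrable lborel q"
    "(LBINT x. norm (q x)) \<le> e'" and split: "\<And>x. v x = h x + q x"
    and hM: "\<And>x. norm (h x) \<le> M" and hc: "\<And>x. norm x < R \<Longrightarrow> isCont h x"
    by (rule L1_approximation[OF v(1) AR e']) (rule that; simp)
  have [measurable]: "v \<in> borel_measurable borel" "q \<in> borel_measurable borel" "\<Omega> \<in> sets borel" "h \<in> borel_measurable borel"
    using v(1) borel_measurable_integrable[OF q(1)] \<Omega> h by (auto simp: locally_integrable_def)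
  have mm[measurable]: "mollify N v \<in> borel_measurable borel" "mollify N q \<in> borel_measurable borel"
    "mollify N h \<in> borel_measurable borel" for N
    by (rule borel_measurable_mollify, measurable)+
  have iv: "integrable lborel (\<lambda>x. v x * of_real (gauss_kernel N p x))" if "N > 0" for N p
    using integrable_mult_gaussian[OF v, of "N\<^sup>2" "N ^ DIM('a)" p] that by simp
  have ih: "integrable lborel (\<lambda>x. h x * of_real (gauss_kernel N p x))" if "N > 0" for N p
  proof (rule Bochner_Integration.integrable_bound[OF integrable_mult_right[OF gauss_kernel_integral(2)[OF that], of M p]])
    have "norm (h x) * gauss_kernel N p x \<le> M * gauss_kernel N p x" for x
      using hM that by (intro mult_right_mono) auto
    then have "norm (h x * of_real (gauss_kernel N p x)) \<le> norm (M * gauss_kernel N p x)" for x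
      unfolding norm_mult_gauss_kernel[OF that] real_norm_def by (rule order_trans[OF _ abs_ge_self])
    then show "AE x in lborel. norm (h x * of_real (gauss_kernel N p x)) \<le> norm (M * gauss_kernel N p x)" by simp
    show "(\<lambda>x. h x * of_real (gauss_kernel N p x)) \<in> borel_measurable lborel" by measurable
  qed
  have mq: "mollify N q p = mollify N v p - mollify N h p" if "N > 0" for N p
  proof -
    have "q x * of_real (gauss_kernel N p x) = v x * of_real (gauss_kernel N p x) - h x * of_real (gauss_kernel N p x)" for x
      by (simp add: split distrib_right)
    then show ?thesis unfolding mollify_def
      by (simp only: Bochner_Integration.integral_diff[OF iv[OF that] ih[OF that]])
  qed
  define A where "A = (\<lambda>j. \<integral>\<^sup>+ p. ennreal (norm (?\<gamma> *\<^sub>R h p - mollify (real (Suc j)) h p)) * indicator \<Omega> p \<partial>lborel)"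
  have "A \<longlonglongrightarrow> (\<integral>\<^sup>+ p. 0 \<partial>(lborel :: 'a measure))"
    unfolding A_def
  proof (rule nn_integral_dominated_convergence[where w = "\<lambda>p. ennreal (2 * (?\<gamma> * M)) * indicator \<Omega> p"])
    show "AE p in lborel. ennreal (norm (?\<gamma> *\<^sub>R h p - mollify (real (Suc j)) h p)) * indicator \<Omega> p
        \<le> ennreal (2 * (?\<gamma> * M)) * indicator \<Omega> p" for j
    proof (rule AE_I2)
      fix p :: 'a
      show "ennreal (norm (?\<gamma> *\<^sub>R h p - mollify (real (Suc j)) h p)) * indicator \<Omega> p
        \<le> ennreal (2 * (?\<gamma> * M)) * indicator \<Omega> p"
      proof (cases "p \<in> \<Omega>")
        case True
        have "norm (mollify (real (Suc j)) h p) \<le> ?\<gamma> * M"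
          by (rule mollify_tendsto(2)[OF h hM hc[OF \<Omega>R[OF True]]]) simp
        moreover have "norm (?\<gamma> *\<^sub>R h p) \<le> ?\<gamma> * M" using hM \<gamma> by simp
        ultimately have "norm (?\<gamma> *\<^sub>R h p - mollify (real (Suc j)) h p) \<le> 2 * (?\<gamma> * M)"
          using norm_triangle_ineq4[of "?\<gamma> *\<^sub>R h p" "mollify (real (Suc j)) h p"] by linarith
        then show ?thesis by (intro mult_right_mono ennreal_leI) auto
      qed simp
    qed
    show "AE p in lborel. (\<lambda>j. ennreal (norm (?\<gamma> *\<^sub>R h p - mollify (real (Suc j)) h p)) * indicator \<Omega> p) \<longlonglongrightarrow> 0"
    proof (rule AE_I2)
      fix p :: 'a
      show "(\<lambda>j. ennreal (norm (?\<gamma> *\<^sub>R h p - mollify (real (Suc j)) h p)) * indicator \<Omega> p) \<longlonglongrightarrow> 0"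
      proof (cases "p \<in> \<Omega>")
        case True
        have "(\<lambda>j. norm (?\<gamma> *\<^sub>R h p - mollify (real (Suc j)) h p)) \<longlonglongrightarrow> norm (?\<gamma> *\<^sub>R h p - ?\<gamma> *\<^sub>R h p)"
          by (intro tendsto_norm tendsto_diff tendsto_const mollify_tendsto(1)[OF h hM hc[OF \<Omega>R[OF True]]])
        then have "(\<lambda>j. ennreal (norm (?\<gamma> *\<^sub>R h p - mollify (real (Suc j)) h p))) \<longlonglongrightarrow> ennreal 0"
          by (intro tendsto_ennrealI) simp
        then show ?thesis using True by simp
      qed simp
    qed
    have "emeasure lborel \<Omega> < \<infinity>" by (rule emeasure_bounded_finite[OF \<Omega>(2)])
    then show "(\<integral>\<^sup>+ p. ennreal (2 * (?\<gamma> * M)) * indicator \<Omega> p \<partial>lborel) < \<infinity>"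
      by (simp add: nn_integral_cmult_indicator ennreal_mult_less_top)
  qed measurable
  then have A0: "A \<longlonglongrightarrow> 0" by simp
  have tri: "norm (a + (b + (- c + d))) \<le> norm a + (norm b + (norm c + norm d))" for a b c d :: complex
    using norm_triangle_ineq[of a "b + (- c + d)"] norm_triangle_ineq[of b "- c + d"]
      norm_triangle_ineq[of "- c" d] norm_minus_cancel[of c] by linarith
  have main: "ennreal ?\<gamma> * (\<integral>\<^sup>+ p. ennreal (norm (v p)) * indicator \<Omega> p \<partial>lborel)
      \<le> A j + (ennreal L + ennreal e)" for j
  proof -
    let ?N = "real (Suc j)"
    have N: "?N > 0" "?N \<ge> 1" by auto
    have pt: "ennreal ?\<gamma> * (ennreal (norm (v p)) * indicator \<Omega> p) \<le>
        ennreal (norm (?\<gamma> *\<^sub>R h p - mollify ?N h p)) * indicator \<Omega> p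
        + (ennreal (norm (mollify ?N v p)) * indicator \<Omega> p
        + (ennreal (norm (mollify ?N q p)) + ennreal ?\<gamma> * ennreal (norm (q p))))" for p
    proof (cases "p \<in> \<Omega>")
      case True
      have "?\<gamma> *\<^sub>R v p = (?\<gamma> *\<^sub>R h p - mollify ?N h p) + (mollify ?N v p + (- mollify ?N q p + ?\<gamma> *\<^sub>R q p))"
        unfolding mq[OF N(1)] split[of p] by (simp add: scaleR_add_right)
      then have "norm (?\<gamma> *\<^sub>R v p) \<le> norm (?\<gamma> *\<^sub>R h p - mollify ?N h p) + (norm (mollify ?N v p) + (norm (mollify ?N q p) + norm (?\<gamma> *\<^sub>R q p)))"
        by (simp only: tri)
      then have "?\<gamma> * norm (v p) \<le> norm (?\<gamma> *\<^sub>R h p - mollify ?N h p) + (norm (mollify ?N v p) + (norm (mollify ?N q p) + ?\<gamma> * norm (q p)))"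
        using \<gamma> by simp
      then have "ennreal (?\<gamma> * norm (v p)) \<le> ennreal (norm (?\<gamma> *\<^sub>R h p - mollify ?N h p) + (norm (mollify ?N v p) + (norm (mollify ?N q p) + ?\<gamma> * norm (q p))))"
        by (rule ennreal_leI)
      then show ?thesis using True \<gamma> by (simp add: ennreal_mult' ennreal_plus)
    qed simp
    have "ennreal ?\<gamma> * (\<integral>\<^sup>+ p. ennreal (norm (v p)) * indicator \<Omega> p \<partial>lborel)
      = (\<integral>\<^sup>+ p. ennreal ?\<gamma> * (ennreal (norm (v p)) * indicator \<Omega> p) \<partial>lborel)"
      by (rule nn_integral_cmult[symmetric]) measurable
    also have "\<dots> \<le> (\<integral>\<^sup>+ p. ennreal (norm (?\<gamma> *\<^sub>R h p - mollify ?N h p)) * indicator \<Omega> p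
        + (ennreal (norm (mollify ?N v p)) * indicator \<Omega> p
        + (ennreal (norm (mollify ?N q p)) + ennreal ?\<gamma> * ennreal (norm (q p)))) \<partial>lborel)"
      by (rule nn_integral_mono) (rule pt)
    also have "\<dots> = A j + ((\<integral>\<^sup>+ p. ennreal (norm (mollify ?N v p)) * indicator \<Omega> p \<partial>lborel)
        + ((\<integral>\<^sup>+ p. ennreal (norm (mollify ?N q p)) \<partial>lborel) + (\<integral>\<^sup>+ p. ennreal ?\<gamma> * ennreal (norm (q p)) \<partial>lborel)))"
    proof -
      have 3: "(\<integral>\<^sup>+ p. ennreal (norm (mollify ?N q p)) + ennreal ?\<gamma> * ennreal (norm (q p)) \<partial>lborel)
          = (\<integral>\<^sup>+ p. ennreal (norm (mollify ?N q p)) \<partial>lborel) + (\<integral>\<^sup>+ p. ennreal ?\<gamma> * ennreal (norm (q p)) \<partial>lborel)"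
        by (rule nn_integral_add) measurable
      have 2: "(\<integral>\<^sup>+ p. ennreal (norm (mollify ?N v p)) * indicator \<Omega> p
          + (ennreal (norm (mollify ?N q p)) + ennreal ?\<gamma> * ennreal (norm (q p))) \<partial>lborel)
          = (\<integral>\<^sup>+ p. ennreal (norm (mollify ?N v p)) * indicator \<Omega> p \<partial>lborel)
          + (\<integral>\<^sup>+ p. ennreal (norm (mollify ?N q p)) + ennreal ?\<gamma> * ennreal (norm (q p)) \<partial>lborel)"
        by (rule nn_integral_add) measurable
      show ?thesis
        unfolding A_def 3[symmetric] 2[symmetric] by (rule nn_integral_add) measurable
    qed
    also have "\<dots> \<le> A j + (ennreal L + (ennreal (?\<gamma> * e') + ennreal (?\<gamma> * e')))"
    proof (intro add_left_mono add_mono)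
      show "(\<integral>\<^sup>+ p. ennreal (norm (mollify ?N v p)) * indicator \<Omega> p \<partial>lborel) \<le> ennreal L"
        by (rule bound[OF N(2)])
      have "ennreal (?\<gamma> * (LBINT x. norm (q x))) \<le> ennreal (?\<gamma> * e')"
        using q(2) \<gamma> by (intro ennreal_leI mult_left_mono) auto
      then show "(\<integral>\<^sup>+ p. ennreal (norm (mollify ?N q p)) \<partial>lborel) \<le> ennreal (?\<gamma> * e')"
        using mollify_L1_le[OF N(1) q(1)] by (rule order_trans[rotated])
      have "(\<integral>\<^sup>+ p. ennreal ?\<gamma> * ennreal (norm (q p)) \<partial>lborel) = ennreal ?\<gamma> * (\<integral>\<^sup>+ p. ennreal (norm (q p)) \<partial>lborel)"
        by (rule nn_integral_cmult) measurable
      also have "(\<integral>\<^sup>+ p. ennreal (norm (q p)) \<partial>lborel) = ennreal ((LBINT x. norm (q x)))"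
        by (rule nn_integral_eq_integral[OF integrable_norm[OF q(1)]]) simp
      also have "ennreal ?\<gamma> * ennreal ((LBINT x. norm (q x))) = ennreal (?\<gamma> * (LBINT x. norm (q x)))"
        using \<gamma> by (simp add: ennreal_mult')
      also have "\<dots> \<le> ennreal (?\<gamma> * e')"
        using q(2) \<gamma> by (intro ennreal_leI mult_left_mono) auto
      finally show "(\<integral>\<^sup>+ p. ennreal ?\<gamma> * ennreal (norm (q p)) \<partial>lborel) \<le> ennreal (?\<gamma> * e')" .
    qed
    also have "ennreal (?\<gamma> * e') + ennreal (?\<gamma> * e') = ennreal e"
    proof -
      have "?\<gamma> * e' + ?\<gamma> * e' = e" using \<gamma> by (simp add: e'_def)
      moreover have "?\<gamma> * e' \<ge> 0" using \<gamma> e' by simp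
      ultimately show ?thesis by (metis ennreal_plus)
    qed
    finally show ?thesis .
  qed
  have "(\<lambda>j. A j + (ennreal L + ennreal e)) \<longlonglongrightarrow> 0 + (ennreal L + ennreal e)"
    by (intro tendsto_add tendsto_const A0)
  then have "(\<lambda>j. A j + (ennreal L + ennreal e)) \<longlonglongrightarrow> ennreal L + ennreal e" by simp
  then show "ennreal ?\<gamma> * (\<integral>\<^sup>+ p. ennreal (norm (v p)) * indicator \<Omega> p \<partial>lborel) \<le> ennreal L + ennreal e"
    by (rule LIMSEQ_le_const) (use main in auto)
qed

section \<open>Scattered fields with vanishing far field\<close>

text \<open>Tonelli and substitution are applied over \<open>lborel\<close>, whereas fields are
  given as Lebesgue measurable functions; a change on a null set mediates.\<close>

lemma lebesgue_measurable_borel_version: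
  fixes u :: "'a::euclidean_space \<Rightarrow> complex"
  assumes "u \<in> borel_measurable lebesgue"
  obtains v where "v \<in> borel_measurable borel" "AE x in lborel. u x = v x"
proof -
  have "(\<lambda>x. Re (u x)) \<in> borel_measurable lebesgue" "(\<lambda>x. Im (u x)) \<in> borel_measurable lebesgue"
    using assms by measurable
  from this[THEN completion_ex_borel_measurable_real] obtain a b where ab: "a \<in> borel_measurable lborel" "AE x in lborel. Re (u x) = a x"
    "b \<in> borel_measurable lborel" "AE x in lborel. Im (u x) = b x"
    by blast
  have "(\<lambda>x. Complex (a x) (b x)) \<in> borel_measurable borel"
    using ab unfolding Complex_eq by simp
  moreover have "AE x in lborel. u x = Complex (a x) (b x)"
    using ab(2,4) by eventually_elim (simp add: complex_eq_iff)
  ultimately show thesis by (rule that)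
qed

lemma locally_integrable_L2loc:
  fixes u v :: "'a::euclidean_space \<Rightarrow> complex"
  assumes u: "L2loc u" and v: "v \<in> borel_measurable borel" "AE x in lborel. u x = v x"
  shows "locally_integrable v"
  unfolding locally_integrable_def
proof (intro conjI allI)
  fix R :: real
  let ?I = "indicat_real (cball (0::'a) R)"
  have um: "u \<in> borel_measurable lebesgue" using u by (simp add: L2loc_def)
  have "integrable lebesgue (\<lambda>x. ?I x *\<^sub>R (norm (u x))\<^sup>2)"
    using u by (simp add: L2loc_def set_integrable_def)
  moreover have "AE x in lebesgue. ?I x *\<^sub>R (norm (u x))\<^sup>2 = ?I x *\<^sub>R (norm (v x))\<^sup>2"
    unfolding AE_completion_iff using v(2) by eventually_elim simp
  moreover have vm: "(\<lambda>x. ?I x *\<^sub>R (norm (v x))\<^sup>2) \<in> borel_measurable lborel"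
    using v(1) by (intro borel_measurable_scaleR borel_measurable_indicator) auto
  ultimately have "integrable lebesgue (\<lambda>x. ?I x *\<^sub>R (norm (v x))\<^sup>2)"
    by (subst integrable_cong_AE[symmetric]) (auto intro: measurable_completion dest: borel_measurable_integrable)
  then have i: "integrable lborel (\<lambda>x. ?I x *\<^sub>R (norm (v x))\<^sup>2)"
    using integrable_completion[OF vm] by simp
  have iI: "integrable lborel ?I"
    using emeasure_lborel_cball_finite by (intro integrable_real_indicator) auto
  show "integrable lborel (\<lambda>x. ?I x *\<^sub>R v x)"
  proof (rule Bochner_Integration.integrable_bound[OF Bochner_Integration.integrable_add[OF iI i]])
    show "(\<lambda>x. ?I x *\<^sub>R v x) \<in> borel_measurable lborel"
      using v(1) by (intro borel_measurable_scaleR borel_measurable_indicator) auto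
    have "t \<le> 1 + t\<^sup>2" for t :: real
      using zero_le_power2[of "t - 1"] zero_le_power2[of t] unfolding power2_diff one_power2 by linarith
    then have "norm (?I x *\<^sub>R v x) \<le> norm (?I x + ?I x *\<^sub>R (norm (v x))\<^sup>2)" for x
      by (simp add: indicator_def abs_of_nonneg add_nonneg_nonneg)
    then show "AE x in lborel. norm (?I x *\<^sub>R v x) \<le> norm (?I x + ?I x *\<^sub>R (norm (v x))\<^sup>2)" by simp
  qed
qed (use v in simp)

text \<open>As \<open>F\<close> vanishes on the unit sphere, \<open>F (sgn x)\<close> is 0 for
  nonzero x, and the far-field expansion reduces to its remainder. Squaring the weight |x|^((n-1)/2)
  gives the integer power.\<close>

lemma far_field_zero_vanishes:
  fixes u v :: "'a::euclidean_space \<Rightarrow> complex"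
  assumes F: "far_field k u F" "\<And>\<omega>. norm \<omega> = 1 \<Longrightarrow> F \<omega> = 0" and v: "AE x in lborel. u x = v x"
    and n: "DIM('a) \<ge> 2"
  shows "vanishes_at_infinity v"
  unfolding vanishes_at_infinity_def
proof (intro allI impI)
  fix e :: real assume e: "e > 0"
  let ?P = "\<lambda>x::'a. norm x powr ((real DIM('a) - 1) / 2)"
  have "\<forall>\<^sub>F x in at_infinity. norm (of_real (?P x) *
        (u x - exp (\<i> * of_real (k * norm x)) / of_real (?P x) * F (sgn x))) < sqrt e"
    using tendstoD[OF F(1)[unfolded far_field_def], of "sqrt e"] e by simp
  then obtain R0 where R0: "\<And>x. norm x \<ge> R0 \<Longrightarrow> norm (of_real (?P x) *
        (u x - exp (\<i> * of_real (k * norm x)) / of_real (?P x) * F (sgn x))) < sqrt e"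
    unfolding eventually_at_infinity by blast
  have "norm x ^ (DIM('a) - 1) * (norm (u x))\<^sup>2 \<le> e" if x: "norm x \<ge> max R0 1" for x
  proof -
    have x0: "norm x > 0" using x by linarith
    then have "F (sgn x) = 0" by (intro F(2)) (simp add: norm_sgn)
    then have "norm (of_real (?P x) * u x) < sqrt e" using R0[of x] x by simp
    then have "?P x * norm (u x) \<le> sqrt e" by (simp add: norm_mult)
    then have "(?P x * norm (u x))\<^sup>2 \<le> (sqrt e)\<^sup>2" by (intro power_mono) auto
    moreover have "(?P x)\<^sup>2 = norm x ^ (DIM('a) - 1)"
    proof -
      have "(?P x)\<^sup>2 = norm x powr (real (DIM('a) - 1))"
        using n by (simp add: power2_eq_square powr_add[symmetric] of_nat_diff)
      then show ?thesis unfolding powr_realpow[OF x0] .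
    qed
    ultimately show ?thesis using e by (simp add: power_mult_distrib)
  qed
  then have *: "norm x \<ge> max R0 1 \<longrightarrow> norm x ^ (DIM('a) - 1) * (norm (u x))\<^sup>2 \<le> e" for x by blast
  have "AE x in lborel. norm x \<ge> max R0 1 \<longrightarrow> norm x ^ (DIM('a) - 1) * (norm (v x))\<^sup>2 \<le> e"
    using v
  proof eventually_elim
    case (elim x)
    then show ?case using *[of x] by simp
  qed
  then show "\<exists>R. AE x in lborel. norm x \<ge> R \<longrightarrow> norm x ^ (DIM('a) - 1) * (norm (v x))\<^sup>2 \<le> e" by blast
qed

lemma integrable_imp_locally_integrable:
  "integrable lborel q \<Longrightarrow> locally_integrable q"
  unfolding locally_integrable_def
  by (auto intro: integrable_mult_indicator dest: borel_measurable_integrable)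

text \<open>The weak equation of the total field minus the weak Helmholtz equation of the incident
  field is Lap v + k^2 v = -q with source q = k^2 V u, now for the Borel representative and over
  \<open>lborel\<close>.\<close>

lemma scattered_weak_identity:
  fixes us v :: "'a::euclidean_space \<Rightarrow> complex"
  assumes sc: "scattered_field k V ui us" and ui: "incident_field k ui"
    and us: "us \<in> borel_measurable lebesgue"
    and v: "locally_integrable v" "AE x in lborel. us x = v x"
    and V: "V \<in> borel_measurable borel"
    and q: "integrable lborel q" "\<And>x. q x = of_real (k\<^sup>2) * V x * (ui x + v x)"
    and \<phi>: "test_fn \<phi>"
  shows "(LBINT x. v x * of_real (laplacian \<phi> x + k\<^sup>2 * \<phi> x))
        + (LBINT x. q x * of_real (\<phi> x)) = 0"
proof -
  have s\<phi>: "smooth \<phi>" using \<phi> by (simp add: test_fn_def)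
  have sui: "smooth ui" using ui by (simp add: incident_field_def)
  have c\<phi>: "continuous_on UNIV \<phi>" "continuous_on UNIV (laplacian \<phi>)"
    by (rule smooth_continuous_on[OF s\<phi>], rule continuous_on_laplacian[OF s\<phi>])
  have iv: "integrable lborel (\<lambda>x. v x * of_real (laplacian \<phi> x + k\<^sup>2 * \<phi> x))"
    and iq: "integrable lborel (\<lambda>x. q x * of_real (\<phi> x))"
  proof -
    show "integrable lborel (\<lambda>x. v x * of_real (laplacian \<phi> x + k\<^sup>2 * \<phi> x))"
    proof (rule test_fn_props[OF \<phi>])
      fix S
      assume S: "compact S" "\<And>x. x \<notin> S \<Longrightarrow> \<phi> x = 0" "\<And>x. x \<notin> S \<Longrightarrow> laplacian \<phi> x = 0"
      show ?thesis
        by (rule locally_integrable_mult[OF v(1) _ S(1)])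
           (simp_all add: S continuous_on_add continuous_on_mult c\<phi>)
    qed
    show "integrable lborel (\<lambda>x. q x * of_real (\<phi> x))"
    proof (rule test_fn_props[OF \<phi>])
      fix S
      assume S: "compact S" "\<And>x. x \<notin> S \<Longrightarrow> \<phi> x = 0" "\<And>x. x \<notin> S \<Longrightarrow> laplacian \<phi> x = 0"
      show ?thesis
        by (rule locally_integrable_mult[OF integrable_imp_locally_integrable[OF q(1)] c\<phi>(1) S(1,2)])
    qed
  qed
  let ?l = "\<lambda>x. (ui x + us x) * (of_real (laplacian \<phi> x) + of_real (k\<^sup>2) * (1 + V x) * of_real (\<phi> x))"
  let ?r = "\<lambda>x. ui x * of_real (laplacian \<phi> x + k\<^sup>2 * \<phi> x) + (v x * of_real (laplacian \<phi> x + k\<^sup>2 * \<phi> x) + q x * of_real (\<phi> x))"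
  have eq: "?l x = ?r x" if "us x = v x" for x
    unfolding q(2) that by (simp add: algebra_simps)
  have ir: "integrable lborel ?r"
    by (intro Bochner_Integration.integrable_add incident_field_weak(2)[OF ui \<phi>] iv iq)
  have [measurable]: "us \<in> borel_measurable lebesgue" by (rule us)
  have [measurable]: "ui \<in> borel_measurable lebesgue" "\<phi> \<in> borel_measurable lebesgue"
     "laplacian \<phi> \<in> borel_measurable lebesgue" "V \<in> borel_measurable lebesgue"
    using borel_measurable_continuous_onI[OF c\<phi>(1)] borel_measurable_continuous_onI[OF c\<phi>(2)]
      borel_measurable_continuous_onI[OF smooth_continuous_on[OF sui]] V
    by (simp_all add: measurable_completion)
  have "0 = integral\<^sup>L lebesgue ?l"
    using sc \<phi> by (simp add: scattered_field_def)
  also have "\<dots> = integral\<^sup>L lebesgue ?r"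
  proof (rule integral_cong_AE)
    show "?l \<in> borel_measurable lebesgue" by measurable
    show "?r \<in> borel_measurable lebesgue"
      using borel_measurable_integrable[OF ir] by (rule measurable_completion)
    show "AE x in lebesgue. ?l x = ?r x"
      unfolding AE_completion_iff using v(2) by (rule eventually_mono) (rule eq)
  qed
  also have "\<dots> = integral\<^sup>L lborel ?r"
    by (rule integral_completion[OF borel_measurable_integrable[OF ir]])
  also have "\<dots> = (LBINT x. ui x * of_real (laplacian \<phi> x + k\<^sup>2 * \<phi> x))
     + ((LBINT x. v x * of_real (laplacian \<phi> x + k\<^sup>2 * \<phi> x)) + (LBINT x. q x * of_real (\<phi> x)))"
    by (simp only: Bochner_Integration.integral_add[OF incident_field_weak(2)[OF ui \<phi>] Bochner_Integration.integrable_add[OF iv iq]]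
        Bochner_Integration.integral_add[OF iv iq])
  finally show ?thesis unfolding incident_field_weak(1)[OF ui \<phi>] by simp
qed

text \<open>Holds without integrability, since the integral of a non-integrable function is 0 by
  convention.\<close>

lemma norm_integral_le_nn_integral:
  fixes f :: "'a \<Rightarrow> 'b::{banach, second_countable_topology}"
  shows "ennreal (norm (integral\<^sup>L M f)) \<le> (\<integral>\<^sup>+ x. ennreal (norm (f x)) \<partial>M)"
  by (cases "integrable M f") (simp_all add: integral_norm_bound_ennreal not_integrable_integral_eq)

text \<open>Tested with the regularised solution centred at \<open>p\<close>, the average
  \<open>mollify N v p\<close> becomes minus the integral of \<open>q\<close> against a kernel that
  is at most a constant times |x - p|^(-(n-1)) for x, p in \<Omega>. Integrating in \<open>p\<close>
  first costs only a factor proportional to \<open>d\<close>, whatever N is.\<close>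

lemma scattered_L1_bound:
  fixes v q :: "'a::euclidean_space \<Rightarrow> complex"
  assumes n: "DIM('a) \<ge> 2" and k: "k > 0"
    and v: "locally_integrable v" "vanishes_at_infinity v"
    and q: "integrable lborel q" "\<And>x. x \<notin> \<Omega> \<Longrightarrow> q x = 0"
    and weak: "\<And>\<phi>. test_fn \<phi> \<Longrightarrow> (LBINT x. v x * of_real (laplacian \<phi> x + k\<^sup>2 * \<phi> x))
        + (LBINT x. q x * of_real (\<phi> x)) = 0"
    and \<Omega>: "\<Omega> \<in> sets borel" "bounded \<Omega>" "\<And>x y. x \<in> \<Omega> \<Longrightarrow> y \<in> \<Omega> \<Longrightarrow> dist x y \<le> d"
    and d: "0 < d" "d \<le> \<delta>" and \<delta>: "k\<^sup>2 * \<delta>\<^sup>2 \<le> 1 / 2"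
    and J: "radial_sol DIM('a) k (\<lambda>s. 0) J" "J 0 (\<delta>\<^sup>2) \<noteq> 0"
  shows "ennreal (gauss_mass TYPE('a)) * (\<integral>\<^sup>+ p. ennreal (norm (v p)) * indicator \<Omega> p \<partial>lborel)
    \<le> ennreal (8 * (1 + fact DIM('a)) * \<delta> * (2 ^ DIM('a) * measure lborel (ball (0::'a) 1) * d) * (LBINT x. norm (q x)))"
proof -
  let ?n = "DIM('a)"
  define a where "a = 8 * (1 + fact ?n) * \<delta>"
  define b where "b = 2 ^ ?n * measure lborel (ball (0::'a) 1) * d"
  have a0: "a \<ge> 0" and b0: "b \<ge> 0" using d by (simp_all add: a_def b_def)
  have Q0: "(LBINT x. norm (q x)) \<ge> 0" by simp
  define \<kappa> where "\<kappa> = (\<lambda>z::'a. ennreal (1 / norm z ^ (?n - 1)) * indicator (cball 0 d) z)"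
  have \<kappa>m[measurable]: "\<kappa> \<in> borel_measurable borel"
    unfolding \<kappa>_def by (intro borel_measurable_times_ennreal borel_measurable_indicator) auto
  have [measurable]: "q \<in> borel_measurable borel" "\<Omega> \<in> sets borel"
    using borel_measurable_integrable[OF q(1)] \<Omega> by auto
  have \<kappa>int: "(\<integral>\<^sup>+ p. \<kappa> (x - p) \<partial>lborel) \<le> ennreal b" for x
  proof -
    have "(\<integral>\<^sup>+ p. \<kappa> (x - p) \<partial>lborel) = (\<integral>\<^sup>+ p. \<kappa> (- x + p) \<partial>lborel)"
      unfolding \<kappa>_def by (intro nn_integral_cong) (auto simp: norm_minus_commute indicator_def)
    also have "\<dots> = (\<integral>\<^sup>+ p. \<kappa> p \<partial>distr lborel borel ((+) (- x)))"
      by (subst nn_integral_distr) auto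
    also have "\<dots> = (\<integral>\<^sup>+ p. \<kappa> p \<partial>lborel)" by (simp only: lborel_distr_plus)
    also have "\<dots> \<le> ennreal b"
      unfolding \<kappa>_def b_def by (rule nn_integral_inverse_power_cball[OF d(1)])
    finally show ?thesis .
  qed
  obtain \<rho> where \<rho>: "\<And>x. x \<in> \<Omega> \<Longrightarrow> norm x \<le> \<rho>" using \<Omega>(2) unfolding bounded_iff by auto
  have q\<rho>: "q x = 0" if "x \<notin> cball 0 \<rho>" for x
    using q(2)[of x] \<rho>[of x] that by auto
  have "(\<integral>\<^sup>+ p. ennreal (norm (mollify N v p)) * indicator \<Omega> p \<partial>lborel)
      \<le> ennreal (a * b * (LBINT x. norm (q x)))" if N: "N \<ge> 1" for N
  proof -
    obtain P where P: "radial_sol ?n k (\<lambda>s. N ^ ?n * exp (- N\<^sup>2 * s)) P"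
      using radial_sol_exists[OF n, of "N\<^sup>2" k "N ^ ?n" 0] by auto
    \<comment> \<open>The multiple of \<open>J\<close> is chosen to make the solution vanish at
      radius \<delta>, as \<open>radial_sol_near_origin\<close> requires; this is where
      \<open>J 0\<close> must not vanish at the square of \<delta>.\<close>
    define H where "H = (\<lambda>m s. P m s - P 0 (\<delta>\<^sup>2) / J 0 (\<delta>\<^sup>2) * J m s)"
    have H: "radial_sol ?n k (\<lambda>s. N ^ ?n * exp (- N\<^sup>2 * s)) H"
      unfolding H_def by (rule radial_sol_diff[OF P J(1)])
    have H0: "H 0 (\<delta>\<^sup>2) = 0" using J(2) by (simp add: H_def)
    have Hb: "\<bar>H 0 ((norm z)\<^sup>2)\<bar> \<le> a * (1 / norm z ^ (?n - 1))" if "norm z \<le> d" "z \<noteq> 0" for z :: 'a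
    proof -
      have "norm z ^ (?n - 1) * \<bar>H 0 ((norm z)\<^sup>2)\<bar> \<le> a"
        unfolding a_def by (rule radial_sol_near_origin[OF H n _ _ \<delta> H0]) (use that N d in auto)
      then show ?thesis using that by (simp add: pos_le_divide_eq mult.commute)
    qed
    have pt: "ennreal (norm (mollify N v p)) * indicator \<Omega> p
        \<le> (\<integral>\<^sup>+ x. ennreal (norm (q x)) * (ennreal a * \<kappa> (x - p)) \<partial>lborel)" for p
    proof (cases "p \<in> \<Omega>")
      case True
      have "mollify N v p + (LBINT x. q x * of_real (H 0 ((norm (x - p))\<^sup>2))) = 0"
        unfolding mollify_def by (rule radial_identity[OF n k _ v q(1) q\<rho> weak H]) (use N in auto)
      then have "norm (mollify N v p) = norm ((LBINT x. q x * of_real (H 0 ((norm (x - p))\<^sup>2))))"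
        by (simp add: add_eq_0_iff)
      also have "ennreal \<dots> \<le> (\<integral>\<^sup>+ x. ennreal (norm (q x * of_real (H 0 ((norm (x - p))\<^sup>2)))) \<partial>lborel)"
        by (rule norm_integral_le_nn_integral)
      also have "\<dots> \<le> (\<integral>\<^sup>+ x. ennreal (norm (q x)) * (ennreal a * \<kappa> (x - p)) \<partial>lborel)"
      proof (rule nn_integral_mono_AE, rule eventually_mono[OF AE_lborel_singleton[of p]])
        fix x assume xp: "x \<noteq> p"
        show "ennreal (norm (q x * of_real (H 0 ((norm (x - p))\<^sup>2)))) \<le> ennreal (norm (q x)) * (ennreal a * \<kappa> (x - p))"
        proof (cases "x \<in> \<Omega>")
          case x: True
          have dx: "norm (x - p) \<le> d" using \<Omega>(3)[OF x True] by (simp add: dist_norm)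
          have "norm (q x * of_real (H 0 ((norm (x - p))\<^sup>2))) = norm (q x) * \<bar>H 0 ((norm (x - p))\<^sup>2)\<bar>"
            by (simp only: norm_mult norm_of_real)
          also have "\<dots> \<le> norm (q x) * (a * (1 / norm (x - p) ^ (?n - 1)))"
            using Hb[OF dx] xp by (intro mult_left_mono) auto
          finally have "ennreal (norm (q x * of_real (H 0 ((norm (x - p))\<^sup>2))))
            \<le> ennreal (norm (q x) * (a * (1 / norm (x - p) ^ (?n - 1))))" by (rule ennreal_leI)
          also have "\<dots> = ennreal (norm (q x)) * (ennreal a * \<kappa> (x - p))"
            unfolding \<kappa>_def using dx a0 by (simp only: ennreal_mult'[OF norm_ge_zero] ennreal_mult'[OF a0]) (simp add: indicator_def)
          finally show ?thesis .
        qed (simp add: q(2))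
      qed
      finally show ?thesis using True by simp
    qed simp
    have "(\<integral>\<^sup>+ p. ennreal (norm (mollify N v p)) * indicator \<Omega> p \<partial>lborel)
      \<le> (\<integral>\<^sup>+ p. (\<integral>\<^sup>+ x. ennreal (norm (q x)) * (ennreal a * \<kappa> (x - p)) \<partial>lborel) \<partial>lborel)"
      by (rule nn_integral_mono) (rule pt)
    also have "\<dots> = (\<integral>\<^sup>+ x. (\<integral>\<^sup>+ p. ennreal (norm (q x)) * (ennreal a * \<kappa> (x - p)) \<partial>lborel) \<partial>lborel)"
      by (rule lborel_pair.Fubini'[symmetric]) measurable
    also have "\<dots> \<le> (\<integral>\<^sup>+ x. ennreal (norm (q x)) * (ennreal a * ennreal b) \<partial>lborel)"
    proof (rule nn_integral_mono)
      fix x :: 'a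
      have "(\<integral>\<^sup>+ p. ennreal (norm (q x)) * (ennreal a * \<kappa> (x - p)) \<partial>lborel)
          = ennreal (norm (q x)) * (\<integral>\<^sup>+ p. ennreal a * \<kappa> (x - p) \<partial>lborel)"
        by (rule nn_integral_cmult) measurable
      also have "(\<integral>\<^sup>+ p. ennreal a * \<kappa> (x - p) \<partial>lborel) = ennreal a * (\<integral>\<^sup>+ p. \<kappa> (x - p) \<partial>lborel)"
        by (rule nn_integral_cmult) measurable
      also have "ennreal (norm (q x)) * (ennreal a * (\<integral>\<^sup>+ p. \<kappa> (x - p) \<partial>lborel)) \<le> ennreal (norm (q x)) * (ennreal a * ennreal b)"
        by (intro mult_left_mono \<kappa>int) auto
      finally show "(\<integral>\<^sup>+ p. ennreal (norm (q x)) * (ennreal a * \<kappa> (x - p)) \<partial>lborel)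
         \<le> ennreal (norm (q x)) * (ennreal a * ennreal b)" .
    qed
    also have "\<dots> = (\<integral>\<^sup>+ x. ennreal (norm (q x)) \<partial>lborel) * (ennreal a * ennreal b)"
      by (rule nn_integral_multc) measurable
    also have "(\<integral>\<^sup>+ x. ennreal (norm (q x)) \<partial>lborel) = ennreal ((LBINT x. norm (q x)))"
      by (rule nn_integral_eq_integral[OF integrable_norm[OF q(1)]]) simp
    also have "ennreal ((LBINT x. norm (q x))) * (ennreal a * ennreal b)
        = ennreal (a * b * (LBINT x. norm (q x)))"
      unfolding ennreal_mult'[OF a0, symmetric] ennreal_mult'[OF Q0, symmetric] by (simp only: mult.commute)
    finally show ?thesis .
  qed
  then show ?thesis
    using L1_bound_from_mollify[OF v \<Omega>(1,2), of "a * b * (LBINT x. norm (q x))"] a0 b0 Q0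
    unfolding a_def b_def by simp
qed

section \<open>From the L^1 bound to the boundary values\<close>

lemma holder_continuous:
  fixes f :: "'a::metric_space \<Rightarrow> 'b::real_normed_vector"
  assumes "C_alpha UNIV \<alpha> f" "\<alpha> > 0"
  shows "continuous_on UNIV f"
proof -
  obtain B where B: "\<And>x y. norm (f x - f y) \<le> B * dist x y powr \<alpha>"
    using assms(1) unfolding C_alpha_def C_alpha_norm_le_def holder_bound_def by auto
  have "(f \<longlongrightarrow> f x) (at x)" for x
  proof (rule Lim_null_comparison[THEN LIM_zero_cancel])
    show "\<forall>\<^sub>F y in at x. norm (f y - f x) \<le> B * dist y x powr \<alpha>"
      using B by simp
    have "((\<lambda>y. dist y x) \<longlongrightarrow> dist x x) (at x)"
      by (intro tendsto_dist tendsto_ident_at tendsto_const)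
    then have "((\<lambda>y. dist y x powr \<alpha>) \<longlongrightarrow> 0 powr \<alpha>) (at x)"
      by (intro tendsto_powr' tendsto_const) (auto simp: assms(2))
    then show "((\<lambda>y. B * dist y x powr \<alpha>) \<longlongrightarrow> 0) (at x)"
      using tendsto_mult_left[of "\<lambda>y. dist y x powr \<alpha>" 0 "at x" B] assms(2) by simp
  qed
  then show ?thesis by (simp add: continuous_on_def)
qed

text \<open>The sum of the bounds on the partial derivatives bounds the operator norm of the
  derivative, so the mean value inequality applies on the convex whole space.\<close>

lemma C1_alpha_lipschitz:
  fixes f :: "'a::euclidean_space \<Rightarrow> 'b::real_normed_vector"
  assumes "C1_alpha_norm_le UNIV \<alpha> f M"
  shows "norm (f x - f y) \<le> M * norm (x - y)"
proof -
  obtain A A1 B1 where d: "\<And>x. f differentiable (at x)" and A: "0 \<le> A"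
    and b: "\<And>b x. b \<in> Basis \<Longrightarrow> 0 \<le> A1 b \<and> 0 \<le> B1 b \<and> norm (pd b f x) \<le> A1 b"
    and le: "A + (\<Sum>b\<in>Basis. A1 b) + (\<Sum>b\<in>Basis. B1 b) \<le> M"
    using assms unfolding C1_alpha_norm_le_def sup_bound_def by blast
  have M: "(\<Sum>b\<in>Basis. A1 b) \<le> M"
    using le A sum_nonneg[of Basis B1] b by fastforce
  show ?thesis
  proof (rule differentiable_bound[OF convex_UNIV])
    fix z :: 'a
    show "(f has_derivative frechet_derivative f (at z)) (at z within UNIV)"
      using d frechet_derivative_works by blast
    show "onorm (frechet_derivative f (at z)) \<le> M"
    proof (rule onorm_le)
      fix h :: 'a
      have lin: "linear (frechet_derivative f (at z))" by (rule linear_frechet_derivative[OF d])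
      have "frechet_derivative f (at z) h = frechet_derivative f (at z) (\<Sum>b\<in>Basis. (h \<bullet> b) *\<^sub>R b)"
        by (simp add: euclidean_representation)
      also have "\<dots> = (\<Sum>b\<in>Basis. (h \<bullet> b) *\<^sub>R pd b f z)"
        by (simp only: linear_sum[OF lin] linear_scale[OF lin] pd_def)
      also have "norm \<dots> \<le> (\<Sum>b\<in>Basis. norm ((h \<bullet> b) *\<^sub>R pd b f z))" by (rule norm_sum)
      also have "\<dots> \<le> (\<Sum>b\<in>Basis. norm h * A1 b)"
      proof (rule sum_mono)
        fix b :: 'a assume B: "b \<in> Basis"
        have "\<bar>h \<bullet> b\<bar> * norm (pd b f z) \<le> norm h * A1 b"
          using b[OF B, of z] Basis_le_norm[OF B, of h] by (intro mult_mono) auto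
        then show "norm ((h \<bullet> b) *\<^sub>R pd b f z) \<le> norm h * A1 b" by simp
      qed
      also have "\<dots> = norm h * (\<Sum>b\<in>Basis. A1 b)" by (simp add: sum_distrib_left)
      also have "\<dots> \<le> M * norm h" using mult_left_mono[OF M norm_ge_zero[of h]] by (simp add: mult.commute)
      finally show "norm (frechet_derivative f (at z) h) \<le> M * norm h" .
    qed
  qed auto
qed

lemma diameter_pos_open:
  fixes \<Omega> :: "'a::euclidean_space set"
  assumes "open \<Omega>" "bounded \<Omega>" "\<Omega> \<noteq> {}"
  shows "diameter \<Omega> > 0"
proof -
  obtain x r where x: "x \<in> \<Omega>" "r > 0" "cball x r \<subseteq> \<Omega>"
    using assms open_contains_cball by blast
  obtain b :: 'a where b: "b \<in> Basis" using nonempty_Basis by blast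
  have "x + r *\<^sub>R b \<in> \<Omega>" using x b by (intro subsetD[OF x(3)]) (simp add: dist_norm)
  then have "dist x (x + r *\<^sub>R b) \<le> diameter \<Omega>" by (rule diameter_bounded_bound[OF assms(2) x(1)])
  then show ?thesis using x b by (simp add: dist_norm)
qed

text \<open>\<open>q\<close> integrates to zero against J(|x - z|^2), which is close to 1 on
  \<Omega>. Hence k^2 \<phi>(z) ui(z) times the volume of \<Omega> is a pure error integral, and its
  four parts give the four summands of the constant: oscillation of \<phi>, oscillation of ui,
  deviation of J from 1, and the scattered field.\<close>

lemma boundary_bound_small:
  fixes \<Omega> :: "'a::euclidean_space set" and \<phi> ui v :: "'a \<Rightarrow> complex"
  assumes n: "DIM('a) \<ge> 2" and k: "k > 0" and Mp: "Mp \<ge> 0" and Mi: "Mi \<ge> 0" and \<alpha>: "0 < \<alpha>" "\<alpha> < 1"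
    and v: "locally_integrable v" "vanishes_at_infinity v"
    and \<Omega>: "open \<Omega>" "bounded \<Omega>" "\<Omega> \<noteq> {}"
    and \<phi>: "continuous_on UNIV \<phi>" "\<And>x. x \<in> closure \<Omega> \<Longrightarrow> norm (\<phi> x) \<le> Mp"
      "\<And>x y. x \<in> closure \<Omega> \<Longrightarrow> y \<in> closure \<Omega> \<Longrightarrow> norm (\<phi> x - \<phi> y) \<le> Mp * dist x y powr \<alpha>"
    and ui: "continuous_on UNIV ui" "\<And>x. norm (ui x) \<le> 1" "\<And>x y. norm (ui x - ui y) \<le> Mi * norm (x - y)"
    and q: "\<And>x. q x = of_real (k\<^sup>2) * (if x \<in> \<Omega> then \<phi> x else 0) * (ui x + v x)"
    and weak: "\<And>\<psi>. integrable lborel q \<Longrightarrow> test_fn \<psi> \<Longrightarrow> (LBINT x. v x * of_real (laplacian \<psi> x + k\<^sup>2 * \<psi> x))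
        + (LBINT x. q x * of_real (\<psi> x)) = 0"
    and J: "radial_sol DIM('a) k (\<lambda>s. 0) J" "J 0 (\<delta>\<^sup>2) \<noteq> 0"
    and JK: "\<And>s. 0 \<le> s \<Longrightarrow> s \<le> \<delta>\<^sup>2 \<Longrightarrow> \<bar>J 0 s - 1\<bar> \<le> KJ * s" and KJ: "KJ \<ge> 0" "KJ * \<delta>\<^sup>2 \<le> 1"
    and d: "d = diameter \<Omega>" "d \<le> \<delta>" "d \<le> 1" and \<delta>: "k\<^sup>2 * \<delta>\<^sup>2 \<le> 1 / 2"
    and C5: "gauss_mass TYPE('a) * C5 =
        8 * (1 + fact DIM('a)) * \<delta> * (2 ^ DIM('a) * measure lborel (ball (0::'a) 1)) * (k\<^sup>2 * Mp)" "C5 * d \<le> 1 / 2"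
    and z: "z \<in> frontier \<Omega>"
  shows "norm (\<phi> z * ui z) \<le> (Mp + Mp * Mi + Mp * KJ + 4 * Mp * C5) * d powr \<alpha>"
proof -
  let ?\<gamma> = "gauss_mass TYPE('a)"
  have \<gamma>: "?\<gamma> > 0" by (rule gauss_mass_pos)
  have d0: "d > 0" using diameter_pos_open[OF \<Omega>] d by simp
  have C50: "C5 \<ge> 0"
  proof -
    have "?\<gamma> * C5 \<ge> 0" unfolding C5(1) using Mp d0 d(2) by (intro mult_nonneg_nonneg) auto
    then show ?thesis using \<gamma> by (simp add: zero_le_mult_iff)
  qed
  have dd: "d \<le> d powr \<alpha>" "d\<^sup>2 \<le> d powr \<alpha>"
  proof -
    show 1: "d \<le> d powr \<alpha>"
      using powr_mono'[of \<alpha> 1 d] d0 d(3) \<alpha> by simp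
    have "d\<^sup>2 \<le> d" using d0 d(3) by (simp add: power2_eq_square mult_left_le_one_le)
    then show "d\<^sup>2 \<le> d powr \<alpha>" using 1 by linarith
  qed
  have \<Omega>b[measurable]: "\<Omega> \<in> sets borel" using \<Omega>(1) by simp
  have dist_d: "dist x y \<le> d" if "x \<in> closure \<Omega>" "y \<in> closure \<Omega>" for x y
    using diameter_bounded_bound[OF bounded_closure[OF \<Omega>(2)] that] diameter_closure[OF \<Omega>(2)] d(1) by simp
  have zc: "z \<in> closure \<Omega>" using z by (simp add: frontier_def)
  have sub: "x \<in> closure \<Omega>" if "x \<in> \<Omega>" for x using that closure_subset by blast
  define I where "I = indicat_real \<Omega>"
  have I01: "I x = 0 \<or> I x = 1" for x by (simp add: I_def indicator_def)
  have Im[measurable]: "I \<in> borel_measurable borel" unfolding I_def by measurable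
  have finite: "emeasure lborel \<Omega> < \<infinity>" by (rule emeasure_bounded_finite[OF \<Omega>(2)])
  define \<mu> where "\<mu> = measure lborel \<Omega>"
  have iI: "integrable lborel I" unfolding I_def using finite by (intro integrable_real_indicator) auto
  have I\<mu>: "integral\<^sup>L lborel I = \<mu>" by (simp add: I_def \<mu>_def)
  have \<mu>: "\<mu> > 0"
  proof -
    obtain x r where x: "r > 0" "ball x r \<subseteq> \<Omega>" using \<Omega> open_contains_ball by blast
    have "0 < measure lborel (ball x r)" using x by (simp add: content_ball_pos)
    also have "\<dots> \<le> \<mu>" unfolding \<mu>_def
      by (rule measure_mono_fmeasurable[OF x(2)]) (use finite in \<open>auto simp: fmeasurable_def\<close>)
    finally show ?thesis .
  qed
  have vm[measurable]: "v \<in> borel_measurable borel" using v(1) by (simp add: locally_integrable_def)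
  have uim[measurable]: "ui \<in> borel_measurable borel" by (rule borel_measurable_continuous_onI[OF ui(1)])
  have \<phi>m[measurable]: "\<phi> \<in> borel_measurable borel" by (rule borel_measurable_continuous_onI[OF \<phi>(1)])
  have iv: "integrable lborel (\<lambda>x. I x *\<^sub>R v x)"
  proof -
    obtain \<rho> where \<rho>: "\<And>x. x \<in> \<Omega> \<Longrightarrow> norm x \<le> \<rho>" using \<Omega>(2) unfolding bounded_iff by auto
    have i: "integrable lborel (\<lambda>x. indicator (cball 0 \<rho>) x *\<^sub>R v x)" using v(1) by (simp add: locally_integrable_def)
    show ?thesis
      by (rule Bochner_Integration.integrable_bound[OF i])
         (use \<rho> in \<open>auto simp: I_def indicator_def\<close>)
  qed
  define X where "X = (LBINT x. I x * norm (v x))"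
  have ivn: "integrable lborel (\<lambda>x. I x * norm (v x))"
    using integrable_norm[OF iv] I01 by (simp add: I_def)
  have X0: "X \<ge> 0" unfolding X_def by (rule integral_nonneg_AE) (simp add: I_def)
  have qle: "norm (q x) \<le> k\<^sup>2 * Mp * (I x + I x * norm (v x))" for x
  proof (cases "x \<in> \<Omega>")
    case True
    have "norm (q x) = k\<^sup>2 * (norm (\<phi> x) * norm (ui x + v x))" using True by (simp add: q norm_mult norm_power)
    also have "\<dots> \<le> k\<^sup>2 * (Mp * (1 + norm (v x)))"
      using \<phi>(2)[OF sub[OF True]] norm_triangle_ineq[of "ui x" "v x"] ui(2)[of x] Mp
      by (intro mult_left_mono mult_mono) auto
    finally show ?thesis using True by (simp add: I_def)
  qed (simp add: q I_def)
  have iq: "integrable lborel q"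
  proof (rule Bochner_Integration.integrable_bound[OF integrable_mult_right[OF Bochner_Integration.integrable_add[OF iI ivn], of "k\<^sup>2 * Mp"]])
    have "(\<lambda>x. of_real (k\<^sup>2) * (if x \<in> \<Omega> then \<phi> x else 0) * (ui x + v x)) \<in> borel_measurable borel" by measurable
    then show "q \<in> borel_measurable lborel" by (simp add: q[abs_def] cong: measurable_cong)
    show "AE x in lborel. norm (q x) \<le> norm (k\<^sup>2 * Mp * (I x + I x * norm (v x)))"
      by (rule AE_I2) (rule order_trans[OF qle], simp)
  qed
  have q0: "q x = 0" if "x \<notin> \<Omega>" for x using that by (simp add: q)
  \<comment> \<open>\<open>C5\<close> is chosen so that the constant of
    \<open>scattered_L1_bound\<close> times k^2 Mp equals \<gamma> C5 d. The bound
    \<open>qle\<close> brings the L^1 norm \<open>X\<close> of \<open>v\<close> to the right-hand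
    side as well, where C5 d \<le> 1/2 absorbs it.\<close>
  have Xle: "X \<le> 2 * C5 * d * \<mu>"
  proof -
    let ?Q = "(LBINT x. norm (q x))"
    let ?c = "8 * (1 + fact DIM('a)) * \<delta> * (2 ^ DIM('a) * measure lborel (ball (0::'a) 1) * d)"
    have "ennreal ?\<gamma> * (\<integral>\<^sup>+ p. ennreal (norm (v p)) * indicator \<Omega> p \<partial>lborel) \<le> ennreal (?c * ?Q)"
      by (rule scattered_L1_bound[OF n k v iq q0 weak[OF iq] \<Omega>b \<Omega>(2) dist_d[OF sub sub] d0 d(2) \<delta> J])
    also have "(\<integral>\<^sup>+ p. ennreal (norm (v p)) * indicator \<Omega> p \<partial>lborel) = (\<integral>\<^sup>+ p. ennreal (I p * norm (v p)) \<partial>lborel)"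
      by (intro nn_integral_cong) (auto simp: I_def indicator_def)
    also have "\<dots> = ennreal X"
      unfolding X_def by (rule nn_integral_eq_integral[OF ivn]) (simp add: I_def)
    finally have "ennreal (?\<gamma> * X) \<le> ennreal (?c * ?Q)" using \<gamma> by (simp add: ennreal_mult')
    moreover have c0: "?c \<ge> 0" using d0 d(2) by simp
    ultimately have 1: "?\<gamma> * X \<le> ?c * ?Q" by (simp add: ennreal_le_iff)
    have "?Q \<le> (LBINT x. k\<^sup>2 * Mp * (I x + I x * norm (v x)))"
      by (rule integral_mono[OF integrable_norm[OF iq] integrable_mult_right[OF Bochner_Integration.integrable_add[OF iI ivn]] qle])
    also have "\<dots> = k\<^sup>2 * Mp * (\<mu> + X)"
      by (simp only: integral_mult_right_zero Bochner_Integration.integral_add[OF iI ivn] I\<mu> X_def)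
    finally have "?c * ?Q \<le> ?c * (k\<^sup>2 * Mp * (\<mu> + X))" using c0 by (rule mult_left_mono)
    also have "\<dots> = ?\<gamma> * C5 * d * (\<mu> + X)" unfolding C5(1) by simp
    finally have "?\<gamma> * X \<le> ?\<gamma> * (C5 * d * (\<mu> + X))" using 1 by simp
    then have "X \<le> C5 * d * (\<mu> + X)" using \<gamma> by simp
    also have "\<dots> = C5 * d * \<mu> + (C5 * d) * X" by (simp add: distrib_left)
    also have "\<dots> \<le> C5 * d * \<mu> + (1 / 2) * X" using C5(2) X0 by (intro add_left_mono mult_right_mono)
    finally show ?thesis by simp
  qed
  define Jz where "Jz = (\<lambda>x. J 0 ((norm (x - z))\<^sup>2))"
  have Jb: "\<bar>Jz x - 1\<bar> \<le> KJ * d\<^sup>2" "\<bar>Jz x\<bar> \<le> 2" if "x \<in> \<Omega>" for x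
  proof -
    have "norm (x - z) \<le> d" using dist_d[OF sub[OF that] zc] by (simp add: dist_norm)
    then have s: "(norm (x - z))\<^sup>2 \<le> d\<^sup>2" by (intro power_mono) auto
    have d\<delta>: "d\<^sup>2 \<le> \<delta>\<^sup>2" using d0 d(2) by (intro power_mono) auto
    have "\<bar>Jz x - 1\<bar> \<le> KJ * (norm (x - z))\<^sup>2" unfolding Jz_def using s d\<delta> by (intro JK) auto
    also have "\<dots> \<le> KJ * d\<^sup>2" using s KJ(1) by (rule mult_left_mono)
    finally show 1: "\<bar>Jz x - 1\<bar> \<le> KJ * d\<^sup>2" .
    have "KJ * d\<^sup>2 \<le> KJ * \<delta>\<^sup>2" using d\<delta> KJ(1) by (rule mult_left_mono)
    then show "\<bar>Jz x\<bar> \<le> 2" using 1 KJ(2) by linarith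
  qed
  have qJ: "(LBINT x. q x * of_real (Jz x)) = 0"
  proof -
    obtain \<rho> where \<rho>: "\<And>x. x \<in> \<Omega> \<Longrightarrow> norm x \<le> \<rho>" using \<Omega>(2) unfolding bounded_iff by auto
    have q\<rho>: "q x = 0" if "x \<notin> cball 0 \<rho>" for x using q0[of x] \<rho>[of x] that by auto
    \<comment> \<open>The homogeneous equation seen as a Gaussian one of amplitude 0; the rate 1 is
      an arbitrary positive number.\<close>
    have J': "radial_sol DIM('a) k (\<lambda>s. 0 * exp (- 1 * s)) J" using J(1) by simp
    have "(LBINT x. v x * of_real (0 * exp (- 1 * (norm (x - z))\<^sup>2)))
        + (LBINT x. q x * of_real (J 0 ((norm (x - z))\<^sup>2))) = 0"
      by (rule radial_identity[OF n k _ v iq q\<rho> weak[OF iq] J']) simp_all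
    then show ?thesis by (simp add: Jz_def)
  qed
  let ?a = "\<phi> z * ui z"
  \<comment> \<open>The errors that do not involve \<open>v\<close>, per unit of volume and without
    the factor k^2.\<close>
  define E where "E = Mp * d powr \<alpha> + Mp * Mi * d + Mp * (KJ * d\<^sup>2)"
  have JM[measurable]: "Jz \<in> borel_measurable borel"
  proof -
    have "derivs J" using J(1) by (simp add: radial_sol_def)
    then have "smooth Jz"
      unfolding Jz_def by (rule smooth_compose) (rule smooth_norm_sq)
    then have "continuous_on UNIV Jz" by (rule smooth_continuous_on)
    then show ?thesis by (rule borel_measurable_continuous_onI)
  qed
  have qm[measurable]: "q \<in> borel_measurable borel" using borel_measurable_integrable[OF iq] by simp
  have pt: "norm (I x *\<^sub>R (of_real (k\<^sup>2) * ?a) - q x * of_real (Jz x)) \<le> k\<^sup>2 * (E * I x + 2 * Mp * (I x * norm (v x)))" for x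
  proof (cases "x \<in> \<Omega>")
    case True
    note xc = sub[OF True]
    have dz: "dist z x \<le> d" by (rule dist_d[OF zc xc])
    \<comment> \<open>Telescoping: \<phi>(z) ui(z) is exchanged for \<phi>(x) (ui(x) + v(x)) J one
      factor at a time.\<close>
    have "I x *\<^sub>R (of_real (k\<^sup>2) * ?a) - q x * of_real (Jz x)
       = of_real (k\<^sup>2) * ((\<phi> z - \<phi> x) * ui z + (\<phi> x * (ui z - ui x) + (\<phi> x * ui x * of_real (1 - Jz x) + - (\<phi> x * v x * of_real (Jz x)))))"
      using True by (simp add: q I_def algebra_simps)
    then have "norm (I x *\<^sub>R (of_real (k\<^sup>2) * ?a) - q x * of_real (Jz x))
       = k\<^sup>2 * norm ((\<phi> z - \<phi> x) * ui z + (\<phi> x * (ui z - ui x) + (\<phi> x * ui x * of_real (1 - Jz x) + - (\<phi> x * v x * of_real (Jz x)))))"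
      by (simp only: norm_mult norm_of_real) simp
    also have "\<dots> \<le> k\<^sup>2 * (Mp * d powr \<alpha> + (Mp * Mi * d + (Mp * (KJ * d\<^sup>2) + 2 * Mp * norm (v x))))"
    proof (rule mult_left_mono)
      have t1: "norm ((\<phi> z - \<phi> x) * ui z) \<le> Mp * d powr \<alpha>"
      proof -
        have "norm (\<phi> z - \<phi> x) \<le> Mp * dist z x powr \<alpha>" by (rule \<phi>(3)[OF zc xc])
        also have "\<dots> \<le> Mp * d powr \<alpha>" using dz \<alpha> Mp by (intro mult_left_mono powr_mono2) auto
        finally have "norm (\<phi> z - \<phi> x) * norm (ui z) \<le> Mp * d powr \<alpha> * 1"
          using ui(2) Mp by (intro mult_mono) auto
        then show ?thesis by (simp add: norm_mult)
      qed
      have t2: "norm (\<phi> x * (ui z - ui x)) \<le> Mp * Mi * d"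
      proof -
        have "norm (ui z - ui x) \<le> Mi * norm (z - x)" by (rule ui(3))
        also have "\<dots> \<le> Mi * d" using dz Mi by (intro mult_left_mono) (auto simp: dist_norm)
        finally have "norm (\<phi> x) * norm (ui z - ui x) \<le> Mp * (Mi * d)"
          using \<phi>(2)[OF xc] Mp by (intro mult_mono) auto
        then show ?thesis by (simp add: norm_mult mult.assoc)
      qed
      have t3: "norm (\<phi> x * ui x * of_real (1 - Jz x)) \<le> Mp * (KJ * d\<^sup>2)"
      proof -
        have a1: "norm (\<phi> x) * norm (ui x) \<le> Mp * 1" using \<phi>(2)[OF xc] ui(2) Mp by (intro mult_mono) auto
        have a2: "\<bar>1 - Jz x\<bar> \<le> KJ * d\<^sup>2" using Jb(1)[OF True] by (simp add: abs_minus_commute)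
        have "norm (\<phi> x) * norm (ui x) * \<bar>1 - Jz x\<bar> \<le> Mp * 1 * (KJ * d\<^sup>2)"
          by (rule mult_mono[OF a1 a2]) (use Mp in auto)
        then show ?thesis by (simp only: norm_mult norm_of_real mult_1_right)
      qed
      have t4: "norm (\<phi> x * v x * of_real (Jz x)) \<le> 2 * Mp * norm (v x)"
      proof -
        have "norm (\<phi> x) * \<bar>Jz x\<bar> \<le> Mp * 2" using \<phi>(2)[OF xc] Jb(2)[OF True] Mp by (intro mult_mono) auto
        then have "norm (\<phi> x) * \<bar>Jz x\<bar> * norm (v x) \<le> Mp * 2 * norm (v x)" by (rule mult_right_mono) simp
        then show ?thesis by (simp only: norm_mult norm_of_real) (simp add: mult_ac)
      qed
      have tri: "norm (a + (b + (c + - e))) \<le> norm a + (norm b + (norm c + norm e))" for a b c e :: complex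
        using norm_triangle_ineq[of a "b + (c + - e)"] norm_triangle_ineq[of b "c + - e"]
          norm_triangle_ineq[of c "- e"] norm_minus_cancel[of e] by linarith
      show "norm ((\<phi> z - \<phi> x) * ui z + (\<phi> x * (ui z - ui x) + (\<phi> x * ui x * of_real (1 - Jz x) + - (\<phi> x * v x * of_real (Jz x)))))
        \<le> Mp * d powr \<alpha> + (Mp * Mi * d + (Mp * (KJ * d\<^sup>2) + 2 * Mp * norm (v x)))"
        by (rule order_trans[OF tri]) (intro add_mono t1 t2 t3 t4)
    qed simp
    also have "\<dots> = k\<^sup>2 * (E * I x + 2 * Mp * (I x * norm (v x)))"
      using True by (simp add: E_def I_def)
    finally show ?thesis .
  qed (simp add: I_def q0)
  have iqJ: "integrable lborel (\<lambda>x. q x * of_real (Jz x))"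
  proof (rule Bochner_Integration.integrable_bound[OF integrable_scaleR_right[OF iq, of 2]])
    show "(\<lambda>x. q x * of_real (Jz x)) \<in> borel_measurable lborel" by measurable
    have "norm (q x * of_real (Jz x)) \<le> norm (2 *\<^sub>R q x)" for x
    proof (cases "x \<in> \<Omega>")
      case True
      have "norm (q x) * \<bar>Jz x\<bar> \<le> norm (q x) * 2" using Jb(2)[OF True] by (rule mult_left_mono) simp
      then show ?thesis by (simp add: norm_mult)
    qed (simp add: q0)
    then show "AE x in lborel. norm (q x * of_real (Jz x)) \<le> norm (2 *\<^sub>R q x)" by simp
  qed
  have ia: "integrable lborel (\<lambda>x. I x *\<^sub>R (of_real (k\<^sup>2) * ?a))"
    by (rule integrable_scaleR_left[OF iI])
  have "\<mu> * (k\<^sup>2 * norm ?a) = norm (\<mu> *\<^sub>R (of_real (k\<^sup>2) * ?a))"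
    using \<mu> by (simp add: norm_mult norm_power)
  \<comment> \<open>Subtracting the product of \<open>q\<close> and \<open>Jz\<close> is free
    because its integral is zero.\<close>
  also have "\<mu> *\<^sub>R (of_real (k\<^sup>2) * ?a) = (LBINT x. I x *\<^sub>R (of_real (k\<^sup>2) * ?a) - q x * of_real (Jz x))"
    by (simp only: Bochner_Integration.integral_diff[OF ia iqJ] qJ integral_scaleR_left[OF iI] I\<mu> diff_0_right)
  also have "norm \<dots> \<le> (LBINT x. k\<^sup>2 * (E * I x + 2 * Mp * (I x * norm (v x))))"
    by (rule Bochner_Integration.integral_norm_bound_integral[OF Bochner_Integration.integrable_diff[OF ia iqJ] _ pt])
       (intro integrable_mult_right Bochner_Integration.integrable_add iI ivn)
  also have "\<dots> = k\<^sup>2 * (E * \<mu> + 2 * Mp * X)"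
    using iI ivn by (simp add: I\<mu> X_def)
  \<comment> \<open>A factor 2 from |J| \<le> 2 and a factor 2 from the absorption in
    \<open>Xle\<close> combine to the 4 in the constant.\<close>
  also have "\<dots> \<le> k\<^sup>2 * (E * \<mu> + 2 * Mp * (2 * C5 * d * \<mu>))"
    using Xle Mp by (intro mult_left_mono add_left_mono) auto
  also have "\<dots> = \<mu> * (k\<^sup>2 * (E + 4 * Mp * C5 * d))" by (simp add: algebra_simps)
  finally have "k\<^sup>2 * norm ?a \<le> k\<^sup>2 * (E + 4 * Mp * C5 * d)" using \<mu> by simp
  then have "norm ?a \<le> E + 4 * Mp * C5 * d" using k by simp
  also have "\<dots> \<le> (Mp * d powr \<alpha> + Mp * Mi * d powr \<alpha> + Mp * (KJ * d powr \<alpha>)) + 4 * Mp * C5 * d powr \<alpha>"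
    unfolding E_def using dd Mp Mi KJ(1) C50 by (intro add_mono mult_left_mono) auto
  also have "\<dots> = (Mp + Mp * Mi + Mp * KJ + 4 * Mp * C5) * d powr \<alpha>" by (simp add: algebra_simps)
  finally show ?thesis .
qed

theorem theorem3p3:
  fixes D Mp Mi k \<alpha> :: real
    and Cwp :: "real \<Rightarrow> real"
  assumes "DIM('a::euclidean_space) \<ge> 2"
    and "D > 0" and "Mp > 0" and "Mi > 0" and "k > 0" and "0 < \<alpha>" and "\<alpha> < 1"
    and "\<forall>R>0. uniformly_well_posed TYPE('a) R Mp k (Cwp R)"
  shows "\<exists>\<C>>0. \<forall>(\<Omega>::'a set) (\<phi>::'a \<Rightarrow> complex) ui us.
     lipschitz_domain \<Omega> \<and> bounded \<Omega> \<and> diameter \<Omega> \<le> D \<and> connected (- closure \<Omega>) \<and>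
     C_alpha UNIV \<alpha> \<phi> \<and> C_alpha_norm_le (closure \<Omega>) \<alpha> \<phi> Mp \<and> (\<forall>x\<in>\<Omega>. Im (\<phi> x) \<ge> 0) \<and>
     incident_field k ui \<and> (\<forall>x. norm (ui x) \<le> 1) \<and> C1_alpha_norm_le UNIV \<alpha> ui Mi \<and>
     scattered_field k (\<lambda>x. if x \<in> \<Omega> then \<phi> x else 0) ui us \<and>
     (SUP x\<in>frontier \<Omega>. norm (\<phi> x * ui x)) > \<C> * diameter \<Omega> powr \<alpha>
     \<longrightarrow> (\<forall>F. far_field k us F \<longrightarrow> (\<exists>\<omega>. norm \<omega> = 1 \<and> F \<omega> \<noteq> 0))"
proof -
  note n = assms(1) and Mp = assms(3) and Mi = assms(4) and k = assms(5) and \<alpha> = assms(6,7)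
  let ?n = "DIM('a)"
  let ?\<gamma> = "gauss_mass TYPE('a)"
  have \<gamma>: "?\<gamma> > 0" by (rule gauss_mass_pos)
  \<comment> \<open>The solution with value 1 at its centre; like all constants below, it is fixed
    before \<Omega>, \<phi> and the fields enter.\<close>
  obtain J where J: "radial_sol ?n k (\<lambda>s. 0) J" and J0: "J 0 0 = 1"
    using radial_sol_exists[OF n order_refl, of k 0 1] by auto
  have dJ: "(J m has_real_derivative J (Suc m) s) (at s)" for m s
    using J by (auto simp: radial_sol_def derivs_def)
  have "continuous_on {0..1} (J 1)"
    using dJ[of 1] by (meson DERIV_isCont continuous_at_imp_continuous_on)
  then have "bounded (J 1 ` {0..1})"
    by (intro compact_imp_bounded compact_continuous_image) auto
  then obtain K0 where K0: "\<And>s. s \<in> {0..1} \<Longrightarrow> \<bar>J 1 s\<bar> \<le> K0"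
    unfolding bounded_iff by (metis image_eqI real_norm_def)
  define KJ where "KJ = \<bar>K0\<bar>"
  have KJ: "KJ \<ge> 0" by (simp add: KJ_def)
  have JK: "\<bar>J 0 s - 1\<bar> \<le> KJ * s" if s: "0 \<le> s" "s \<le> 1" for s
  proof (cases "s = 0")
    case False
    obtain t where t: "0 < t" "t < s" "J 0 s - J 0 0 = (s - 0) * J 1 t"
      using MVT2[of 0 s "J 0" "J 1"] dJ[of 0] s False by auto
    have "\<bar>J 1 t\<bar> \<le> KJ" using K0[of t] t s by (simp add: KJ_def)
    then have "s * \<bar>J 1 t\<bar> \<le> s * KJ" using s(1) by (rule mult_left_mono)
    then show ?thesis using t J0 s by (simp add: abs_mult mult.commute)
  qed (simp add: J0)
  \<comment> \<open>The bound 1 keeps the square of \<delta> in the interval where J' is controlled,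
    1/(2k) gives k^2 \<delta>^2 \<le> 1/2, and 1/(2(KJ + 1)) gives |J - 1| \<le> 1/2 up to
    \<delta>^2, hence J \<noteq> 0 there.\<close>
  define \<delta> where "\<delta> = min 1 (min (1 / (2 * k)) (1 / (2 * (KJ + 1))))"
  have \<delta>: "\<delta> > 0" "\<delta> \<le> 1" using k KJ by (auto simp: \<delta>_def)
  have k\<delta>: "k\<^sup>2 * \<delta>\<^sup>2 \<le> 1 / 2"
  proof -
    have "\<delta> \<le> 1 / (2 * k)" by (simp add: \<delta>_def)
    then have "k * \<delta> \<le> 1 / 2" using k by (simp add: pos_le_divide_eq mult_ac)
    then have "(k * \<delta>)\<^sup>2 \<le> (1 / 2)\<^sup>2" using k \<delta> by (intro power_mono) auto
    then show ?thesis by (simp add: power_mult_distrib power2_eq_square[of "1 / 2 :: real"])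
  qed
  have \<delta>2: "\<delta>\<^sup>2 \<le> 1" "\<delta>\<^sup>2 \<le> \<delta>"
    using \<delta> by (simp add: power_le_one, simp add: power2_eq_square mult_left_le_one_le)
  have K\<delta>: "KJ * \<delta>\<^sup>2 \<le> 1 / 2"
  proof -
    have "\<delta> \<le> 1 / (2 * (KJ + 1))" by (simp add: \<delta>_def)
    then have "(KJ + 1) * \<delta> \<le> 1 / 2" using KJ by (simp add: pos_le_divide_eq mult_ac)
    moreover have "KJ * \<delta>\<^sup>2 \<le> (KJ + 1) * \<delta>" using KJ \<delta>2 \<delta> by (intro mult_mono) auto
    ultimately show ?thesis by linarith
  qed
  have J\<delta>: "J 0 (\<delta>\<^sup>2) \<noteq> 0" using JK[of "\<delta>\<^sup>2"] \<delta>2 K\<delta> by auto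
  have JK': "\<bar>J 0 s - 1\<bar> \<le> KJ * s" if "0 \<le> s" "s \<le> \<delta>\<^sup>2" for s using JK[of s] that \<delta>2 by simp
  have K\<delta>': "KJ * \<delta>\<^sup>2 \<le> 1" using K\<delta> by simp
  define C5 where "C5 = 8 * (1 + fact ?n) * \<delta> * (2 ^ ?n * measure lborel (ball (0::'a) 1)) * (k\<^sup>2 * Mp) / ?\<gamma>"
  have C5: "?\<gamma> * C5 = 8 * (1 + fact ?n) * \<delta> * (2 ^ ?n * measure lborel (ball (0::'a) 1)) * (k\<^sup>2 * Mp)"
    using \<gamma> by (simp add: C5_def)
  have C50: "C5 \<ge> 0" using \<gamma> Mp \<delta> by (simp add: C5_def)
  \<comment> \<open>Up to this diameter C5 d \<le> 1/2, so that \<open>boundary_bound_small\<close>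
    applies.\<close>
  define \<delta>1 where "\<delta>1 = min \<delta> (1 / (2 * C5 + 1))"
  have \<delta>1: "\<delta>1 > 0" using \<delta> C50 by (simp add: \<delta>1_def)
  define C0 where "C0 = Mp + Mp * Mi + Mp * KJ + 4 * Mp * C5"
  \<comment> \<open>\<open>C0\<close> serves diameters up to \<delta>1. For larger ones (diam /
    \<delta>1)^\<alpha> is at least 1, so the second summand alone dominates the trivial bound
    Mp.\<close>
  define \<C> where "\<C> = C0 + Mp / \<delta>1 powr \<alpha>"
  have C0: "C0 > 0" unfolding C0_def using Mp Mi KJ C50 by (intro add_pos_nonneg) auto
  have Cb: "Mp / \<delta>1 powr \<alpha> > 0" using Mp \<delta>1 by simp
  show ?thesis
  proof (intro exI[of _ \<C>] conjI allI impI)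
    show "\<C> > 0" using C0 Cb by (simp add: \<C>_def)
    fix \<Omega> :: "'a set" and \<phi> ui us F
    assume A: "lipschitz_domain \<Omega> \<and> bounded \<Omega> \<and> diameter \<Omega> \<le> D \<and> connected (- closure \<Omega>) \<and>
     C_alpha UNIV \<alpha> \<phi> \<and> C_alpha_norm_le (closure \<Omega>) \<alpha> \<phi> Mp \<and> (\<forall>x\<in>\<Omega>. Im (\<phi> x) \<ge> 0) \<and>
     incident_field k ui \<and> (\<forall>x. norm (ui x) \<le> 1) \<and> C1_alpha_norm_le UNIV \<alpha> ui Mi \<and>
     scattered_field k (\<lambda>x. if x \<in> \<Omega> then \<phi> x else 0) ui us \<and>
     (SUP x\<in>frontier \<Omega>. norm (\<phi> x * ui x)) > \<C> * diameter \<Omega> powr \<alpha>"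
      and F: "far_field k us F"
    have \<Omega>: "open \<Omega>" "bounded \<Omega>" "\<Omega> \<noteq> {}" using A by (auto simp: lipschitz_domain_def)
    have sc: "scattered_field k (\<lambda>x. if x \<in> \<Omega> then \<phi> x else 0) ui us" and inc: "incident_field k ui"
      and ui1: "\<And>x. norm (ui x) \<le> 1" and uiL: "C1_alpha_norm_le UNIV \<alpha> ui Mi"
      and \<phi>C: "C_alpha UNIV \<alpha> \<phi>"
      using A by auto
    obtain M1 M2 where M12: "0 \<le> M1" "0 \<le> M2" "M1 + M2 \<le> Mp"
      and M1: "\<And>x. x \<in> closure \<Omega> \<Longrightarrow> norm (\<phi> x) \<le> M1"
      and M2: "\<And>x y. x \<in> closure \<Omega> \<Longrightarrow> y \<in> closure \<Omega> \<Longrightarrow> norm (\<phi> x - \<phi> y) \<le> M2 * dist x y powr \<alpha>"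
      using A unfolding C_alpha_norm_le_def sup_bound_def holder_bound_def by blast
    have \<phi>b: "norm (\<phi> x) \<le> Mp" if "x \<in> closure \<Omega>" for x using M1[OF that] M12 by linarith
    have \<phi>h: "norm (\<phi> x - \<phi> y) \<le> Mp * dist x y powr \<alpha>" if "x \<in> closure \<Omega>" "y \<in> closure \<Omega>" for x y
    proof -
      have "M2 * dist x y powr \<alpha> \<le> Mp * dist x y powr \<alpha>" using M12 by (intro mult_right_mono) auto
      then show ?thesis using M2[OF that] by linarith
    qed
    have cui: "continuous_on UNIV ui" using inc by (simp add: incident_field_def smooth_continuous_on)
    have c\<phi>: "continuous_on UNIV \<phi>" by (rule holder_continuous[OF \<phi>C \<alpha>(1)])
    have d0: "diameter \<Omega> > 0" by (rule diameter_pos_open[OF \<Omega>])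
    show "\<exists>\<omega>. norm \<omega> = 1 \<and> F \<omega> \<noteq> 0"
    proof (rule ccontr)
      assume "\<nexists>\<omega>. norm \<omega> = 1 \<and> F \<omega> \<noteq> 0"
      then have F0: "F \<omega> = 0" if "norm \<omega> = 1" for \<omega> using that by blast
      have L2: "L2loc us" using sc by (auto simp: scattered_field_def H2loc_def H2_weak_def)
      then have usm: "us \<in> borel_measurable lebesgue" by (simp add: L2loc_def)
      obtain v where v: "v \<in> borel_measurable borel" "AE x in lborel. us x = v x"
        by (rule lebesgue_measurable_borel_version[OF usm])
      have vl: "locally_integrable v" by (rule locally_integrable_L2loc[OF L2 v])
      have vv: "vanishes_at_infinity v" by (rule far_field_zero_vanishes[OF F F0 v(2) n])
      define q where "q = (\<lambda>x. of_real (k\<^sup>2) * (if x \<in> \<Omega> then \<phi> x else 0) * (ui x + v x))"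
      have V: "(\<lambda>x. if x \<in> \<Omega> then \<phi> x else 0) \<in> borel_measurable borel"
        by (intro measurable_If_set borel_measurable_continuous_onI[OF c\<phi>]) (use \<Omega> in auto)
      have weak: "(LBINT x. v x * of_real (laplacian \<psi> x + k\<^sup>2 * \<psi> x))
        + (LBINT x. q x * of_real (\<psi> x)) = 0" if "integrable lborel q" "test_fn \<psi>" for \<psi>
        by (rule scattered_weak_identity[OF sc inc usm vl v(2) V that(1) _ that(2)]) (simp add: q_def)
      have bd: "norm (\<phi> z * ui z) \<le> \<C> * diameter \<Omega> powr \<alpha>" if z: "z \<in> frontier \<Omega>" for z
      proof (cases "diameter \<Omega> \<le> \<delta>1")
        case True
        have d1: "diameter \<Omega> \<le> \<delta>" "diameter \<Omega> \<le> 1" using True \<delta> by (auto simp: \<delta>1_def)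
        have "C5 * diameter \<Omega> \<le> C5 * (1 / (2 * C5 + 1))"
          using True C50 by (intro mult_left_mono) (auto simp: \<delta>1_def)
        also have "\<dots> \<le> 1 / 2" using C50 by (simp add: pos_divide_le_eq)
        finally have C5d: "C5 * diameter \<Omega> \<le> 1 / 2" .
        have "norm (\<phi> z * ui z) \<le> C0 * diameter \<Omega> powr \<alpha>"
          unfolding C0_def
          by (rule boundary_bound_small[OF n k less_imp_le[OF Mp] less_imp_le[OF Mi] \<alpha> vl vv \<Omega> c\<phi> \<phi>b \<phi>h cui ui1
                C1_alpha_lipschitz[OF uiL] q_def[THEN fun_cong] weak J J\<delta> JK' KJ K\<delta>' refl d1 k\<delta> C5 C5d z])
        also have "\<dots> \<le> \<C> * diameter \<Omega> powr \<alpha>"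
          using Cb by (intro mult_right_mono) (auto simp: \<C>_def)
        finally show ?thesis .
      next
        case False
        have "norm (\<phi> z) * norm (ui z) \<le> Mp * 1"
          using \<phi>b[of z] z ui1[of z] Mp by (intro mult_mono) (auto simp: frontier_def)
        also have "\<dots> = Mp / \<delta>1 powr \<alpha> * \<delta>1 powr \<alpha>" using \<delta>1 by simp
        also have "\<dots> \<le> Mp / \<delta>1 powr \<alpha> * diameter \<Omega> powr \<alpha>"
          using False \<delta>1 \<alpha> Cb by (intro mult_left_mono powr_mono2) auto
        also have "\<dots> \<le> \<C> * diameter \<Omega> powr \<alpha>"
          using C0 by (intro mult_right_mono) (auto simp: \<C>_def)
        finally show ?thesis by (simp add: norm_mult)
      qed
      \<comment> \<open>\<open>cSUP_least\<close> asks for a nonempty index set: a nonempty bounded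
        set is not the whole space, so its frontier is not empty.\<close>
      have "frontier \<Omega> \<noteq> {}"
        using \<Omega> not_bounded_UNIV frontier_eq_empty[of \<Omega>] by auto
      then have "(SUP x\<in>frontier \<Omega>. norm (\<phi> x * ui x)) \<le> \<C> * diameter \<Omega> powr \<alpha>"
        by (rule cSUP_least) (rule bd)
      then show False using A by linarith
    qed
  qed
qed

end
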